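(* Let $\tau>d$ and suppose that the kernel $K(x,y)=\Phi(x-y)$ on $\mathbb{R}^d$ satisfies $\hat\Phi(\omega)=\Theta\big((1+\|\omega\|_2^{\tau})^{-1}\big)$ for $\omega\in\mathbb{R}^d$, i.e. there are constants $0<c\le C$ with $c\,(1+\|\omega\|_2^{\tau})^{-1}\le\hat\Phi(\omega)\le C\,(1+\|\omega\|_2^{\tau})^{-1}$ for all $\omega\in\mathbb{R}^d$. Then the bump norm function satisfies $$\beta(r)=\|b_r^*\|_K=\Theta\big(r^{d/2-\tau/2}\big)\quad\text{for } r\to 0,$$ i.e. there are constants $0<c'\le C'$ and $r_0>0$ such that $c'\,r^{d/2-\tau/2}\le\beta(r)\le C'\,r^{d/2-\tau/2}$ for all $0<r\le r_0$. In particular, in the Sobolev space $H_2^m(\mathbb{R}^d)$ with $m>d/2$ this holds with $\tau=2m$.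
   Context: $K$ is a continuous symmetric positive definite translation-invariant real-valued kernel on $\mathbb{R}^d\times\mathbb{R}^d$, written $K(x,y)=\Phi(x-y)$, and $\hat\Phi$ is the $d$-variate Fourier transform of $\Phi$. $\mathcal{K}$ is the native space of $K$, i.e. the Hilbert space of functions on $\mathbb{R}^d$ with norm $\|\cdot\|_K$ for which $K$ is the reproducing kernel. The set of bump functions of support radius $r>0$ is $\mathcal{B}_r:=\{b\in\mathcal{K} : b(0)=1,\ b(y)=0 \text{ for all } \|y\|_2\ge r\}$, the bump norm function is $\beta(r):=\inf\{\|b\|_K : b\in\mathcal{B}_r\}$, and $b_r^*\in\mathcal{B}_r$ is the unique element attaining this infimum. The Sobolev space $H_2^m(\mathbb{R}^d)$, $m>d/2$, is defined via Fourier transforms and is the native space of the Whittle-Matérn kernel $K(x,y)=\|x-y\|_2^{m-d/2}K_{m-d/2}(\|x-y\|_2)$ (up to a positive factor), where $K_\nu$ is the modified Bessel function of the second kind. *)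

theory Defs
  imports "HOL-Analysis.Analysis"
begin

text \<open>Reproducing kernel Hilbert spaces of real functions, given by a carrier and an inner product
  whose values matter on the carrier only.\<close>

definition pos_def_kernel :: "('a \<Rightarrow> 'a \<Rightarrow> real) \<Rightarrow> bool" where
  "pos_def_kernel K \<longleftrightarrow>
     (\<forall>X c. finite X \<and> (\<exists>x\<in>X. c x \<noteq> 0) \<longrightarrow> 0 < (\<Sum>x\<in>X. \<Sum>y\<in>X. c x * c y * K x y))"

definition ip_norm :: "(('a \<Rightarrow> real) \<Rightarrow> ('a \<Rightarrow> real) \<Rightarrow> real) \<Rightarrow> ('a \<Rightarrow> real) \<Rightarrow> real" where
  "ip_norm ip f = sqrt (ip f f)"

definition hilbert_function_space ::
    "('a \<Rightarrow> real) set \<Rightarrow> (('a \<Rightarrow> real) \<Rightarrow> ('a \<Rightarrow> real) \<Rightarrow> real) \<Rightarrow> bool" where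
  "hilbert_function_space H ip \<longleftrightarrow>
     (\<lambda>x. 0) \<in> H \<and>
     (\<forall>f\<in>H. \<forall>g\<in>H. (\<lambda>x. f x + g x) \<in> H) \<and>
     (\<forall>a. \<forall>f\<in>H. (\<lambda>x. a * f x) \<in> H) \<and>
     (\<forall>f\<in>H. \<forall>g\<in>H. ip f g = ip g f) \<and>
     (\<forall>f\<in>H. \<forall>g\<in>H. \<forall>h\<in>H. ip (\<lambda>x. f x + g x) h = ip f h + ip g h) \<and>
     (\<forall>a. \<forall>f\<in>H. \<forall>g\<in>H. ip (\<lambda>x. a * f x) g = a * ip f g) \<and>
     (\<forall>f\<in>H. 0 \<le> ip f f) \<and>
     (\<forall>f\<in>H. ip f f = 0 \<longrightarrow> f = (\<lambda>x. 0)) \<and>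
     (\<forall>s. (\<forall>n. s n \<in> H) \<and>
          (\<forall>e>0. \<exists>N::nat. \<forall>i\<ge>N. \<forall>j\<ge>N. ip_norm ip (\<lambda>x. s i x - s j x) < e) \<longrightarrow>
          (\<exists>f\<in>H. (\<lambda>n. ip_norm ip (\<lambda>x. s n x - f x)) \<longlonglongrightarrow> 0))"

definition native_space ::
    "('a \<Rightarrow> 'a \<Rightarrow> real) \<Rightarrow> ('a \<Rightarrow> real) set \<Rightarrow> (('a \<Rightarrow> real) \<Rightarrow> ('a \<Rightarrow> real) \<Rightarrow> real) \<Rightarrow> bool" where
  "native_space K H ip \<longleftrightarrow>
     hilbert_function_space H ip \<and>
     (\<forall>x. (\<lambda>y. K y x) \<in> H \<and> (\<forall>f\<in>H. f x = ip f (\<lambda>y. K y x)))"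

definition bumps :: "(real^'d \<Rightarrow> real) set \<Rightarrow> real \<Rightarrow> (real^'d \<Rightarrow> real) set" where
  "bumps H r = {b \<in> H. b 0 = 1 \<and> (\<forall>y. r \<le> norm y \<longrightarrow> b y = 0)}"

definition bump_norm ::
    "(real^'d \<Rightarrow> real) set \<Rightarrow> ((real^'d \<Rightarrow> real) \<Rightarrow> (real^'d \<Rightarrow> real) \<Rightarrow> real) \<Rightarrow> real \<Rightarrow> real" where
  "bump_norm H ip r = (INF b \<in> bumps H r. ip_norm ip b)"

definition optimal_bump ::
    "(real^'d \<Rightarrow> real) set \<Rightarrow> ((real^'d \<Rightarrow> real) \<Rightarrow> (real^'d \<Rightarrow> real) \<Rightarrow> real)
       \<Rightarrow> real \<Rightarrow> real^'d \<Rightarrow> real" where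
  "optimal_bump H ip r = (THE b. b \<in> bumps H r \<and> ip_norm ip b = bump_norm H ip r)"

text \<open>The Fourier transform is the one on \<open>L\<^sup>2\<close>: the limit, in \<open>L\<^sup>2\<close>, of the Fourier integrals of
  the truncations of \<open>f\<close> to balls of growing radius. It is determined almost everywhere, and by
  Plancherel's theorem it is the usual Fourier integral if \<open>f\<close> is also integrable. A transform that
  is only known to be comparable to \<open>1 / (1 + \<bar>\<omega>\<bar>\<^sup>\<tau>)\<close> need not belong to an integrable function,
  but for \<open>\<tau> > d\<close> it does belong to a square integrable one.\<close>

definition fourier_integral :: "(real^'d \<Rightarrow> real) \<Rightarrow> real^'d \<Rightarrow> complex" where
  "fourier_integral f \<omega> =
     complex_of_real ((2 * pi) powr (- real CARD('d) / 2)) *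
     (LINT x|lborel. complex_of_real (f x) * cis (- (x \<bullet> \<omega>)))"

definition is_fourier_transform :: "(real^'d \<Rightarrow> real) \<Rightarrow> (real^'d \<Rightarrow> complex) \<Rightarrow> bool" where
  "is_fourier_transform f F \<longleftrightarrow>
     f \<in> borel_measurable lborel \<and> integrable lborel (\<lambda>x. (f x)\<^sup>2) \<and>
     F \<in> borel_measurable lborel \<and> integrable lborel (\<lambda>\<omega>. (cmod (F \<omega>))\<^sup>2) \<and>
     ((\<lambda>R. \<integral>\<^sup>+ \<omega>. ennreal ((cmod (fourier_integral (\<lambda>x. indicator (cball 0 R) x * f x) \<omega> - F \<omega>))\<^sup>2)
             \<partial>lborel) \<longlongrightarrow> 0) at_top"

definition fourier_transform :: "(real^'d \<Rightarrow> real) \<Rightarrow> real^'d \<Rightarrow> complex" where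
  "fourier_transform f = (SOME F. is_fourier_transform f F)"

text \<open>The Sobolev space \<open>H\<^sub>2\<^sup>m\<close>, for \<open>m > d / 2\<close>: every class in it has exactly one continuous
  representative, which is taken as the element of the function space.\<close>

definition sobolev_space :: "real \<Rightarrow> (real^'d \<Rightarrow> real) set" where
  "sobolev_space m =
     {f. continuous_on UNIV f \<and> integrable lborel (\<lambda>x. (f x)\<^sup>2) \<and>
         integrable lborel (\<lambda>\<omega>. (1 + (norm \<omega>)\<^sup>2) powr m * (cmod (fourier_transform f \<omega>))\<^sup>2)}"

definition sobolev_inner :: "real \<Rightarrow> (real^'d \<Rightarrow> real) \<Rightarrow> (real^'d \<Rightarrow> real) \<Rightarrow> real" where
  "sobolev_inner m f g =
     (LINT \<omega>|lborel. (1 + (norm \<omega>)\<^sup>2) powr m *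
        Re (fourier_transform f \<omega> * cnj (fourier_transform g \<omega>)))"

end

theory Submission
  imports Defs "HOL-Probability.Characteristic_Functions"
begin

text \<open>
  Upper bound: if \<open>\<psi>\<close> is a bump function whose Fourier transform decays fast enough, then
  \<open>\<psi> (x / r)\<close> has support radius \<open>r\<close>, and rescaling the frequency variable in the integral of
  \<open>\<bar>F\<bar>\<^sup>2 / \<Phi>hat\<close>, where \<open>F\<close> is its transform, produces the factor \<open>r\<close> to the power \<open>d - \<tau>\<close>. By
  duality with point evaluations this integral bounds the squared norm in the native space.

  Lower bound: a bump \<open>b\<close> vanishes at the points \<open>j r e\<close> for \<open>j > 0\<close> and a unit vector \<open>e\<close>, so a
  \<open>k\<close>-th finite difference of \<open>b\<close> in direction \<open>e\<close> is just \<open>b 0 = 1\<close>. The squared norm of that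
  difference functional is the integral of \<open>\<Phi>hat\<close> against the 2\<open>k\<close>-th power of
  \<open>\<bar>1 - cis (r (e \<bullet> \<omega>))\<bar>\<close>, which for \<open>2 k \<ge> \<tau>\<close> is at most a constant times \<open>r\<close> to the power \<open>\<tau> - d\<close>.

  Both bounds only need that \<open>K\<close> is the inverse Fourier integral of \<open>\<Phi>hat\<close>, so the Sobolev space is
  covered by exhibiting it as a native space.
\<close>

section \<open>The Fourier transform of integrable functions\<close>

text \<open>The native space is accessible only through its reproducing property, so norms are
  reached through finite combinations of point evaluations. Cauchy-Schwarz against such a
  combination gives lower bounds. Its converse gives upper bounds: a function whose combinations of
  values obey that inequality with a constant \<open>M\<close> lies in the space and has norm at
  most \<open>M\<close>. Both turn into estimates for L2 functions of the frequency once the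
  quadratic form of \<open>K\<close> is an integral against a spectral density. The obstacle is that
  \<open>\<Phi>hat\<close> is given only as an L2 transform and only up to constants, so nothing can
  be computed from a formula: that \<open>K\<close> is an inverse Fourier integral at every point
  has to be derived from the integrability of \<open>\<Phi>hat\<close>, where
  \<open>\<tau> > d\<close> enters, and from continuity. The order of the difference is dictated by
  low frequencies: after rescaling, the density approaches a multiple of
  \<open>norm \<xi> powr (- \<tau>)\<close> as \<open>r\<close> tends to 0, and a zero of order at
  least \<open>\<tau>\<close> at the origin cancels this singularity uniformly in
  \<open>r\<close>.\<close>

lemma lborel_integrable_affine:
  fixes f :: "'a::euclidean_space \<Rightarrow> 'b::{banach, second_countable_topology}"
  assumes "c \<noteq> 0" "integrable lborel f"
  shows "integrable lborel (\<lambda>x. f (t + c *\<^sub>R x))"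
proof -
  have "integrable (density (distr lborel borel (\<lambda>x. t + c *\<^sub>R x)) (\<lambda>_. ennreal (\<bar>c\<bar>^DIM('a)))) f"
    using assms(2) lborel_affine[OF assms(1), of t] by simp
  moreover have [measurable]: "f \<in> borel_measurable borel"
    using assms(2) by auto
  ultimately have "integrable lborel (\<lambda>x. \<bar>c\<bar> ^ DIM('a) *\<^sub>R f (t + c *\<^sub>R x))"
    by (simp add: integrable_density integrable_distr_eq)
  from integrable_scaleR_right[OF this, of "inverse (\<bar>c\<bar> ^ DIM('a))"] show ?thesis
    using assms(1) by simp
qed

lemma lborel_integral_affine:
  fixes f :: "'a::euclidean_space \<Rightarrow> 'b::{banach, second_countable_topology}"
  assumes c: "c \<noteq> 0"
  shows "(LINT x|lborel. f x) = \<bar>c\<bar>^DIM('a) *\<^sub>R (LINT x|lborel. f (t + c *\<^sub>R x))"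
proof cases
  assume f: "integrable lborel f"
  then have [measurable]: "f \<in> borel_measurable borel" by auto
  show ?thesis
    by (subst lborel_affine[OF c, of t]) (simp add: integral_density integral_distr)
next
  \<comment> \<open>A non-integrable function has integral 0 by convention, so the formula persists
    once non-integrability is carried through the substitution by inverting it.\<close>
  assume *: "\<not> integrable lborel f"
  have "\<not> integrable lborel (\<lambda>x. f (t + c *\<^sub>R x))"
  proof
    assume "integrable lborel (\<lambda>x. f (t + c *\<^sub>R x))"
    from lborel_integrable_affine[OF _ this, of "1/c" "- (t /\<^sub>R c)"] * show False
      using c by (simp add: algebra_simps)
  qed
  with * show ?thesis by (simp add: not_integrable_integral_eq)
qed

lemma lborel_nn_integral_affine:
  fixes f :: "'a::euclidean_space \<Rightarrow> ennreal"
  assumes [measurable]: "f \<in> borel_measurable borel" and c: "c \<noteq> 0"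
  shows "(\<integral>\<^sup>+x. f x \<partial>lborel) = ennreal (\<bar>c\<bar>^DIM('a)) * (\<integral>\<^sup>+x. f (t + c *\<^sub>R x) \<partial>lborel)"
  by (subst lborel_affine[OF c, of t])
     (simp add: nn_integral_density nn_integral_distr nn_integral_cmult)

lemma borel_measurable_cis [measurable]: "cis \<in> borel_measurable borel"
  by (intro borel_measurable_continuous_onI continuous_intros)

lemma borel_measurable_cnj [measurable]: "cnj \<in> borel_measurable borel"
  by (intro borel_measurable_continuous_onI continuous_intros)

lemma isCont_cis: "isCont cis t"
  using continuous_on_cis[OF continuous_on_id, of UNIV] by (simp add: continuous_on_eq_continuous_at)

lemma integrable_mult_cis:
  fixes f :: "'a::euclidean_space \<Rightarrow> complex"
  assumes f: "integrable lborel f" and g: "g \<in> borel_measurable borel"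
  shows "integrable lborel (\<lambda>x. f x * cis (g x))"
proof (rule Bochner_Integration.integrable_bound[OF f])
  show "(\<lambda>x. f x * cis (g x)) \<in> borel_measurable lborel"
    using f g by measurable
qed (simp add: norm_mult)

text \<open>The unitary normalisation: Plancherel's theorem gets the constant 1 and the inverse
  transform is \<open>ft\<close> at the reflected argument, so one operator serves both directions.
  With complex values \<open>ft\<close> can be applied to its own output.\<close>

definition ft :: "('a::euclidean_space \<Rightarrow> complex) \<Rightarrow> 'a \<Rightarrow> complex" where
  "ft f \<omega> = complex_of_real ((2 * pi) powr (- real DIM('a) / 2)) *
     (LINT x|lborel. f x * cis (- (x \<bullet> \<omega>)))"

lemma borel_measurable_ft [measurable]:
  fixes f :: "'a::euclidean_space \<Rightarrow> complex"
  assumes [measurable]: "f \<in> borel_measurable borel"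
  shows "ft f \<in> borel_measurable borel"
  unfolding ft_def by measurable

lemma norm_ft_le:
  fixes f :: "'a::euclidean_space \<Rightarrow> complex"
  shows "cmod (ft f \<omega>) \<le> (2 * pi) powr (- real DIM('a) / 2) * (LINT x|lborel. cmod (f x))"
  unfolding ft_def norm_mult
  by (intro mult_mono order_trans[OF integral_norm_bound]) (auto simp: norm_mult)

lemma continuous_on_ft:
  fixes f :: "'a::euclidean_space \<Rightarrow> complex"
  assumes f: "integrable lborel f"
  shows "continuous_on S (ft f)"
proof -
  have [measurable]: "f \<in> borel_measurable borel" using f by auto
  have "(\<lambda>n. ft f (s n)) \<longlonglongrightarrow> ft f w" if s: "s \<longlonglongrightarrow> w" for s w
    unfolding ft_def
  proof (intro tendsto_mult tendsto_const integral_dominated_convergence[where w="\<lambda>x. cmod (f x)"])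
    show "AE x in lborel. (\<lambda>n. f x * cis (- (x \<bullet> s n))) \<longlonglongrightarrow> f x * cis (- (x \<bullet> w))"
      using s by (intro AE_I2 tendsto_mult tendsto_const isCont_tendsto_compose[of _ cis]
          tendsto_minus tendsto_inner isCont_cis)
  qed (use f in \<open>auto simp: norm_mult\<close>)
  then show ?thesis
    by (auto simp: continuous_on_sequentially o_def)
qed

lemma ft_eq_AE:
  fixes f g :: "'a::euclidean_space \<Rightarrow> complex"
  assumes "AE x in lborel. f x = g x"
    and [measurable]: "f \<in> borel_measurable borel" "g \<in> borel_measurable borel"
  shows "ft f = ft g"
proof
  fix w
  have "(LINT x|lborel. f x * cis (- (x \<bullet> w))) = (LINT x|lborel. g x * cis (- (x \<bullet> w)))"
    by (rule integral_cong_AE) (use assms(1) in auto)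
  then show "ft f w = ft g w" by (simp add: ft_def)
qed

lemma ft_add:
  assumes "integrable lborel f" "integrable lborel g"
  shows "ft (\<lambda>x. f x + g x) w = ft f w + ft g w"
  unfolding ft_def
  by (simp add: distrib_right integrable_mult_cis[OF assms(1)] integrable_mult_cis[OF assms(2)]
      algebra_simps)

lemma ft_diff:
  assumes "integrable lborel f" "integrable lborel g"
  shows "ft (\<lambda>x. f x - g x) w = ft f w - ft g w"
  unfolding ft_def
  by (simp add: left_diff_distrib integrable_mult_cis[OF assms(1)] integrable_mult_cis[OF assms(2)]
      right_diff_distrib)

lemma ft_cmult: "ft (\<lambda>x. c * f x) w = c * ft f w"
  unfolding ft_def by (simp add: mult.assoc) 

text \<open>The multiplication formula, from Fubini: the adjoint of \<open>ft\<close> is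
  \<open>ft\<close> followed by a reflection. Plancherel, inversion and the cross terms of L2
  estimates start from it with a suitable \<open>g\<close>.\<close>

lemma integral_cnj_ft_mult:
  fixes f g :: "'a::euclidean_space \<Rightarrow> complex"
  assumes f: "integrable lborel f" and g: "integrable lborel g"
  shows "(LINT w|lborel. cnj (ft f w) * g w) = (LINT x|lborel. cnj (f x) * ft g (- x))"
proof -
  let ?C = "complex_of_real ((2 * pi) powr (- real DIM('a) / 2))"
  have [measurable]: "f \<in> borel_measurable borel" "g \<in> borel_measurable borel" using f g by auto
  let ?h = "\<lambda>x w. cnj (f x) * (g w * cis (x \<bullet> w))"
  have int: "integrable (lborel \<Otimes>\<^sub>M lborel) (\<lambda>(x, w). ?h x w)"
  proof (rule lborel_pair.Fubini_integrable)
    show "integrable lborel (\<lambda>x. LINT y|lborel. norm (case (x, y) of (x, w) \<Rightarrow> ?h x w))"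
      using f by (simp add: norm_mult)
    show "AE x in lborel. integrable lborel (\<lambda>y. case (x, y) of (x, w) \<Rightarrow> ?h x w)"
      using g by (auto intro!: AE_I2 integrable_mult_right integrable_mult_cis)
  qed measurable
  have "(LINT w|lborel. cnj (ft f w) * g w) = (LINT w|lborel. (LINT x|lborel. ?C * ?h x w))"
  proof (intro Bochner_Integration.integral_cong refl)
    fix w
    have "cnj (ft f w) = ?C * (LINT x|lborel. cnj (f x * cis (- (x \<bullet> w))))"
      unfolding ft_def Bochner_Integration.integral_cnj by simp
    then show "cnj (ft f w) * g w = (LINT x|lborel. ?C * ?h x w)"
      by (simp add: cis_cnj mult_ac flip: integral_mult_left_zero integral_mult_right_zero)
  qed
  also have "\<dots> = (LINT x|lborel. (LINT w|lborel. ?C * ?h x w))"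
    by (rule lborel_pair.Fubini_integral)
      (use integrable_mult_right[OF int, of ?C] in \<open>simp add: split_beta'\<close>)
  also have "\<dots> = (LINT x|lborel. cnj (f x) * ft g (- x))"
    unfolding ft_def
    by (intro Bochner_Integration.integral_cong refl) (simp only: integral_mult_right_zero, simp add: mult_ac inner_commute)
  finally show ?thesis .
qed

section \<open>Gaussians\<close>

definition gauss :: "'a::euclidean_space \<Rightarrow> real" where
  "gauss x = exp (- (norm x)\<^sup>2 / 2)"

text \<open>In one dimension the transform of the Gaussian is the characteristic function of the
  standard normal distribution, up to the factor \<open>sqrt (2 * pi)\<close>.\<close>

lemma gauss_1d:
  shows "integrable lborel (\<lambda>x::real. complex_of_real (exp (- x\<^sup>2 / 2)) * cis (t * x))"
    and "(LINT x|lborel. complex_of_real (exp (- x\<^sup>2 / 2)) * cis (t * x)) =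
      complex_of_real (sqrt (2 * pi) * exp (- t\<^sup>2 / 2))"
proof -
  have *: "exp (- x\<^sup>2 / 2) = sqrt (2 * pi) * std_normal_density x" for x
    by (simp add: std_normal_density_def)
  have "integrable lborel (\<lambda>x. complex_of_real (sqrt (2 * pi) * std_normal_density x))"
    by (intro integrable_of_real integrable_mult_right integrable_normal_density) simp
  from integrable_mult_cis[OF this, of "\<lambda>x. t * x"]
  show "integrable lborel (\<lambda>x::real. complex_of_real (exp (- x\<^sup>2 / 2)) * cis (t * x))"
    unfolding * by simp
  have "char std_normal_distribution t = (LINT x|lborel. std_normal_density x *\<^sub>R iexp (t * x))"
    unfolding char_def by (subst integral_density) auto
  also have "\<dots> = (LINT x|lborel. complex_of_real (std_normal_density x) * cis (t * x))"
    by (simp add: scaleR_conv_of_real cis_conv_exp)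
  finally have "(LINT x|lborel. complex_of_real (std_normal_density x) * cis (t * x)) = exp (- t\<^sup>2 / 2)"
    using char_std_normal_distribution by (simp add: fun_eq_iff)
  then show "(LINT x|lborel. complex_of_real (exp (- x\<^sup>2 / 2)) * cis (t * x)) =
      complex_of_real (sqrt (2 * pi) * exp (- t\<^sup>2 / 2))"
    unfolding * by (simp add: mult.assoc)
qed

lemma gauss_prod: "gauss x = (\<Prod>b\<in>Basis. exp (- (x \<bullet> b)\<^sup>2 / 2))"
proof -
  have "(norm x)\<^sup>2 = (\<Sum>b\<in>Basis. (x \<bullet> b)\<^sup>2)"
    unfolding power2_norm_eq_inner by (subst euclidean_inner) (simp add: power2_eq_square)
  then show ?thesis
    by (simp add: gauss_def exp_sum[symmetric] sum_negf sum_divide_distrib)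
qed

lemma cis_sum: "finite A \<Longrightarrow> cis (sum f A) = (\<Prod>a\<in>A. cis (f a))"
  by (induction A rule: finite_induct) (auto simp: cis_mult[symmetric])

text \<open>Lebesgue measure is the image of a finite product of one-dimensional ones under the
  coordinate map; this lifts \<open>gauss_1d\<close> to all dimensions.\<close>

lemma lborel_integral_prod:
  fixes f :: "'a::euclidean_space \<Rightarrow> real \<Rightarrow> complex"
  assumes int: "\<And>b. b \<in> Basis \<Longrightarrow> integrable lborel (f b)"
  shows "integrable lborel (\<lambda>x. \<Prod>b\<in>Basis. f b (x \<bullet> b))"
    and "(LINT x|lborel. (\<Prod>b\<in>Basis. f b (x \<bullet> b))) = (\<Prod>b\<in>Basis. LINT t|lborel. f b t)"
proof -
  interpret product_sigma_finite "\<lambda>_. lborel" ..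
  have [measurable]: "b \<in> Basis \<Longrightarrow> f b \<in> borel_measurable borel" for b
    using int[of b] by auto
  let ?T = "\<lambda>u. \<Sum>b\<in>Basis. u b *\<^sub>R b"
  have T: "?T \<in> (\<Pi>\<^sub>M b\<in>Basis. lborel) \<rightarrow>\<^sub>M borel" by measurable
  have eq: "(\<lambda>u. \<Prod>b\<in>Basis. f b (?T u \<bullet> b)) = (\<lambda>u. \<Prod>b\<in>Basis. f b (u b))"
    by (intro ext prod.cong refl) (simp add: inner_sum_left inner_Basis if_distrib cong: if_cong)
  show "integrable lborel (\<lambda>x. \<Prod>b\<in>Basis. f b (x \<bullet> b))"
    by (subst lborel_eq, subst integrable_distr_eq[OF T]) 
       (auto simp: eq intro!: product_integrable_prod int)
  show "(LINT x|lborel. (\<Prod>b\<in>Basis. f b (x \<bullet> b))) = (\<Prod>b\<in>Basis. LINT t|lborel. f b t)"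
    by (subst (1) lborel_eq, subst integral_distr[OF T]) 
       (auto simp: eq intro!: product_integral_prod int)
qed

lemma gauss_cis:
  fixes w :: "'a::euclidean_space"
  shows "integrable lborel (\<lambda>x::'a. complex_of_real (gauss x) * cis (x \<bullet> w))"
    and "(LINT x|lborel. complex_of_real (gauss x) * cis (x \<bullet> w)) =
      complex_of_real ((2 * pi) powr (real DIM('a) / 2) * gauss w)"
proof -
  let ?f = "\<lambda>b t. complex_of_real (exp (- t\<^sup>2 / 2)) * cis ((w \<bullet> b) * t)"
  have eq: "complex_of_real (gauss x) * cis (x \<bullet> w) = (\<Prod>b\<in>Basis. ?f b (x \<bullet> b))" for x
  proof -
    have "cis (x \<bullet> w) = (\<Prod>b\<in>Basis. cis ((w \<bullet> b) * (x \<bullet> b)))"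
      by (subst euclidean_inner) (simp add: cis_sum mult.commute)
    then show ?thesis by (simp add: gauss_prod prod.distrib)
  qed
  show "integrable lborel (\<lambda>x::'a. complex_of_real (gauss x) * cis (x \<bullet> w))"
    unfolding eq by (intro lborel_integral_prod gauss_1d)
  have "(LINT x|lborel. complex_of_real (gauss x) * cis (x \<bullet> w)) =
     (\<Prod>b\<in>Basis. complex_of_real (sqrt (2 * pi) * exp (- (w \<bullet> b)\<^sup>2 / 2)))"
    unfolding eq by (subst lborel_integral_prod[OF gauss_1d(1)]) (simp only: gauss_1d(2))
  also have "\<dots> = complex_of_real (sqrt (2 * pi) ^ DIM('a) * gauss w)"
    by (simp add: prod.distrib gauss_prod)
  also have "sqrt (2 * pi) ^ DIM('a) = (2 * pi) powr (real DIM('a) / 2)"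
    by (simp add: powr_half_sqrt[symmetric] powr_powr flip: powr_realpow)
  finally show "(LINT x|lborel. complex_of_real (gauss x) * cis (x \<bullet> w)) =
      complex_of_real ((2 * pi) powr (real DIM('a) / 2) * gauss w)" .
qed

lemma gauss_pos: "0 < gauss x" and gauss_le_1: "gauss x \<le> 1" and gauss_0 [simp]: "gauss 0 = 1"
  and gauss_minus [simp]: "gauss (- x) = gauss x"
  by (auto simp: gauss_def)

lemma gauss_nonneg [simp]: "0 \<le> gauss x"
  by (simp add: gauss_def)

lemma abs_gauss [simp]: "\<bar>gauss x\<bar> = gauss x"
  using gauss_pos[of x] by simp

lemma borel_measurable_gauss [measurable]: "gauss \<in> borel_measurable borel"
  unfolding gauss_def by measurable

lemma isCont_gauss: "isCont gauss x"
  unfolding gauss_def by (intro continuous_intros) auto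

lemma integrable_gauss: "integrable lborel (gauss :: 'a::euclidean_space \<Rightarrow> real)"
  and integral_gauss: "(LINT x|lborel. gauss (x::'a)) = (2 * pi) powr (real DIM('a) / 2)"
proof -
  have i: "integrable lborel (\<lambda>x::'a. complex_of_real (gauss x))"
    using gauss_cis(1)[of 0] by simp
  then show "integrable lborel (gauss :: 'a \<Rightarrow> real)"
    by (simp add: complex_of_real_integrable_eq)
  have "(LINT x|lborel. complex_of_real (gauss (x::'a))) = complex_of_real ((2 * pi) powr (real DIM('a) / 2))"
    using gauss_cis(2)[of "0::'a"] by simp
  then show "(LINT x|lborel. gauss (x::'a)) = (2 * pi) powr (real DIM('a) / 2)"
    by (simp only: integral_complex_of_real of_real_eq_iff)
qed

lemma integrable_gauss_scaled:
  assumes "e > 0"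
  shows "integrable lborel (\<lambda>x::'a::euclidean_space. gauss (e *\<^sub>R x))"
  using lborel_integrable_affine[OF _ integrable_gauss, of e 0] assms by simp

lemma powr_pi_inverse: "(2 * pi) powr (- real n / 2) * (2 * pi) powr (real n / 2) = 1"
  by (simp add: powr_add[symmetric])

lemma integrable_bounded_mult:
  fixes f g :: "'a \<Rightarrow> complex"
  assumes f: "integrable M f" and g: "g \<in> borel_measurable M" and b: "\<And>x. cmod (g x) \<le> B"
  shows "integrable M (\<lambda>x. g x * f x)"
proof (rule Bochner_Integration.integrable_bound[of _ "\<lambda>x. B * cmod (f x)"])
  show "AE x in M. cmod (g x * f x) \<le> norm (B * cmod (f x))"
    using b order_trans[OF norm_ge_zero b] by (auto simp: norm_mult mult_right_mono)
qed (use f g in auto)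

text \<open>Modulation by \<open>w\<close> centres the transform at \<open>w\<close>, and dilation
  by \<open>e\<close> makes it an approximate identity of width \<open>e\<close>, up to a constant
  mass. Hence Gaussian damping on one side is mollification on the other.\<close>

lemma ft_gauss:
  fixes w \<xi> :: "'a::euclidean_space"
  assumes e: "e > 0"
  shows "ft (\<lambda>x. complex_of_real (gauss (e *\<^sub>R x)) * cis (x \<bullet> w)) \<xi> =
    complex_of_real (gauss ((w - \<xi>) /\<^sub>R e) / e ^ DIM('a))"
proof -
  have "(LINT x|lborel. complex_of_real (gauss (e *\<^sub>R x)) * cis (x \<bullet> w) * cis (- (x \<bullet> \<xi>)))
      = (LINT x|lborel. complex_of_real (gauss (e *\<^sub>R x)) * cis (x \<bullet> (w - \<xi>)))"
    by (simp add: mult.assoc cis_mult inner_diff_right)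
  also have "\<dots> = (LINT x|lborel. complex_of_real (gauss x) * cis (x \<bullet> ((w - \<xi>) /\<^sub>R e))) /\<^sub>R e ^ DIM('a)"
    using e by (subst lborel_integral_affine[where c="1/e" and t=0])
      (auto simp: power_one_over inverse_eq_divide)
  also have "\<dots> = complex_of_real ((2 * pi) powr (real DIM('a) / 2) * gauss ((w - \<xi>) /\<^sub>R e) / e ^ DIM('a))"
    unfolding gauss_cis(2) by (simp add: scaleR_conv_of_real field_simps)
  finally show ?thesis
    unfolding ft_def using powr_pi_inverse[of "DIM('a)"]
    by (simp add: field_simps flip: of_real_mult) 
qed

section \<open>Gaussian regularisation, inversion and Plancherel's theorem\<close>

definition mollify :: "real \<Rightarrow> ('a::euclidean_space \<Rightarrow> complex) \<Rightarrow> 'a \<Rightarrow> complex" where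
  "mollify e f w = complex_of_real ((2 * pi) powr (- real DIM('a) / 2)) *
     (LINT z|lborel. f (w - e *\<^sub>R z) * complex_of_real (gauss z))"

text \<open>Gauss summability. It is the multiplication formula for a modulated Gaussian; the
  constant in \<open>mollify\<close> normalises the Gaussian weight to mass 1.\<close>

lemma integral_ft_gauss:
  fixes f :: "'a::euclidean_space \<Rightarrow> complex"
  assumes e: "e > 0" and f: "integrable lborel f"
  shows "ft (\<lambda>x. ft f x * complex_of_real (gauss (e *\<^sub>R x))) (- w) = mollify e f w"
proof -
  let ?g = "\<lambda>x. complex_of_real (gauss (e *\<^sub>R x)) * cis (x \<bullet> (- w))"
  have g: "integrable lborel ?g"
    by (intro integrable_mult_cis integrable_of_real integrable_gauss_scaled e) auto
  have "(LINT x|lborel. ft f x * complex_of_real (gauss (e *\<^sub>R x)) * cis (- (x \<bullet> - w))) =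
      cnj (LINT x|lborel. cnj (ft f x) * ?g x)"
    unfolding Bochner_Integration.integral_cnj[symmetric] by (simp add: cis_cnj mult_ac)
  also have "\<dots> = cnj (LINT x|lborel. cnj (f x) * ft ?g (- x))"
    by (subst integral_cnj_ft_mult[OF f g]) (rule refl)
  also have "\<dots> = (LINT x|lborel. f x * complex_of_real (gauss ((x - w) /\<^sub>R e) / e ^ DIM('a)))"
    unfolding Bochner_Integration.integral_cnj[symmetric] ft_gauss[OF e] by simp
  \<comment> \<open>The substitution \<open>x = w - e *\<^sub>R z\<close> has the negative scale
    \<open>- e\<close>: only its absolute value enters the Jacobian, and the Gaussian is
    even.\<close>
  also have "\<dots> = e ^ DIM('a) *\<^sub>R (LINT z|lborel. f (w - e *\<^sub>R z) * complex_of_real (gauss z / e ^ DIM('a)))"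
    using e by (subst lborel_integral_affine[where c="- e" and t=w]) (auto simp: algebra_simps)
  also have "\<dots> = (LINT z|lborel. f (w - e *\<^sub>R z) * complex_of_real (gauss z))"
    using e by (simp add: scaleR_conv_of_real)
  finally show ?thesis
    by (simp add: ft_def mollify_def)
qed

lemma integrable_ft_gauss:
  fixes f :: "'a::euclidean_space \<Rightarrow> complex"
  assumes e: "e > 0" and f: "integrable lborel f"
  shows "integrable lborel (\<lambda>x. ft f x * complex_of_real (gauss (e *\<^sub>R x)))"
  by (rule integrable_bounded_mult[OF _ _ norm_ft_le])
     (use f in \<open>auto intro!: integrable_of_real integrable_gauss_scaled e\<close>)

lemma of_real_cmod_square_mult: "complex_of_real ((cmod z)\<^sup>2 * t) = cnj z * (z * complex_of_real t)"
  by (metis complex_norm_square mult.assoc mult.commute of_real_mult)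

lemma integral_norm_ft_gauss:
  fixes f :: "'a::euclidean_space \<Rightarrow> complex"
  assumes e: "e > 0" and f: "integrable lborel f"
  shows "complex_of_real (LINT x|lborel. (cmod (ft f x))\<^sup>2 * gauss (e *\<^sub>R x)) =
     (LINT x|lborel. cnj (f x) * mollify e f x)"
proof -
  have "complex_of_real (LINT x|lborel. (cmod (ft f x))\<^sup>2 * gauss (e *\<^sub>R x)) =
     (LINT x|lborel. cnj (ft f x) * (ft f x * complex_of_real (gauss (e *\<^sub>R x))))"
    unfolding integral_complex_of_real[symmetric]
    by (intro Bochner_Integration.integral_cong refl) (rule of_real_cmod_square_mult)
  also have "\<dots> = (LINT x|lborel. cnj (f x) * mollify e f x)"
    unfolding integral_cnj_ft_mult[OF f integrable_ft_gauss[OF e f]] integral_ft_gauss[OF e f] ..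
  finally show ?thesis .
qed

text \<open>The squared L2 norm as an extended real, so that estimates can be stated for all
  measurable functions and square integrability becomes \<open>nsq f < \<infinity>\<close>.\<close>

definition nsq :: "('a::euclidean_space \<Rightarrow> complex) \<Rightarrow> ennreal" where
  "nsq f = (\<integral>\<^sup>+x. ennreal ((cmod (f x))\<^sup>2) \<partial>lborel)"

lemma norm_integral_le_nn:
  fixes f :: "'a \<Rightarrow> complex"
  shows "ennreal (norm (integral\<^sup>L M f)) \<le> (\<integral>\<^sup>+x. norm (f x) \<partial>M)"
  by (cases "integrable M f") (auto simp: integral_norm_bound_ennreal not_integrable_integral_eq)

lemma nn_integral_gauss:
  "(\<integral>\<^sup>+x. ennreal (gauss (x::'a::euclidean_space)) \<partial>lborel) = ennreal ((2 * pi) powr (real DIM('a) / 2))"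
  by (subst nn_integral_eq_integral) (auto simp: integrable_gauss integral_gauss gauss_pos less_imp_le)

lemma nsq_affine_minus:
  fixes f :: "'a::euclidean_space \<Rightarrow> complex"
  assumes [measurable]: "f \<in> borel_measurable borel"
  shows "(\<integral>\<^sup>+x. ennreal ((cmod (f (x - y)))\<^sup>2) \<partial>lborel) = nsq f"
  unfolding nsq_def
  by (subst (2) lborel_nn_integral_affine[where c=1 and t="- y"]) auto

text \<open>With \<open>2 * \<bar>f x\<bar> * \<bar>f y\<bar> \<le> \<bar>f x\<bar>\<^sup>2 + \<bar>f y\<bar>\<^sup>2\<close>, no continuity of translations in \<open>L\<^sup>2\<close> is needed
  for this half of Plancherel's theorem.\<close>

lemma integral_cnj_mollify_le:
  fixes f :: "'a::euclidean_space \<Rightarrow> complex"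
  assumes [measurable]: "f \<in> borel_measurable borel"
  shows "ennreal (cmod (LINT x|lborel. cnj (f x) * mollify e f x)) \<le> nsq f"
proof -
  define A where "A = (2 * pi) powr (- real DIM('a) / 2)"
  define B where "B = (2 * pi) powr (real DIM('a) / 2)"
  have A: "A \<ge> 0" and B: "B \<ge> 0" and AB: "A * B = 1"
    using powr_pi_inverse[of "DIM('a)"] by (auto simp: A_def B_def)
  let ?q = "\<lambda>x (z::'a). (cmod (f x))\<^sup>2 / 2 * gauss z"
  let ?r = "\<lambda>x z. (cmod (f (x - e *\<^sub>R z)))\<^sup>2 / 2 * gauss z"
  have 1: "ennreal (cmod (cnj (f x) * mollify e f x)) \<le>
      ennreal A * (\<integral>\<^sup>+z. ennreal (?q x z) + ennreal (?r x z) \<partial>lborel)" for x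
  proof -
    have "ennreal (cmod (cnj (f x) * mollify e f x)) =
       ennreal A * (ennreal (cmod (f x)) * ennreal (cmod (LINT z|lborel. f (x - e *\<^sub>R z) * complex_of_real (gauss z))))"
      unfolding mollify_def A_def[symmetric] norm_mult using A by (simp add: ennreal_mult' mult_ac)
    also have "\<dots> \<le> ennreal A * (ennreal (cmod (f x)) * 
        (\<integral>\<^sup>+z. norm (f (x - e *\<^sub>R z) * complex_of_real (gauss z)) \<partial>lborel))"
      by (intro mult_left_mono norm_integral_le_nn) auto
    also have "\<dots> = ennreal A * (\<integral>\<^sup>+z. ennreal (cmod (f x)) * norm (f (x - e *\<^sub>R z) * complex_of_real (gauss z)) \<partial>lborel)"
      by (subst nn_integral_cmult) auto
    also have "\<dots> \<le> ennreal A * (\<integral>\<^sup>+z. ennreal (?q x z) + ennreal (?r x z) \<partial>lborel)"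
    proof (intro mult_left_mono nn_integral_mono)
      fix z
      have "cmod (f x) * cmod (f (x - e *\<^sub>R z)) \<le> (cmod (f x))\<^sup>2 / 2 + (cmod (f (x - e *\<^sub>R z)))\<^sup>2 / 2"
        using sum_squares_bound[of "cmod (f x)" "cmod (f (x - e *\<^sub>R z))"] by simp
      from mult_right_mono[OF this, of "gauss z"] gauss_pos[of z]
      show "ennreal (cmod (f x)) * norm (f (x - e *\<^sub>R z) * complex_of_real (gauss z)) \<le>
         ennreal (?q x z) + ennreal (?r x z)"
        by (simp only: norm_mult norm_of_real abs_gauss)
          (simp add: ennreal_mult[symmetric] ennreal_plus[symmetric] ring_distribs mult.assoc del: ennreal_plus)
    qed auto
    finally show ?thesis .
  qed
  define h :: ennreal where "h = ennreal (1 / 2)"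
  have sp: "ennreal (t\<^sup>2 / 2 * gauss z) = h * (ennreal (t\<^sup>2) * ennreal (gauss z))" for t and z :: 'a
  proof -
    have "t\<^sup>2 / 2 * gauss z = 1 / 2 * (t\<^sup>2 * gauss z)" by simp
    then show ?thesis by (simp only: h_def ennreal_mult' zero_le_power2 zero_le_divide_1_iff zero_le_numeral)
  qed
  have hh: "h + h = 1"
    unfolding h_def by (subst ennreal_plus[symmetric]) (simp_all del: ennreal_plus)
  have G: "(\<integral>\<^sup>+z. ennreal (gauss (z::'a)) \<partial>lborel) = ennreal B"
    by (simp add: nn_integral_gauss B_def)
  have q: "(\<integral>\<^sup>+x. (\<integral>\<^sup>+z. ennreal (?q x z) \<partial>lborel) \<partial>lborel) = h * (nsq f * ennreal B)"
    by (simp only: sp) (simp add: nn_integral_cmult nn_integral_multc G nsq_def)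
  have r: "(\<integral>\<^sup>+x. (\<integral>\<^sup>+z. ennreal (?r x z) \<partial>lborel) \<partial>lborel) = h * (nsq f * ennreal B)"
  proof -
    have "(\<integral>\<^sup>+x. (\<integral>\<^sup>+z. ennreal (?r x z) \<partial>lborel) \<partial>lborel) = (\<integral>\<^sup>+z. (\<integral>\<^sup>+x. ennreal (?r x z) \<partial>lborel) \<partial>lborel)"
      by (rule lborel_pair.Fubini') measurable
    \<comment> \<open>With the order exchanged, the inner integral contains \<open>f\<close> only
      through a translate, whose squared norm does not depend on the shift.\<close>
    also have "\<dots> = h * (nsq f * ennreal B)"
      by (simp only: sp) (simp add: nn_integral_cmult nn_integral_multc nsq_affine_minus G)
    finally show ?thesis .
  qed
  have "ennreal (cmod (LINT x|lborel. cnj (f x) * mollify e f x)) \<le> (\<integral>\<^sup>+x. cmod (cnj (f x) * mollify e f x) \<partial>lborel)"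
    by (rule norm_integral_le_nn)
  also have "\<dots> \<le> (\<integral>\<^sup>+x. ennreal A * (\<integral>\<^sup>+z. ennreal (?q x z) + ennreal (?r x z) \<partial>lborel) \<partial>lborel)"
    by (intro nn_integral_mono 1)
  also have "\<dots> = ennreal A * (\<integral>\<^sup>+x. (\<integral>\<^sup>+z. ennreal (?q x z) \<partial>lborel) + (\<integral>\<^sup>+z. ennreal (?r x z) \<partial>lborel) \<partial>lborel)"
    by (subst nn_integral_cmult[symmetric], measurable, intro nn_integral_cong arg_cong2[where f="(*)"] refl nn_integral_add)
       measurable
  also have "\<dots> = ennreal A * ((\<integral>\<^sup>+x. (\<integral>\<^sup>+z. ennreal (?q x z) \<partial>lborel) \<partial>lborel) + (\<integral>\<^sup>+x. (\<integral>\<^sup>+z. ennreal (?r x z) \<partial>lborel) \<partial>lborel))"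
    by (intro arg_cong2[where f="(*)"] refl nn_integral_add) measurable
  also have "\<dots> = ennreal A * ennreal B * ((h + h) * nsq f)"
    unfolding q r by (simp only: distrib_left distrib_right mult_ac)
  also have "\<dots> = nsq f"
    using A B AB hh by (simp add: ennreal_mult[symmetric])
  finally show ?thesis .
qed

text \<open>Half of Plancherel's theorem: Fatou's lemma removes the Gaussian damping, and
  \<open>integral_cnj_mollify_le\<close> bounds every damped integral. This half alone makes the
  transforms of truncations a Cauchy family in L2.\<close>

lemma nsq_ft_le:
  fixes f :: "'a::euclidean_space \<Rightarrow> complex"
  assumes f: "integrable lborel f"
  shows "nsq (ft f) \<le> nsq f"
proof -
  have [measurable]: "f \<in> borel_measurable borel" using f by auto
  let ?e = "\<lambda>n. 1 / real (Suc n)"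
  let ?h = "\<lambda>n x. (cmod (ft f x))\<^sup>2 * gauss (?e n *\<^sub>R x)"
  have e0: "?e \<longlonglongrightarrow> 0" by (rule LIMSEQ_Suc[OF lim_1_over_n])
  have lim: "(\<lambda>n. ?h n x) \<longlonglongrightarrow> (cmod (ft f x))\<^sup>2" for x
  proof -
    have "(\<lambda>n. gauss (?e n *\<^sub>R x)) \<longlonglongrightarrow> gauss (0 *\<^sub>R x)"
      by (intro isCont_tendsto_compose[OF isCont_gauss] tendsto_scaleR tendsto_const e0)
    then have "(\<lambda>n. (cmod (ft f x))\<^sup>2 * gauss (?e n *\<^sub>R x)) \<longlonglongrightarrow> (cmod (ft f x))\<^sup>2 * gauss (0 *\<^sub>R x)"
      by (intro tendsto_mult tendsto_const)
    then show ?thesis by simp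
  qed
  have int: "integrable lborel (?h n)" for n
  proof -
    have e: "?e n > 0" by simp
    have "integrable lborel (\<lambda>x. cnj (ft f x) * (ft f x * complex_of_real (gauss (?e n *\<^sub>R x))))"
      by (rule integrable_bounded_mult[OF integrable_ft_gauss[OF e f]])
         (auto intro: norm_ft_le)
    then have "integrable lborel (\<lambda>x. cmod (cnj (ft f x) * (ft f x * complex_of_real (gauss (?e n *\<^sub>R x)))))"
      by (rule integrable_norm)
    then show ?thesis
      by (simp add: norm_mult power2_eq_square less_imp_le[OF gauss_pos] mult_ac)
  qed
  have "nsq (ft f) = (\<integral>\<^sup>+x. liminf (\<lambda>n. ennreal (?h n x)) \<partial>lborel)"
    unfolding nsq_def
    by (intro nn_integral_cong lim_imp_Liminf[symmetric] tendsto_ennrealI lim) simp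
  also have "\<dots> \<le> liminf (\<lambda>n. \<integral>\<^sup>+x. ennreal (?h n x) \<partial>lborel)"
    by (rule nn_integral_liminf) measurable
  also have "\<dots> \<le> liminf (\<lambda>n::nat. nsq f)"
  proof (intro Liminf_mono always_eventually allI)
    fix n
    have e: "?e n > 0" by simp
    have "(\<integral>\<^sup>+x. ennreal (?h n x) \<partial>lborel) = ennreal (LINT x|lborel. ?h n x)"
      by (intro nn_integral_eq_integral int) (auto simp: less_imp_le[OF gauss_pos])
    also have "LINT x|lborel. ?h n x = cmod (complex_of_real (LINT x|lborel. ?h n x))"
      by (simp add: less_imp_le[OF gauss_pos] integral_nonneg)
    also have "\<dots> = cmod (LINT x|lborel. cnj (f x) * mollify (?e n) f x)"
      by (simp only: integral_norm_ft_gauss[OF e f])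
    also have "ennreal \<dots> \<le> nsq f"
      by (rule integral_cnj_mollify_le) measurable
    finally show "(\<integral>\<^sup>+x. ennreal (?h n x) \<partial>lborel) \<le> nsq f" .
  qed
  also have "\<dots> = nsq f" by (intro lim_imp_Liminf tendsto_const) simp
  finally show ?thesis .
qed

lemma mollify_tendsto:
  fixes f :: "'a::euclidean_space \<Rightarrow> complex"
  assumes [measurable]: "f \<in> borel_measurable borel" and B: "\<And>x. cmod (f x) \<le> B"
    and c: "isCont f x" and e: "e \<longlonglongrightarrow> 0"
  shows "(\<lambda>n. mollify (e n) f x) \<longlonglongrightarrow> f x"
proof -
  have "(\<lambda>n. LINT z|lborel. f (x - e n *\<^sub>R z) * complex_of_real (gauss z)) \<longlonglongrightarrow>
      (LINT z|lborel. f x * complex_of_real (gauss (z::'a)))"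
  proof (rule integral_dominated_convergence[where w="\<lambda>z. B * gauss z"])
    show "integrable lborel (\<lambda>z::'a. B * gauss z)" by (intro integrable_mult_right integrable_gauss)
    show "AE z in lborel. cmod (f (x - e n *\<^sub>R z) * complex_of_real (gauss z)) \<le> B * gauss z" for n
      using B by (auto simp: norm_mult intro!: AE_I2 mult_right_mono)
    show "AE z in lborel. (\<lambda>n. f (x - e n *\<^sub>R z) * complex_of_real (gauss z)) \<longlonglongrightarrow> f x * complex_of_real (gauss z)"
    proof (intro AE_I2 tendsto_mult tendsto_const isCont_tendsto_compose[OF c])
      fix z :: 'a
      have "(\<lambda>n. x - e n *\<^sub>R z) \<longlonglongrightarrow> x - 0 *\<^sub>R z" by (intro tendsto_intros e)
      then show "(\<lambda>n. x - e n *\<^sub>R z) \<longlonglongrightarrow> x" by simp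
    qed
  qed measurable
  from tendsto_mult[OF tendsto_const this, of "complex_of_real ((2 * pi) powr (- real DIM('a) / 2))"]
  show ?thesis
    unfolding mollify_def using powr_pi_inverse[of "DIM('a)"]
    by (simp add: integral_gauss mult_ac flip: of_real_mult)
qed

text \<open>As the damping disappears, the damped integral of \<open>ft f\<close> has two limits:
  the inversion integral, by dominated convergence, and the value of \<open>f\<close> at a point of
  continuity, by \<open>mollify_tendsto\<close>.\<close>

lemma ft_inversion:
  fixes f :: "'a::euclidean_space \<Rightarrow> complex"
  assumes f: "integrable lborel f" and B: "\<And>x. cmod (f x) \<le> B"
    and c: "isCont f x" and i: "integrable lborel (ft f)"
  shows "ft (ft f) (- x) = f x"
proof -
  have [measurable]: "f \<in> borel_measurable borel" using f by auto
  let ?e = "\<lambda>n. 1 / real (Suc n)"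
  have e0: "?e \<longlonglongrightarrow> 0" by (rule LIMSEQ_Suc[OF lim_1_over_n])
  have "(\<lambda>n. mollify (?e n) f x) \<longlonglongrightarrow> f x"
    by (rule mollify_tendsto[OF _ B c e0]) measurable
  moreover have "(\<lambda>n. ft (\<lambda>x. ft f x * complex_of_real (gauss (?e n *\<^sub>R x))) (- x)) \<longlonglongrightarrow> ft (ft f) (- x)"
    unfolding ft_def[of _ "- x"]
  proof (intro tendsto_mult tendsto_const integral_dominated_convergence[where w="\<lambda>x. cmod (ft f x)"])
    show "AE y in lborel. (\<lambda>n. ft f y * complex_of_real (gauss (?e n *\<^sub>R y)) * cis (- (y \<bullet> - x))) \<longlonglongrightarrow> ft f y * cis (- (y \<bullet> - x))"
    proof (intro AE_I2)
      fix y :: 'a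
      have "(\<lambda>n. gauss (?e n *\<^sub>R y)) \<longlonglongrightarrow> gauss (0 *\<^sub>R y)"
        by (intro isCont_tendsto_compose[OF isCont_gauss] tendsto_scaleR tendsto_const e0)
      then have "(\<lambda>n. ft f y * complex_of_real (gauss (?e n *\<^sub>R y)) * cis (- (y \<bullet> - x))) \<longlonglongrightarrow> 
         ft f y * complex_of_real (gauss (0 *\<^sub>R y)) * cis (- (y \<bullet> - x))"
        by (intro tendsto_mult tendsto_const tendsto_of_real)
      then show "(\<lambda>n. ft f y * complex_of_real (gauss (?e n *\<^sub>R y)) * cis (- (y \<bullet> - x))) \<longlonglongrightarrow> ft f y * cis (- (y \<bullet> - x))"
        by simp
    qed
    show "AE y in lborel. cmod (ft f y * complex_of_real (gauss (?e n *\<^sub>R y)) * cis (- (y \<bullet> - x))) \<le> cmod (ft f y)" for n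
      by (simp add: norm_mult mult_left_le gauss_le_1)
  qed (use i in auto)
  moreover have "ft (\<lambda>x. ft f x * complex_of_real (gauss (?e n *\<^sub>R x))) (- x) = mollify (?e n) f x" for n
    by (rule integral_ft_gauss[OF _ f]) simp
  ultimately show ?thesis
    using LIMSEQ_unique[of "\<lambda>n. mollify (?e n) f x"] by simp
qed

lemma integrable_nsq_finite:
  fixes f :: "'a::euclidean_space \<Rightarrow> complex"
  assumes [measurable]: "f \<in> borel_measurable borel"
  shows "integrable lborel (\<lambda>x. (cmod (f x))\<^sup>2) \<longleftrightarrow> nsq f < \<infinity>"
  unfolding integrable_iff_bounded nsq_def by auto

lemma nsq_eq_integral:
  fixes f :: "'a::euclidean_space \<Rightarrow> complex"
  assumes "integrable lborel (\<lambda>x. (cmod (f x))\<^sup>2)"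
  shows "nsq f = ennreal (LINT x|lborel. (cmod (f x))\<^sup>2)"
  unfolding nsq_def by (intro nn_integral_eq_integral assms) auto

text \<open>Boundedness and continuity make the mollifications converge pointwise under a fixed
  bound, so \<open>integral_norm_ft_gauss\<close> passes to the limit as an equality. It is applied
  to the transforms of Sobolev kernel sections.\<close>

lemma Plancherel_bounded_continuous:
  fixes f :: "'a::euclidean_space \<Rightarrow> complex"
  assumes f: "integrable lborel f" and B: "\<And>x. cmod (f x) \<le> B" and c: "\<And>x. isCont f x"
  shows "nsq (ft f) = nsq f"
proof -
  have [measurable]: "f \<in> borel_measurable borel" using f by auto
  let ?e = "\<lambda>n. 1 / real (Suc n)"
  have e0: "?e \<longlonglongrightarrow> 0" by (rule LIMSEQ_Suc[OF lim_1_over_n])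
  have f2: "integrable lborel (\<lambda>x. (cmod (f x))\<^sup>2)"
    using integrable_norm[OF integrable_bounded_mult[OF f _ B]] by (simp add: norm_mult power2_eq_square)
  have F2: "integrable lborel (\<lambda>x. (cmod (ft f x))\<^sup>2)"
    using nsq_ft_le[OF f] f2 by (simp add: integrable_nsq_finite)
  \<comment> \<open>The Gaussian weight in \<open>mollify\<close> has mass 1, so the bound
    \<open>B\<close> is preserved; this yields the dominating function \<open>B * cmod (f x)\<close>
    below.\<close>
  have mB: "cmod (mollify e f x) \<le> B" for e x
  proof -
    have "cmod (LINT z|lborel. f (x - e *\<^sub>R z) * complex_of_real (gauss z)) \<le> (LINT z|lborel. B * gauss (z::'a))"
    proof (rule Bochner_Integration.integral_norm_bound_integral)
      show "integrable lborel (\<lambda>z. f (x - e *\<^sub>R z) * complex_of_real (gauss z))"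
        by (rule integrable_bounded_mult[OF _ _ B]) (auto intro!: integrable_of_real integrable_gauss)
      show "integrable lborel (\<lambda>z::'a. B * gauss z)" by (intro integrable_mult_right integrable_gauss)
    qed (use B gauss_pos in \<open>auto simp: norm_mult less_imp_le intro!: mult_right_mono\<close>)
    also have "\<dots> = B * (2 * pi) powr (real DIM('a) / 2)" by (simp add: integral_gauss)
    finally have "(2 * pi) powr (- real DIM('a) / 2) * cmod (LINT z|lborel. f (x - e *\<^sub>R z) * complex_of_real (gauss z))
       \<le> (2 * pi) powr (- real DIM('a) / 2) * (B * (2 * pi) powr (real DIM('a) / 2))"
      by (intro mult_left_mono) auto
    also have "\<dots> = B" using powr_pi_inverse[of "DIM('a)"] by (simp add: mult_ac)
    finally show ?thesis by (simp add: mollify_def norm_mult)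
  qed
  have [measurable]: "mollify e f \<in> borel_measurable borel" for e
    unfolding mollify_def by measurable
  have lim1: "(\<lambda>n. LINT x|lborel. cnj (f x) * mollify (?e n) f x) \<longlonglongrightarrow> (LINT x|lborel. cnj (f x) * f x)"
  proof (rule integral_dominated_convergence[where w="\<lambda>x. B * cmod (f x)"])
    show "AE x in lborel. (\<lambda>n. cnj (f x) * mollify (?e n) f x) \<longlonglongrightarrow> cnj (f x) * f x"
      by (intro AE_I2 tendsto_mult tendsto_const mollify_tendsto[OF _ B c e0]) auto
    show "AE x in lborel. cmod (cnj (f x) * mollify (?e n) f x) \<le> B * cmod (f x)" for n
      unfolding norm_mult complex_mod_cnj mult.commute[of B] by (intro AE_I2 mult_left_mono mB) simp
  qed (use f in auto)
  have eq: "(LINT x|lborel. cnj (f x) * f x) = complex_of_real (LINT x|lborel. (cmod (f x))\<^sup>2)"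
    unfolding integral_complex_of_real[symmetric]
    using of_real_cmod_square_mult[of _ 1] by (intro Bochner_Integration.integral_cong refl) simp
  have "(\<lambda>n. LINT x|lborel. (cmod (ft f x))\<^sup>2 * gauss (?e n *\<^sub>R x)) \<longlonglongrightarrow> (LINT x|lborel. (cmod (ft f x))\<^sup>2)"
  proof (rule integral_dominated_convergence[where w="\<lambda>x. (cmod (ft f x))\<^sup>2"])
    show "AE y in lborel. (\<lambda>n. (cmod (ft f y))\<^sup>2 * gauss (?e n *\<^sub>R y)) \<longlonglongrightarrow> (cmod (ft f y))\<^sup>2"
    proof (intro AE_I2)
      fix y :: 'a
      have "(\<lambda>n. gauss (?e n *\<^sub>R y)) \<longlonglongrightarrow> gauss (0 *\<^sub>R y)"
        by (intro isCont_tendsto_compose[OF isCont_gauss] tendsto_scaleR tendsto_const e0)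
      from tendsto_mult[OF tendsto_const this, of "(cmod (ft f y))\<^sup>2"]
      show "(\<lambda>n. (cmod (ft f y))\<^sup>2 * gauss (?e n *\<^sub>R y)) \<longlonglongrightarrow> (cmod (ft f y))\<^sup>2" by simp
    qed
    show "AE y in lborel. norm ((cmod (ft f y))\<^sup>2 * gauss (?e n *\<^sub>R y)) \<le> (cmod (ft f y))\<^sup>2" for n
      by (simp add: mult_left_le gauss_le_1)
  qed (use F2 in auto)
  from tendsto_of_real[OF this]
  have lim2: "(\<lambda>n. LINT x|lborel. cnj (f x) * mollify (?e n) f x) \<longlonglongrightarrow> complex_of_real (LINT x|lborel. (cmod (ft f x))\<^sup>2)"
    by (subst integral_norm_ft_gauss[OF _ f, symmetric]) simp_all
  have "(LINT x|lborel. (cmod (f x))\<^sup>2) = (LINT x|lborel. (cmod (ft f x))\<^sup>2)"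
    using LIMSEQ_unique[OF lim1 lim2] unfolding eq of_real_eq_iff .
  then show ?thesis
    by (simp add: nsq_eq_integral f2 F2)
qed

section \<open>Limits, completeness and duality in L2\<close>

lemma nsq_minus_commute: "nsq (\<lambda>x. f x - g x) = nsq (\<lambda>x. g x - f x)"
  by (simp add: nsq_def norm_minus_commute)

lemma nsq_cmult: 
  fixes f :: "'a::euclidean_space \<Rightarrow> complex"
  assumes [measurable]: "f \<in> borel_measurable borel"
  shows "nsq (\<lambda>x. c * f x) = ennreal ((cmod c)\<^sup>2) * nsq f"
  unfolding nsq_def by (simp add: norm_mult power_mult_distrib ennreal_mult nn_integral_cmult)

lemma nsq_eq_0:
  fixes f :: "'a::euclidean_space \<Rightarrow> complex"
  assumes [measurable]: "f \<in> borel_measurable borel"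
  shows "nsq f = 0 \<longleftrightarrow> (AE x in lborel. f x = 0)"
  unfolding nsq_def by (subst nn_integral_0_iff_AE) auto

text \<open>Letting \<open>t\<close> tend to \<open>0\<close>, this replaces Minkowski's inequality in \<open>nsq_tendsto_le\<close>.\<close>

lemma nsq_le:
  fixes f g :: "'a::euclidean_space \<Rightarrow> complex"
  assumes [measurable]: "f \<in> borel_measurable borel" "g \<in> borel_measurable borel" and t: "t > 0"
  shows "nsq f \<le> ennreal (1 + t) * nsq g + ennreal (1 + 1 / t) * nsq (\<lambda>x. f x - g x)"
proof -
  have *: "(cmod (f x))\<^sup>2 \<le> (1 + t) * (cmod (g x))\<^sup>2 + (1 + 1 / t) * (cmod (f x - g x))\<^sup>2" for x
  proof -
    let ?b = "cmod (g x)" and ?d = "cmod (f x - g x)"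
    have "cmod (f x) \<le> ?b + ?d" using norm_triangle_ineq[of "g x" "f x - g x"] by simp
    then have "(cmod (f x))\<^sup>2 \<le> (?b + ?d)\<^sup>2" by (simp add: power_mono)
    moreover have "2 * ?b * ?d \<le> t * ?b\<^sup>2 + ?d\<^sup>2 / t"
      using sum_squares_bound[of "sqrt t * ?b" "?d / sqrt t"] t
      by (simp add: power_mult_distrib power_divide)
    ultimately show ?thesis by (simp add: power2_sum distrib_right)
  qed
  have "nsq f \<le> (\<integral>\<^sup>+x. ennreal (1 + t) * ennreal ((cmod (g x))\<^sup>2) + ennreal (1 + 1 / t) * ennreal ((cmod (f x - g x))\<^sup>2) \<partial>lborel)"
    unfolding nsq_def
  proof (intro nn_integral_mono)
    fix x
    have "ennreal (1 + t) * ennreal ((cmod (g x))\<^sup>2) + ennreal (1 + 1 / t) * ennreal ((cmod (f x - g x))\<^sup>2)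
       = ennreal ((1 + t) * (cmod (g x))\<^sup>2 + (1 + 1 / t) * (cmod (f x - g x))\<^sup>2)"
      using t by (simp add: ennreal_plus[symmetric] ennreal_mult[symmetric] del: ennreal_plus)
    with ennreal_leI[OF *[of x]]
    show "ennreal ((cmod (f x))\<^sup>2) \<le> ennreal (1 + t) * ennreal ((cmod (g x))\<^sup>2) + ennreal (1 + 1 / t) * ennreal ((cmod (f x - g x))\<^sup>2)"
      by simp
  qed
  also have "\<dots> = ennreal (1 + t) * nsq g + ennreal (1 + 1 / t) * nsq (\<lambda>x. f x - g x)"
    unfolding nsq_def by (subst nn_integral_add) (simp_all add: nn_integral_cmult)
  finally show ?thesis .
qed

lemma nsq_triangle:
  fixes f g h :: "'a::euclidean_space \<Rightarrow> complex"
  assumes [measurable]: "f \<in> borel_measurable borel" "g \<in> borel_measurable borel" "h \<in> borel_measurable borel"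
  shows "nsq (\<lambda>x. f x - h x) \<le> 2 * nsq (\<lambda>x. f x - g x) + 2 * nsq (\<lambda>x. g x - h x)"
  using nsq_le[of "\<lambda>x. f x - h x" "\<lambda>x. f x - g x" 1] by simp

text \<open>The filter is general because limits occur over real truncation radii as well as over
  sequences. Two applications of \<open>nsq_le\<close> cost a factor \<open>(1 + t)\<^sup>2\<close>,
  which is sent to 1 only after the error terms have vanished for fixed \<open>t\<close>.\<close>

lemma nsq_tendsto_le:
  fixes f g :: "'i \<Rightarrow> 'a::euclidean_space \<Rightarrow> complex"
  assumes F: "F \<noteq> bot" 
    and [measurable]: "\<And>i. f i \<in> borel_measurable borel" "\<And>i. g i \<in> borel_measurable borel"
      "f0 \<in> borel_measurable borel" "g0 \<in> borel_measurable borel"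
    and f: "((\<lambda>i. nsq (\<lambda>x. f i x - f0 x)) \<longlongrightarrow> 0) F"
    and g: "((\<lambda>i. nsq (\<lambda>x. g i x - g0 x)) \<longlongrightarrow> 0) F"
    and le: "\<And>i. nsq (g i) \<le> nsq (f i)"
  shows "nsq g0 \<le> nsq f0"
proof -
  have 1: "nsq g0 \<le> ennreal (1 + t) * (ennreal (1 + t) * nsq f0)" if t: "t > 0" for t
  proof -
    define A C where "A = ennreal (1 + t)" and "C = ennreal (1 + 1 / t)"
    have AC: "A < top" "C < top" by (simp_all add: A_def C_def)
    have *: "nsq g0 \<le> A * (A * nsq f0 + C * nsq (\<lambda>x. f i x - f0 x)) + C * nsq (\<lambda>x. g i x - g0 x)" for i
    proof -
      have "nsq g0 \<le> A * nsq (g i) + C * nsq (\<lambda>x. g0 x - g i x)"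
        unfolding A_def C_def by (rule nsq_le[OF _ _ t]) auto
      also have "nsq (\<lambda>x. g0 x - g i x) = nsq (\<lambda>x. g i x - g0 x)" by (rule nsq_minus_commute)
      also have "A * nsq (g i) + C * nsq (\<lambda>x. g i x - g0 x) \<le>
          A * (A * nsq f0 + C * nsq (\<lambda>x. f i x - f0 x)) + C * nsq (\<lambda>x. g i x - g0 x)"
        unfolding A_def C_def
        by (rule add_right_mono, rule mult_left_mono, rule order_trans[OF le nsq_le[OF _ _ t]]) auto
      finally show ?thesis .
    qed
    have "((\<lambda>i. A * (A * nsq f0 + C * nsq (\<lambda>x. f i x - f0 x)) + C * nsq (\<lambda>x. g i x - g0 x))
      \<longlongrightarrow> A * (A * nsq f0 + C * 0) + C * 0) F"
      by (intro tendsto_add tendsto_const ennreal_tendsto_cmult f g AC)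
    from tendsto_lowerbound[OF this always_eventually[OF allI[OF *]] F]
    show ?thesis by (simp only: A_def mult_zero_right add_0_right)
  qed
  show ?thesis
  proof (cases "nsq f0" rule: ennreal_cases)
    case (real r)
    let ?e = "\<lambda>n. 1 / real (Suc n)"
    have "(\<lambda>n. ennreal ((1 + ?e n) * ((1 + ?e n) * r))) \<longlonglongrightarrow> ennreal ((1 + 0) * ((1 + 0) * r))"
      by (intro tendsto_ennrealI tendsto_mult tendsto_add tendsto_const LIMSEQ_Suc[OF lim_1_over_n])
    moreover have "nsq g0 \<le> ennreal ((1 + ?e n) * ((1 + ?e n) * r))" for n
    proof -
      have "ennreal ((1 + ?e n) * ((1 + ?e n) * r)) = ennreal (1 + ?e n) * (ennreal (1 + ?e n) * ennreal r)"
        using real(1) by (subst ennreal_mult, simp, simp)+ (rule refl)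
      then show ?thesis using 1[of "?e n"] real(2) by simp
    qed
    ultimately have "nsq g0 \<le> ennreal ((1 + 0) * ((1 + 0) * r))"
      by (intro tendsto_lowerbound[OF _ always_eventually sequentially_bot]) auto
    then show ?thesis using real(2) by simp
  qed simp
qed

text \<open>Riesz-Fischer: a subsequence with squared gaps at most \<open>(1/4) ^ k\<close>
  converges almost everywhere, and Fatou's lemma along it turns the pointwise limit into an L2 limit
  of the full sequence.\<close>

lemma L2_complete:
  fixes F :: "nat \<Rightarrow> 'a::euclidean_space \<Rightarrow> complex"
  assumes [measurable]: "\<And>n. F n \<in> borel_measurable borel"
    and C: "\<And>e::real. e > 0 \<Longrightarrow> \<exists>N. \<forall>m\<ge>N. \<forall>n\<ge>N. nsq (\<lambda>x. F m x - F n x) \<le> ennreal e"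
  obtains G where "G \<in> borel_measurable borel" "(\<lambda>n. nsq (\<lambda>x. F n x - G x)) \<longlonglongrightarrow> 0"
proof -
  have "\<exists>N. \<forall>m\<ge>N. \<forall>n\<ge>N. nsq (\<lambda>x. F m x - F n x) \<le> ennreal ((1/4) ^ k)" for k
    by (intro C) simp
  then obtain N where N: "\<And>k m n. m \<ge> N k \<Longrightarrow> n \<ge> N k \<Longrightarrow> nsq (\<lambda>x. F m x - F n x) \<le> ennreal ((1/4) ^ k)"
    by metis
  \<comment> \<open>Summing the \<open>N i\<close> puts both \<open>s k\<close> and
    \<open>s (Suc k)\<close> at or above \<open>N k\<close>; the extra summand \<open>k\<close>
    makes the indices unbounded.\<close>
  define s where "s k = (\<Sum>i\<le>k. N i) + k" for k
  have sN: "s k \<ge> N k" and sN': "s (Suc k) \<ge> N k" for k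
    using member_le_sum[of k "{..k}" N] by (auto simp: s_def)
  have sk: "s k \<ge> k" for k by (simp add: s_def)
  define a where "a k x = cmod (F (s (Suc k)) x - F (s k) x)" for k x
  have a0: "a k x \<ge> 0" for k x by (simp add: a_def)
  have [measurable]: "a k \<in> borel_measurable borel" for k unfolding a_def by measurable
  have "(\<integral>\<^sup>+x. (\<Sum>k. ennreal (2 ^ k * (a k x)\<^sup>2)) \<partial>lborel) = (\<Sum>k. \<integral>\<^sup>+x. ennreal (2 ^ k * (a k x)\<^sup>2) \<partial>lborel)"
    by (intro nn_integral_suminf) measurable
  \<comment> \<open>The weight \<open>2 ^ k\<close> spends half of the decay
    \<open>(1/4) ^ k\<close>. The weighted squares stay summable, and since \<open>a k x\<close> is
    at most \<open>(1/2) ^ k\<close> or at most \<open>2 ^ k * (a k x)\<^sup>2\<close>, the gaps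
    themselves become summable.\<close>
  also have "\<dots> \<le> (\<Sum>k. ennreal ((1/2) ^ k))"
  proof (intro suminf_le summableI allI)
    fix k
    have "(\<integral>\<^sup>+x. ennreal (2 ^ k * (a k x)\<^sup>2) \<partial>lborel) = ennreal (2 ^ k) * nsq (\<lambda>x. F (s (Suc k)) x - F (s k) x)"
      by (simp add: ennreal_mult nn_integral_cmult nsq_def a_def)
    also have "\<dots> \<le> ennreal (2 ^ k) * ennreal ((1/4) ^ k)"
      by (intro mult_left_mono N sN sN') simp
    also have "\<dots> = ennreal ((1/2) ^ k)"
      by (simp add: ennreal_mult[symmetric] power_mult_distrib[symmetric])
    finally show "(\<integral>\<^sup>+x. ennreal (2 ^ k * (a k x)\<^sup>2) \<partial>lborel) \<le> ennreal ((1/2) ^ k)" .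
  qed
  also have "\<dots> = ennreal (\<Sum>k. (1/2) ^ k)"
    by (intro suminf_ennreal2) auto
  finally have fin: "(\<integral>\<^sup>+x. (\<Sum>k. ennreal (2 ^ k * (a k x)\<^sup>2)) \<partial>lborel) < \<infinity>"
    by (simp add: le_less_trans)
  have "AE x in lborel. (\<Sum>k. ennreal (2 ^ k * (a k x)\<^sup>2)) \<noteq> \<infinity>"
    by (rule nn_integral_PInf_AE) (use fin in auto)
  then have conv: "AE x in lborel. (\<lambda>k. F (s k) x) \<longlonglongrightarrow> lim (\<lambda>k. F (s k) x)"
  proof eventually_elim
    fix x assume x: "(\<Sum>k. ennreal (2 ^ k * (a k x)\<^sup>2)) \<noteq> \<infinity>"
    have s1: "summable (\<lambda>k. 2 ^ k * (a k x)\<^sup>2)"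
      by (rule summable_suminf_not_top) (use x in auto)
    have "summable (\<lambda>k. a k x)"
    proof (rule summable_comparison_test'[of "\<lambda>k. (1/2) ^ k + 2 ^ k * (a k x)\<^sup>2" 0])
      show "summable (\<lambda>k. (1/2) ^ k + 2 ^ k * (a k x)\<^sup>2)"
        by (intro summable_add s1 summable_geometric) simp
      fix k :: nat
      show "norm (a k x) \<le> (1/2) ^ k + 2 ^ k * (a k x)\<^sup>2"
      proof (cases "a k x \<le> (1/2) ^ k")
        case False
        then have "2 ^ k * (1/2) ^ k * a k x \<le> 2 ^ k * a k x * a k x"
          using a0[of k x] by (simp add: mult_right_mono)
        then have "a k x \<le> 2 ^ k * (a k x)\<^sup>2" by (simp add: power_mult_distrib[symmetric] power2_eq_square)
        moreover have "(0::real) \<le> (1/2) ^ k" by simp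
        ultimately have "a k x \<le> (1/2) ^ k + 2 ^ k * (a k x)\<^sup>2" by linarith
        then show ?thesis using a0 by simp
      next
        case True
        then show ?thesis using a0 by (simp add: add_increasing2)
      qed
    qed
    then have "summable (\<lambda>k. F (s (Suc k)) x - F (s k) x)"
      unfolding a_def by (rule summable_norm_cancel)
    then have "convergent (\<lambda>n. \<Sum>k<n. F (s (Suc k)) x - F (s k) x)"
      by (simp add: summable_iff_convergent)
    then have "convergent (\<lambda>n. F (s n) x - F (s 0) x)"
      by (simp add: sum_lessThan_telescope[of "\<lambda>k. F (s k) x"])
    from convergent_add[OF this convergent_const[of "F (s 0) x"]]
    show "(\<lambda>k. F (s k) x) \<longlonglongrightarrow> lim (\<lambda>k. F (s k) x)"
      by (simp add: convergent_LIMSEQ_iff)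
  qed
  define G where "G x = lim (\<lambda>k. F (s k) x)" for x
  have [measurable]: "G \<in> borel_measurable borel" unfolding G_def by measurable
  have bound: "nsq (\<lambda>x. F n x - G x) \<le> ennreal e" if e: "\<And>m. m \<ge> M \<Longrightarrow> nsq (\<lambda>x. F n x - F m x) \<le> ennreal e" for n M e
  proof -
    have "nsq (\<lambda>x. F n x - G x) = (\<integral>\<^sup>+x. liminf (\<lambda>k. ennreal ((cmod (F n x - F (s k) x))\<^sup>2)) \<partial>lborel)"
      unfolding nsq_def
    proof (intro nn_integral_cong_AE, use conv in eventually_elim)
      fix x assume "(\<lambda>k. F (s k) x) \<longlonglongrightarrow> lim (\<lambda>k. F (s k) x)"
      then have "(\<lambda>k. (cmod (F n x - F (s k) x))\<^sup>2) \<longlonglongrightarrow> (cmod (F n x - G x))\<^sup>2"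
        unfolding G_def by (intro tendsto_power tendsto_norm tendsto_diff tendsto_const)
      then show "ennreal ((cmod (F n x - G x))\<^sup>2) = liminf (\<lambda>k. ennreal ((cmod (F n x - F (s k) x))\<^sup>2))"
        by (intro lim_imp_Liminf[symmetric] tendsto_ennrealI) simp
    qed
    also have "\<dots> \<le> liminf (\<lambda>k. nsq (\<lambda>x. F n x - F (s k) x))"
      unfolding nsq_def by (rule nn_integral_liminf) measurable
    also have "\<dots> \<le> liminf (\<lambda>k::nat. ennreal e)"
    proof (intro Liminf_mono eventually_sequentiallyI[of M])
      fix k assume "M \<le> k"
      then show "nsq (\<lambda>x. F n x - F (s k) x) \<le> ennreal e" by (intro e order_trans[OF _ sk])
    qed
    also have "\<dots> = ennreal e" by (intro lim_imp_Liminf tendsto_const) simp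
    finally show ?thesis .
  qed
  have "(\<lambda>n. nsq (\<lambda>x. F n x - G x)) \<longlonglongrightarrow> 0"
  proof (rule order_tendstoI)
    fix y :: ennreal assume "y < 0"
    then show "\<forall>\<^sub>F n in sequentially. y < nsq (\<lambda>x. F n x - G x)" by simp
  next
    fix y :: ennreal assume "0 < y"
    then obtain e where e: "0 < e" "ennreal e < y"
      by (metis dense ennreal_0 ennreal_cases ennreal_less_zero_iff less_top order.strict_trans not_less_iff_gr_or_eq)
    from C[OF e(1)] obtain M where M: "\<forall>m\<ge>M. \<forall>n\<ge>M. nsq (\<lambda>x. F m x - F n x) \<le> ennreal e" by blast
    show "\<forall>\<^sub>F n in sequentially. nsq (\<lambda>x. F n x - G x) < y"
    proof (rule eventually_sequentiallyI[of M])
      fix n assume "M \<le> n"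
      then have "nsq (\<lambda>x. F n x - G x) \<le> ennreal e" by (intro bound[of M]) (use M in auto)
      with e(2) show "nsq (\<lambda>x. F n x - G x) < y" by simp
    qed
  qed
  then show ?thesis by (intro that[of G]) measurable
qed

lemma norm_integral_mult_le:
  fixes f g :: "'a::euclidean_space \<Rightarrow> complex"
  assumes [measurable]: "f \<in> borel_measurable borel" "g \<in> borel_measurable borel"
  shows "(ennreal (cmod (LINT x|lborel. f x * g x)))\<^sup>2 \<le> nsq f * nsq g"
proof -
  have "ennreal (cmod (LINT x|lborel. f x * g x)) \<le> (\<integral>\<^sup>+x. cmod (f x * g x) \<partial>lborel)"
    by (rule norm_integral_le_nn)
  also have "\<dots> = (\<integral>\<^sup>+x. ennreal (cmod (f x)) * ennreal (cmod (g x)) \<partial>lborel)"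
    by (simp add: norm_mult ennreal_mult)
  finally have "(ennreal (cmod (LINT x|lborel. f x * g x)))\<^sup>2 \<le> (\<integral>\<^sup>+x. ennreal (cmod (f x)) * ennreal (cmod (g x)) \<partial>lborel)\<^sup>2"
    by (rule power_mono) simp
  also have "\<dots> \<le> (\<integral>\<^sup>+x. (ennreal (cmod (f x)))\<^sup>2 \<partial>lborel) * (\<integral>\<^sup>+x. (ennreal (cmod (g x)))\<^sup>2 \<partial>lborel)"
    by (rule Cauchy_Schwarz_nn_integral) measurable
  also have "\<dots> = nsq f * nsq g"
    by (simp add: nsq_def ennreal_power)
  finally show ?thesis .
qed

lemma integrable_mult_L2:
  fixes f g :: "'a::euclidean_space \<Rightarrow> complex"
  assumes "f \<in> borel_measurable borel" "g \<in> borel_measurable borel"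
    and "integrable lborel (\<lambda>x. (cmod (f x))\<^sup>2)" "integrable lborel (\<lambda>x. (cmod (g x))\<^sup>2)"
  shows "integrable lborel (\<lambda>x. f x * g x)"
proof (rule Bochner_Integration.integrable_bound)
  show "integrable lborel (\<lambda>x. (cmod (f x))\<^sup>2 + (cmod (g x))\<^sup>2)" using assms by simp
  show "AE x in lborel. cmod (f x * g x) \<le> norm ((cmod (f x))\<^sup>2 + (cmod (g x))\<^sup>2)"
  proof (intro AE_I2)
    fix x
    show "cmod (f x * g x) \<le> norm ((cmod (f x))\<^sup>2 + (cmod (g x))\<^sup>2)"
      using sum_squares_bound[of "cmod (f x)" "cmod (g x)"] mult_nonneg_nonneg[OF norm_ge_zero[of "f x"] norm_ge_zero[of "g x"]] 
      unfolding norm_mult real_norm_def by linarith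
  qed
qed (use assms in measurable)

text \<open>Cauchy-Schwarz applied to the difference. In use, \<open>g\<close> is the transform of a
  test function or represents evaluation at a point.\<close>

lemma tendsto_integral_mult_L2:
  fixes f :: "'i \<Rightarrow> 'a::euclidean_space \<Rightarrow> complex"
  assumes [measurable]: "\<And>i. f i \<in> borel_measurable borel" "f0 \<in> borel_measurable borel" "g \<in> borel_measurable borel"
    and int: "\<And>i. integrable lborel (\<lambda>x. f i x * g x)" "integrable lborel (\<lambda>x. f0 x * g x)"
    and lim: "((\<lambda>i. nsq (\<lambda>x. f i x - f0 x)) \<longlongrightarrow> 0) F" and g: "nsq g < \<infinity>"
  shows "((\<lambda>i. LINT x|lborel. f i x * g x) \<longlongrightarrow> (LINT x|lborel. f0 x * g x)) F"
proof -
  let ?d = "\<lambda>i. cmod ((LINT x|lborel. f i x * g x) - (LINT x|lborel. f0 x * g x))"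
  have le: "ennreal ((?d i)\<^sup>2) \<le> nsq g * nsq (\<lambda>x. f i x - f0 x)" for i
  proof -
    have "(LINT x|lborel. f i x * g x) - (LINT x|lborel. f0 x * g x) = (LINT x|lborel. (f i x - f0 x) * g x)"
      using int by (simp add: left_diff_distrib)
    then show ?thesis
      using norm_integral_mult_le[of "\<lambda>x. f i x - f0 x" g] by (simp add: ennreal_power mult.commute)
  qed
  have "((\<lambda>i. nsq g * nsq (\<lambda>x. f i x - f0 x)) \<longlongrightarrow> nsq g * 0) F"
    using g by (intro ennreal_tendsto_cmult lim) simp
  then have up: "((\<lambda>i. nsq g * nsq (\<lambda>x. f i x - f0 x)) \<longlongrightarrow> ennreal 0) F"
    by simp
  have "((\<lambda>i. ennreal ((?d i)\<^sup>2)) \<longlongrightarrow> ennreal 0) F"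
    by (rule tendsto_sandwich[OF always_eventually[OF allI] always_eventually[OF allI[OF le]] tendsto_const up]) simp
  then have "((\<lambda>i. (?d i)\<^sup>2) \<longlongrightarrow> 0) F"
    by (subst (asm) tendsto_ennreal_iff) (auto intro!: always_eventually)
  from tendsto_real_sqrt[OF this]
  have "(?d \<longlongrightarrow> 0) F"
    by simp
  then show ?thesis
    by (rule Lim_null[THEN iffD2, OF tendsto_norm_zero_cancel])
qed

section \<open>The Fourier transform of square integrable functions\<close>

definition cutoff :: "real \<Rightarrow> ('a::euclidean_space \<Rightarrow> real) \<Rightarrow> 'a \<Rightarrow> complex" where
  "cutoff R f x = complex_of_real (indicator (cball 0 R) x * f x)"

lemma borel_measurable_cutoff [measurable]:
  fixes f :: "'a::euclidean_space \<Rightarrow> real"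
  assumes [measurable]: "f \<in> borel_measurable borel"
  shows "cutoff R f \<in> borel_measurable borel"
  unfolding cutoff_def
  by (rule measurable_compose[OF _ borel_measurable_of_real])
     (intro borel_measurable_times borel_measurable_indicator, auto)

lemma integrable_cutoff:
  fixes f :: "'a::euclidean_space \<Rightarrow> real"
  assumes [measurable]: "f \<in> borel_measurable borel" and f2: "integrable lborel (\<lambda>x. (f x)\<^sup>2)"
  shows "integrable lborel (cutoff R f)"
proof (rule Bochner_Integration.integrable_bound)
  show "integrable lborel (\<lambda>x. indicator (cball 0 R) x + (f x)\<^sup>2)"
    by (intro Bochner_Integration.integrable_add integrable_real_indicator f2)
       (auto simp: emeasure_lborel_cball_finite[unfolded infinity_ennreal_def])
  show "AE x in lborel. cmod (cutoff R f x) \<le> norm (indicator (cball 0 R) x + (f x)\<^sup>2)"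
  proof (intro AE_I2)
    fix x
    have "\<bar>f x\<bar> \<le> 1 + (f x)\<^sup>2"
      using sum_squares_bound[of 1 "\<bar>f x\<bar>"] by simp
    then show "cmod (cutoff R f x) \<le> norm (indicator (cball 0 R) x + (f x)\<^sup>2)"
      by (auto simp: cutoff_def indicator_def)
  qed
qed measurable

lemma nsq_cutoff_tendsto:
  fixes f :: "'a::euclidean_space \<Rightarrow> real"
  assumes [measurable]: "f \<in> borel_measurable borel" and f2: "integrable lborel (\<lambda>x. (f x)\<^sup>2)"
  shows "((\<lambda>R. nsq (\<lambda>x. cutoff R f x - complex_of_real (f x))) \<longlongrightarrow> 0) at_top"
proof -
  let ?h = "\<lambda>R x. (indicator (- cball 0 R) x :: real) * (f x)\<^sup>2"
  have "((\<lambda>R. LINT x|lborel. ?h R x) \<longlongrightarrow> (LINT (x::'a)|lborel. (0::real))) at_top"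
  proof (rule integral_dominated_convergence_at_top[where w="\<lambda>x. (f x)\<^sup>2"])
    show "AE x in lborel. ((\<lambda>R. ?h R x) \<longlongrightarrow> 0) at_top"
    proof (intro AE_I2 tendsto_eventually)
      fix x :: 'a
      show "\<forall>\<^sub>F R in at_top. ?h R x = 0"
        using eventually_ge_at_top[of "norm x"] by eventually_elim auto
    qed
    show "\<forall>\<^sub>F R in at_top. AE x in lborel. norm (?h R x) \<le> (f x)\<^sup>2"
      by (intro always_eventually allI AE_I2) (auto simp: indicator_def)
  qed (use f2 in auto)
  then have "((\<lambda>R. ennreal (LINT x|lborel. ?h R x)) \<longlongrightarrow> ennreal 0) at_top"
    by (intro tendsto_ennrealI) simp
  moreover have "nsq (\<lambda>x. cutoff R f x - complex_of_real (f x)) = ennreal (LINT x|lborel. ?h R x)" for R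
  proof -
    have "nsq (\<lambda>x. cutoff R f x - complex_of_real (f x)) = (\<integral>\<^sup>+x. ennreal (?h R x) \<partial>lborel)"
      unfolding nsq_def cutoff_def by (intro nn_integral_cong) (auto simp: indicator_def)
    also have "\<dots> = ennreal (LINT x|lborel. ?h R x)"
    proof (intro nn_integral_eq_integral)
      show "integrable lborel (\<lambda>x. ?h R x)"
        by (rule Bochner_Integration.integrable_bound[OF f2]) (auto simp: indicator_def)
    qed auto
    finally show ?thesis .
  qed
  ultimately show ?thesis by simp
qed

lemma fourier_integral_eq_ft:
  fixes f :: "real^'d \<Rightarrow> real"
  shows "fourier_integral f = ft (\<lambda>x. complex_of_real (f x))"
  by (simp add: fourier_integral_def ft_def fun_eq_iff)

lemma is_fourier_transform_iff:
  fixes f :: "real^'d \<Rightarrow> real"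
  shows "is_fourier_transform f F \<longleftrightarrow>
     f \<in> borel_measurable borel \<and> integrable lborel (\<lambda>x. (f x)\<^sup>2) \<and>
     F \<in> borel_measurable borel \<and> integrable lborel (\<lambda>\<omega>. (cmod (F \<omega>))\<^sup>2) \<and>
     ((\<lambda>R. nsq (\<lambda>w. ft (cutoff R f) w - F w)) \<longlongrightarrow> 0) at_top"
  unfolding is_fourier_transform_def fourier_integral_eq_ft nsq_def cutoff_def[abs_def] by simp

lemma nsq_of_real:
  fixes f :: "'a::euclidean_space \<Rightarrow> real"
  assumes f2: "integrable lborel (\<lambda>x. (f x)\<^sup>2)"
  shows "nsq (\<lambda>x. complex_of_real (f x)) = ennreal (LINT x|lborel. (f x)\<^sup>2)"
  using nsq_eq_integral[of "\<lambda>x. complex_of_real (f x)"] f2 by simp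

lemma nsq_fourier_transform_le:
  fixes f :: "real^'d \<Rightarrow> real"
  assumes "is_fourier_transform f F"
  shows "nsq F \<le> nsq (\<lambda>x. complex_of_real (f x))"
proof -
  from assms have [measurable]: "f \<in> borel_measurable borel" "F \<in> borel_measurable borel"
    and f2: "integrable lborel (\<lambda>x. (f x)\<^sup>2)" 
    and l: "((\<lambda>R. nsq (\<lambda>w. ft (cutoff R f) w - F w)) \<longlongrightarrow> 0) at_top"
    unfolding is_fourier_transform_iff by auto
  show ?thesis
    by (rule nsq_tendsto_le[OF trivial_limit_at_top_linorder _ _ _ _ nsq_cutoff_tendsto[OF _ f2] l nsq_ft_le[OF integrable_cutoff[OF _ f2]]])
       measurable
qed

text \<open>This gives meaning to the choice in \<open>fourier_transform\<close>. By Plancherel's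
  inequality the transforms of truncations are Cauchy; \<open>L2_complete\<close> supplies a limit
  along integer radii, and the same inequality then controls all real radii.\<close>

lemma fourier_transform_exists:
  fixes f :: "real^'d \<Rightarrow> real"
  assumes [measurable]: "f \<in> borel_measurable borel" and f2: "integrable lborel (\<lambda>x. (f x)\<^sup>2)"
  shows "is_fourier_transform f (fourier_transform f)"
proof -
  let ?F = "\<lambda>R. ft (cutoff R f)"
  let ?d = "\<lambda>R. nsq (\<lambda>x. cutoff R f x - complex_of_real (f x))"
  have F: "nsq (\<lambda>w. ?F R w - ?F S w) \<le> 2 * ?d R + 2 * ?d S" for R S
  proof -
    have "nsq (\<lambda>w. ?F R w - ?F S w) = nsq (ft (\<lambda>x. cutoff R f x - cutoff S f x))"
      by (intro arg_cong[of _ _ nsq] ext ft_diff[symmetric] integrable_cutoff assms)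
    also have "\<dots> \<le> nsq (\<lambda>x. cutoff R f x - cutoff S f x)"
      by (intro nsq_ft_le Bochner_Integration.integrable_diff integrable_cutoff f2) auto
    also have "\<dots> \<le> 2 * ?d R + 2 * nsq (\<lambda>x. complex_of_real (f x) - cutoff S f x)"
      by (rule nsq_triangle) measurable
    finally show ?thesis by (simp add: nsq_minus_commute[of _ "cutoff S f"])
  qed
  have d: "(?d \<longlongrightarrow> 0) at_top" by (intro nsq_cutoff_tendsto f2) auto
  have dn: "(\<lambda>n. ?d (real n)) \<longlonglongrightarrow> 0"
    by (rule filterlim_compose[OF d filterlim_real_sequentially])
  obtain G where [measurable]: "G \<in> borel_measurable borel" and G: "(\<lambda>n. nsq (\<lambda>x. ?F (real n) x - G x)) \<longlonglongrightarrow> 0"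
  proof (rule L2_complete[of "\<lambda>n. ?F (real n)"])
    fix e :: real assume e: "e > 0"
    then have "\<forall>\<^sub>F n in sequentially. ?d (real n) < ennreal (e / 4)"
      by (intro order_tendstoD(2)[OF dn]) simp
    then obtain N where N: "\<And>n. n \<ge> N \<Longrightarrow> ?d (real n) < ennreal (e / 4)"
      by (auto simp: eventually_sequentially)
    have "nsq (\<lambda>x. ?F (real m) x - ?F (real n) x) \<le> ennreal e" if "m \<ge> N" "n \<ge> N" for m n
    proof -
      have "nsq (\<lambda>x. ?F (real m) x - ?F (real n) x) \<le> 2 * ?d m + 2 * ?d n" by (rule F)
      also have "\<dots> \<le> ennreal 2 * ennreal (e / 4) + ennreal 2 * ennreal (e / 4)"
        using N[OF that(1)] N[OF that(2)] by (intro add_mono mult_mono) auto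
      also have "\<dots> = ennreal e"
        using e by (simp add: ennreal_mult[symmetric] ennreal_plus[symmetric] del: ennreal_plus flip: ennreal_numeral)
      finally show ?thesis .
    qed
    then show "\<exists>N. \<forall>m\<ge>N. \<forall>n\<ge>N. nsq (\<lambda>x. ?F (real m) x - ?F (real n) x) \<le> ennreal e" by blast
  qed measurable
  \<comment> \<open>Compare radius \<open>R\<close> with an integer radius \<open>n\<close> and let
    \<open>n\<close> grow: only the truncation error at \<open>R\<close> remains.\<close>
  have le: "nsq (\<lambda>w. ?F R w - G w) \<le> 4 * ?d R" for R
  proof -
    have *: "nsq (\<lambda>w. ?F R w - G w) \<le> 2 * (2 * ?d R + 2 * ?d (real n)) + 2 * nsq (\<lambda>w. ?F (real n) w - G w)" for n
    proof -
      have "nsq (\<lambda>w. ?F R w - G w) \<le> 2 * nsq (\<lambda>w. ?F R w - ?F n w) + 2 * nsq (\<lambda>w. ?F (real n) w - G w)"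
        by (rule nsq_triangle) measurable
      also have "\<dots> \<le> 2 * (2 * ?d R + 2 * ?d (real n)) + 2 * nsq (\<lambda>w. ?F (real n) w - G w)"
        by (intro add_mono mult_left_mono F) auto
      finally show ?thesis .
    qed
    have "(\<lambda>n. 2 * (2 * ?d R + 2 * ?d (real n)) + 2 * nsq (\<lambda>w. ?F (real n) w - G w)) \<longlonglongrightarrow>
       2 * (2 * ?d R + 2 * 0) + 2 * 0"
      by (intro tendsto_add tendsto_const ennreal_tendsto_cmult dn G) auto
    from tendsto_lowerbound[OF this always_eventually, of "nsq (\<lambda>w. ?F R w - G w)"] * 
    show ?thesis by (simp add: mult.assoc[symmetric])
  qed
  have lim: "((\<lambda>R. nsq (\<lambda>w. ?F R w - G w)) \<longlongrightarrow> 0) at_top"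
  proof (rule tendsto_sandwich[OF _ _ tendsto_const])
    have "((\<lambda>R. 4 * ?d R) \<longlongrightarrow> 4 * 0) at_top" by (intro ennreal_tendsto_cmult d) simp
    then show "((\<lambda>R. 4 * ?d R) \<longlongrightarrow> 0) at_top" by simp
  qed (auto simp: le)
  have "nsq G \<le> nsq (\<lambda>x. complex_of_real (f x))"
    by (rule nsq_tendsto_le[OF trivial_limit_at_top_linorder _ _ _ _ d lim nsq_ft_le[OF integrable_cutoff[OF _ f2]]])
       measurable
  also have "\<dots> < \<infinity>" by (simp add: nsq_of_real f2)
  finally have "is_fourier_transform f G"
    unfolding is_fourier_transform_iff by (simp add: f2 lim integrable_nsq_finite)
  then show ?thesis
    unfolding fourier_transform_def by (rule someI[of "is_fourier_transform f"])
qed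

lemma fourier_transform_unique:
  fixes f :: "real^'d \<Rightarrow> real"
  assumes "is_fourier_transform f F" "is_fourier_transform f G"
  shows "AE w in lborel. F w = G w"
proof -
  from assms have [measurable]: "f \<in> borel_measurable borel" "F \<in> borel_measurable borel" "G \<in> borel_measurable borel"
    and F: "((\<lambda>R. nsq (\<lambda>w. ft (cutoff R f) w - F w)) \<longlongrightarrow> 0) at_top"
    and G: "((\<lambda>R. nsq (\<lambda>w. ft (cutoff R f) w - G w)) \<longlongrightarrow> 0) at_top"
    unfolding is_fourier_transform_iff by auto
  have *: "nsq (\<lambda>w. F w - G w) \<le> 2 * nsq (\<lambda>w. ft (cutoff R f) w - F w) + 2 * nsq (\<lambda>w. ft (cutoff R f) w - G w)" for R
    using nsq_triangle[of F "ft (cutoff R f)" G] by (simp add: nsq_minus_commute[of F])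
  have "((\<lambda>R. 2 * nsq (\<lambda>w. ft (cutoff R f) w - F w) + 2 * nsq (\<lambda>w. ft (cutoff R f) w - G w)) \<longlongrightarrow> 2 * 0 + 2 * 0) at_top"
    by (intro tendsto_add ennreal_tendsto_cmult F G) auto
  from tendsto_lowerbound[OF this always_eventually trivial_limit_at_top_linorder, of "nsq (\<lambda>w. F w - G w)"] *
  have "nsq (\<lambda>w. F w - G w) = 0" by simp
  then show ?thesis by (subst (asm) nsq_eq_0) auto
qed

text \<open>Two real coefficients are carried along so that sums, differences and multiples are all
  instances, with coefficients such as 1, -1 and 0.\<close>

lemma is_fourier_transform_add:
  fixes f g :: "real^'d \<Rightarrow> real"
  assumes f: "is_fourier_transform f F" and g: "is_fourier_transform g G"
  shows "is_fourier_transform (\<lambda>x. a * f x + b * g x) (\<lambda>w. complex_of_real a * F w + complex_of_real b * G w)"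
proof -
  from f g have [measurable]: "f \<in> borel_measurable borel" "F \<in> borel_measurable borel"
      "g \<in> borel_measurable borel" "G \<in> borel_measurable borel"
    and f2: "integrable lborel (\<lambda>x. (f x)\<^sup>2)" and g2: "integrable lborel (\<lambda>x. (g x)\<^sup>2)"
    and F2: "integrable lborel (\<lambda>x. (cmod (F x))\<^sup>2)" and G2: "integrable lborel (\<lambda>x. (cmod (G x))\<^sup>2)"
    and F: "((\<lambda>R. nsq (\<lambda>w. ft (cutoff R f) w - F w)) \<longlongrightarrow> 0) at_top"
    and G: "((\<lambda>R. nsq (\<lambda>w. ft (cutoff R g) w - G w)) \<longlongrightarrow> 0) at_top"
    unfolding is_fourier_transform_iff by auto
  let ?h = "\<lambda>x. a * f x + b * g x" and ?H = "\<lambda>w. complex_of_real a * F w + complex_of_real b * G w"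
  have *: "(a * x + b * y)\<^sup>2 \<le> 2 * (a\<^sup>2 * x\<^sup>2) + 2 * (b\<^sup>2 * y\<^sup>2)" for a b x y :: real
    using sum_squares_bound[of "a * x" "b * y"] by (simp add: power2_sum power_mult_distrib)
  have h2: "integrable lborel (\<lambda>x. (?h x)\<^sup>2)"
    by (rule Bochner_Integration.integrable_bound[of _ "\<lambda>x. 2 * (a\<^sup>2 * (f x)\<^sup>2) + 2 * (b\<^sup>2 * (g x)\<^sup>2)"])
       (use f2 g2 * in \<open>auto intro!: AE_I2\<close>)
  have H2: "integrable lborel (\<lambda>x. (cmod (?H x))\<^sup>2)"
  proof (rule Bochner_Integration.integrable_bound[of _ "\<lambda>x. 2 * (a\<^sup>2 * (cmod (F x))\<^sup>2) + 2 * (b\<^sup>2 * (cmod (G x))\<^sup>2)"])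
    show "AE x in lborel. norm ((cmod (?H x))\<^sup>2) \<le> norm (2 * (a\<^sup>2 * (cmod (F x))\<^sup>2) + 2 * (b\<^sup>2 * (cmod (G x))\<^sup>2))"
    proof (intro AE_I2)
      fix x
      have "cmod (?H x) \<le> \<bar>a\<bar> * cmod (F x) + \<bar>b\<bar> * cmod (G x)"
        by (rule order_trans[OF norm_triangle_ineq]) (simp add: norm_mult)
      then have "(cmod (?H x))\<^sup>2 \<le> (\<bar>a\<bar> * cmod (F x) + \<bar>b\<bar> * cmod (G x))\<^sup>2"
        by (rule power_mono) simp
      also have "\<dots> \<le> 2 * (a\<^sup>2 * (cmod (F x))\<^sup>2) + 2 * (b\<^sup>2 * (cmod (G x))\<^sup>2)"
        using *[of "\<bar>a\<bar>" "cmod (F x)" "\<bar>b\<bar>" "cmod (G x)"] by simp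
      finally show "norm ((cmod (?H x))\<^sup>2) \<le> norm (2 * (a\<^sup>2 * (cmod (F x))\<^sup>2) + 2 * (b\<^sup>2 * (cmod (G x))\<^sup>2))" by simp
    qed
  qed (use F2 G2 in auto)
  have cut: "cutoff R ?h = (\<lambda>x. complex_of_real a * cutoff R f x + complex_of_real b * cutoff R g x)" for R
    by (auto simp: cutoff_def fun_eq_iff algebra_simps)
  have le: "nsq (\<lambda>w. ft (cutoff R ?h) w - ?H w) \<le>
      2 * (ennreal (a\<^sup>2) * nsq (\<lambda>w. ft (cutoff R f) w - F w)) + 2 * (ennreal (b\<^sup>2) * nsq (\<lambda>w. ft (cutoff R g) w - G w))" for R
  proof -
    have "nsq (\<lambda>w. ft (cutoff R ?h) w - ?H w) =
       nsq (\<lambda>w. complex_of_real a * (ft (cutoff R f) w - F w) + complex_of_real b * (ft (cutoff R g) w - G w))"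
      unfolding cut by (subst ft_add) (auto simp: ft_cmult integrable_cutoff f2 g2 algebra_simps)
    \<comment> \<open>The triangle inequality is about a difference through an intermediate
      function: the intermediate is 0 here, and the sign of \<open>b\<close> is flipped to write the
      sum as a difference.\<close>
    also have "\<dots> \<le> 2 * nsq (\<lambda>w. complex_of_real a * (ft (cutoff R f) w - F w)) + 2 * nsq (\<lambda>w. complex_of_real b * (ft (cutoff R g) w - G w))"
      using nsq_triangle[of "\<lambda>w. complex_of_real a * (ft (cutoff R f) w - F w)" "\<lambda>_. 0" "\<lambda>w. complex_of_real (- b) * (ft (cutoff R g) w - G w)"]
      by (simp add: nsq_minus_commute[of "\<lambda>_. 0"])
    finally show ?thesis by (simp add: nsq_cmult)
  qed
  have "((\<lambda>R. nsq (\<lambda>w. ft (cutoff R ?h) w - ?H w)) \<longlongrightarrow> 0) at_top"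
  proof (rule tendsto_sandwich[OF _ _ tendsto_const])
    have "((\<lambda>R. 2 * (ennreal (a\<^sup>2) * nsq (\<lambda>w. ft (cutoff R f) w - F w)) + 2 * (ennreal (b\<^sup>2) * nsq (\<lambda>w. ft (cutoff R g) w - G w)))
       \<longlongrightarrow> 2 * (ennreal (a\<^sup>2) * 0) + 2 * (ennreal (b\<^sup>2) * 0)) at_top"
      by (intro tendsto_add ennreal_tendsto_cmult F G) auto
    then show "((\<lambda>R. 2 * (ennreal (a\<^sup>2) * nsq (\<lambda>w. ft (cutoff R f) w - F w)) + 2 * (ennreal (b\<^sup>2) * nsq (\<lambda>w. ft (cutoff R g) w - G w))) \<longlongrightarrow> 0) at_top"
      by simp
  qed (use le in auto)
  with h2 H2 show ?thesis unfolding is_fourier_transform_iff by auto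
qed

text \<open>Expanding the square, the squared \<open>L\<^sup>2\<close> distance between \<open>G\<close> and the transform of the cut-off \<open>f\<close>
  is at most the squared norm of \<open>G\<close> minus that of the cut-off \<open>f\<close>; so Plancherel's equality
  for \<open>G\<close> is all that is needed.\<close>

lemma is_fourier_transform_inverse:
  fixes f :: "real^'d \<Rightarrow> real"
  assumes G1: "integrable lborel G" and G2: "integrable lborel (\<lambda>w. (cmod (G w))\<^sup>2)"
    and f: "\<And>x. complex_of_real (f x) = ft G (- x)"
    and le: "nsq G \<le> nsq (\<lambda>x. complex_of_real (f x))"
  shows "is_fourier_transform f G"
proof -
  have [measurable]: "G \<in> borel_measurable borel" using G1 by auto
  have "f = (\<lambda>x. Re (ft G (- x)))" using f by (metis Re_complex_of_real)
  then have [measurable]: "f \<in> borel_measurable borel" by simp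
  have "nsq (\<lambda>x. complex_of_real (f x)) = nsq (ft G)"
    unfolding f nsq_def by (subst lborel_nn_integral_affine[where c="-1" and t=0]) auto
  then have eq: "nsq (\<lambda>x. complex_of_real (f x)) = nsq G"
    using le nsq_ft_le[OF G1] by simp
  then have "nsq (\<lambda>x. complex_of_real (f x)) < \<infinity>"
    using G2 by (simp add: integrable_nsq_finite)
  then have "integrable lborel (\<lambda>x. (cmod (complex_of_real (f x)))\<^sup>2)"
    by (subst integrable_nsq_finite) auto
  then have f2: "integrable lborel (\<lambda>x. (f x)\<^sup>2)" by simp
  have N: "(LINT x|lborel. (f x)\<^sup>2) = (LINT w|lborel. (cmod (G w))\<^sup>2)"
    using eq by (simp add: nsq_of_real f2 nsq_eq_integral G2)
  let ?h = "\<lambda>R x. (indicator (cball 0 R) x :: real) * (f x)\<^sup>2"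
  have hi: "integrable lborel (?h R)" for R
    by (rule Bochner_Integration.integrable_bound[OF f2]) (auto simp: indicator_def)
  have le: "nsq (\<lambda>w. ft (cutoff R f) w - G w) \<le> ennreal ((LINT x|lborel. (f x)\<^sup>2) - (LINT x|lborel. ?h R x))" for R
  proof -
    let ?F = "ft (cutoff R f)"
    have c1: "integrable lborel (cutoff R f)" by (intro integrable_cutoff f2) auto
    have c2: "(cmod (cutoff R f x))\<^sup>2 = ?h R x" for x by (auto simp: cutoff_def indicator_def)
    have c2i: "integrable lborel (\<lambda>x. (cmod (cutoff R f x))\<^sup>2)" unfolding c2 by (rule hi)
    have F2: "integrable lborel (\<lambda>w. (cmod (?F w))\<^sup>2)"
      using nsq_ft_le[OF c1] c2i by (simp add: integrable_nsq_finite)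
    have FF: "(LINT w|lborel. (cmod (?F w))\<^sup>2) \<le> (LINT x|lborel. ?h R x)"
    proof -
      have "ennreal (LINT w|lborel. (cmod (?F w))\<^sup>2) \<le> ennreal (LINT x|lborel. ?h R x)"
        using nsq_ft_le[OF c1] unfolding nsq_eq_integral[OF c2i] nsq_eq_integral[OF F2] c2 .
      then show ?thesis by (subst (asm) ennreal_le_iff) auto
    qed
    have Fi: "integrable lborel (\<lambda>w. cnj (?F w) * G w)"
      by (intro integrable_mult_L2) (use F2 G2 in auto)
    \<comment> \<open>Because \<open>f\<close> is the inverse integral of \<open>G\<close>, the
      multiplication formula makes the cross term exactly the squared norm of the cut-off
      \<open>f\<close>.\<close>
    have "(LINT w|lborel. cnj (?F w) * G w) = (LINT x|lborel. cnj (cutoff R f x) * complex_of_real (f x))"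
      unfolding f by (rule integral_cnj_ft_mult[OF c1 G1])
    also have "\<dots> = complex_of_real (LINT x|lborel. ?h R x)"
      unfolding integral_complex_of_real[symmetric]
      by (intro Bochner_Integration.integral_cong) (auto simp: cutoff_def power2_eq_square)
    finally have FG: "(LINT w|lborel. Re (cnj (?F w) * G w)) = (LINT x|lborel. ?h R x)"
      using integral_Re[OF Fi] by simp
    have pt: "(cmod (?F w - G w))\<^sup>2 = (cmod (?F w))\<^sup>2 + (cmod (G w))\<^sup>2 - 2 * Re (cnj (?F w) * G w)" for w
      unfolding cmod_power2 by (simp add: power2_eq_square algebra_simps)
    have i: "integrable lborel (\<lambda>w. Re (cnj (?F w) * G w))" using Fi by (rule integrable_Re)
    have "integrable lborel (\<lambda>w. (cmod (?F w - G w))\<^sup>2)"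
      unfolding pt
      by (intro Bochner_Integration.integrable_diff Bochner_Integration.integrable_add integrable_mult_right F2 G2 i)
    then have "nsq (\<lambda>w. ?F w - G w) = ennreal (LINT w|lborel. (cmod (?F w - G w))\<^sup>2)"
      by (rule nsq_eq_integral)
    also have "(LINT w|lborel. (cmod (?F w - G w))\<^sup>2) = (LINT w|lborel. (cmod (?F w))\<^sup>2) + (LINT w|lborel. (cmod (G w))\<^sup>2) - 2 * (LINT x|lborel. ?h R x)"
      unfolding pt FG[symmetric]
      by (simp only: Bochner_Integration.integral_diff Bochner_Integration.integral_add integrable_mult_right
          Bochner_Integration.integrable_add integral_mult_right_zero F2 G2 i)
    also have "ennreal \<dots> \<le> ennreal ((LINT x|lborel. (f x)\<^sup>2) - (LINT x|lborel. ?h R x))"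
      using FF N by (intro ennreal_leI) simp
    finally show ?thesis .
  qed
  have "((\<lambda>R. LINT x|lborel. ?h R x) \<longlongrightarrow> (LINT x|lborel. (f x)\<^sup>2)) at_top"
  proof (rule integral_dominated_convergence_at_top[where w="\<lambda>x. (f x)\<^sup>2"])
    show "AE x in lborel. ((\<lambda>R. ?h R x) \<longlongrightarrow> (f x)\<^sup>2) at_top"
    proof (intro AE_I2 tendsto_eventually)
      fix x :: "real^'d"
      show "\<forall>\<^sub>F R in at_top. ?h R x = (f x)\<^sup>2"
        using eventually_ge_at_top[of "norm x"] by eventually_elim auto
    qed
    show "\<forall>\<^sub>F R in at_top. AE x in lborel. norm (?h R x) \<le> (f x)\<^sup>2"
      by (intro always_eventually allI AE_I2) (auto simp: indicator_def)
    show "(\<lambda>x. ?h R x) \<in> borel_measurable lborel" for R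
      by (rule borel_measurable_integrable[OF hi])
  qed (use f2 in auto)
  from tendsto_diff[OF tendsto_const this, of "LINT x|lborel. (f x)\<^sup>2"]
  have "((\<lambda>R. (LINT x|lborel. (f x)\<^sup>2) - (LINT x|lborel. ?h R x)) \<longlongrightarrow> 0) at_top" by simp
  then have "((\<lambda>R. ennreal ((LINT x|lborel. (f x)\<^sup>2) - (LINT x|lborel. ?h R x))) \<longlongrightarrow> ennreal 0) at_top"
    by (intro tendsto_ennrealI) 
  then have up: "((\<lambda>R. ennreal ((LINT x|lborel. (f x)\<^sup>2) - (LINT x|lborel. ?h R x))) \<longlongrightarrow> 0) at_top"
    by simp
  have "((\<lambda>R. nsq (\<lambda>w. ft (cutoff R f) w - G w)) \<longlongrightarrow> 0) at_top"
    by (rule tendsto_sandwich[OF always_eventually[OF allI] always_eventually[OF allI[OF le]] tendsto_const up]) simp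
  with f2 G2 show ?thesis unfolding is_fourier_transform_iff by simp
qed

section \<open>Decay and bump functions\<close>

text \<open>Dyadic comparison: on the shell of outer radius \<open>2 ^ n\<close> the integrand is at
  most \<open>2 powr \<tau> * 2 powr (- (n * \<tau>))\<close>, while the ball has volume
  proportional to \<open>2 ^ (n * d)\<close>. The dominating series is geometric with ratio
  \<open>2 powr (d - \<tau>)\<close>.\<close>

lemma integrable_decay:
  assumes \<tau>: "\<tau> > real DIM('a::euclidean_space)"
  shows "integrable lborel (\<lambda>x::'a. inverse (1 + norm x powr \<tau>))"
proof -
  let ?d = "DIM('a)" and ?V = "unit_ball_vol (real DIM('a))"
  define q where "q = 2 powr (real ?d - \<tau>)"
  have q: "0 < q" by (simp add: q_def)
  have q1: "q < 1" using \<tau> powr_less_mono[of "real ?d - \<tau>" 0 2] by (simp add: q_def)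
  have \<tau>0: "\<tau> > 0" using \<tau> by (rule less_trans[rotated]) simp
  let ?c = "\<lambda>n. 2 powr \<tau> * 2 powr (- (real n * \<tau>))"
  have "(\<integral>\<^sup>+x. ennreal (inverse (1 + norm (x::'a) powr \<tau>)) \<partial>lborel) \<le>
      (\<integral>\<^sup>+x. (\<Sum>n. ennreal (?c n) * indicator (cball (0::'a) (2 ^ n)) x) \<partial>lborel)"
  proof (intro nn_integral_mono)
    fix x :: 'a
    obtain n where n: "norm x \<le> 2 ^ n" and le: "inverse (1 + norm x powr \<tau>) \<le> ?c n"
    proof (cases "norm x \<le> 1")
      case True
      have "inverse (1 + norm x powr \<tau>) \<le> 1" by (simp add: inverse_le_1_iff)
      also have "1 \<le> ?c 0" using \<tau>0 by (simp add: ge_one_powr_ge_zero)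
      finally show ?thesis using True by (intro that[of 0]) simp_all
    next
      case False
      \<comment> \<open>The least such \<open>n\<close> puts \<open>x\<close> outside the ball of
        radius \<open>2 ^ (n - 1)\<close>; the lost power of 2 is the factor
        \<open>2 powr \<tau>\<close> in \<open>?c\<close>.\<close>
      define n where "n = (LEAST n. norm x \<le> 2 ^ n)"
      have ex: "\<exists>n. norm x \<le> 2 ^ n" using real_arch_pow[of 2 "norm x"] by (auto intro: less_imp_le)
      have n: "norm x \<le> 2 ^ n" unfolding n_def by (rule LeastI_ex[OF ex])
      have n0: "n \<noteq> 0" using n False by (intro notI) simp
      then obtain m where m: "n = Suc m" by (cases n) auto
      have "\<not> norm x \<le> 2 ^ m" using not_less_Least[of m "\<lambda>n. norm x \<le> 2 ^ n"] m by (simp add: n_def)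
      then have "2 ^ m \<le> norm x" by simp
      then have "(2 ^ m) powr \<tau> \<le> norm x powr \<tau>" using \<tau>0 by (intro powr_mono2) auto
      then have "inverse (1 + norm x powr \<tau>) \<le> inverse ((2 ^ m) powr \<tau>)"
        by (intro le_imp_inverse_le) auto
      also have "\<dots> = ?c n"
      proof -
        have "(2::real) ^ m = 2 powr real m" by (simp add: powr_realpow)
        then have "inverse ((2 ^ m) powr \<tau>) = (2::real) powr (- (real m * \<tau>))"
          by (simp only: powr_powr powr_minus)
        also have "- (real m * \<tau>) = \<tau> + - (real n * \<tau>)" by (simp add: m distrib_right)
        finally show ?thesis by (simp only: powr_add)
      qed
      finally show ?thesis using n by (intro that)
    qed
    define h where "h k = ennreal (?c k) * indicator (cball (0::'a) (2 ^ k)) x" for k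
    have "ennreal (inverse (1 + norm x powr \<tau>)) \<le> (\<Sum>k\<in>{n}. h k)"
      using n ennreal_leI[OF le] by (simp add: h_def)
    also have "\<dots> \<le> (\<Sum>k. h k)"
      by (intro sum_le_suminf) auto
    also have "\<dots> = (\<Sum>n. ennreal (?c n) * indicator (cball (0::'a) (2 ^ n)) x)"
      by (simp add: h_def)
    finally show "ennreal (inverse (1 + norm x powr \<tau>)) \<le> (\<Sum>n. ennreal (?c n) * indicator (cball (0::'a) (2 ^ n)) x)" .
  qed
  also have "\<dots> = (\<Sum>n. ennreal (?c n) * emeasure lborel (cball (0::'a) (2 ^ n)))"
  proof (subst nn_integral_suminf)
    show "(\<lambda>x. ennreal (?c n) * indicator (cball (0::'a) (2 ^ n)) x) \<in> borel_measurable lborel" for n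
    proof -
      have [measurable]: "cball (0::'a) (2 ^ n) \<in> sets borel" by simp
      show ?thesis by measurable
    qed
  qed (simp only: nn_integral_cmult_indicator sets_lborel borel_closed closed_cball)
  also have "\<dots> = (\<Sum>n. ennreal (2 powr \<tau> * ?V * q ^ n))"
  proof (intro suminf_cong)
    fix n
    have "ennreal (?c n) * emeasure lborel (cball (0::'a) (2 ^ n)) = ennreal (?c n * (?V * (2 ^ n) ^ ?d))"
      by (simp add: emeasure_cball ennreal_mult)
    also have "?c n * (?V * (2 ^ n) ^ ?d) = 2 powr \<tau> * ?V * q ^ n"
    proof -
      have "((2::real) ^ n) ^ ?d = 2 powr (real n * real ?d)"
        by (simp only: power_mult[symmetric] of_nat_mult[symmetric] powr_realpow zero_less_numeral)
      moreover have "q ^ n = 2 powr (real n * real ?d + - (real n * \<tau>))"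
      proof -
        have "q ^ n = q powr real n" by (rule powr_realpow[symmetric, OF q])
        also have "\<dots> = 2 powr ((real ?d - \<tau>) * real n)" by (simp only: q_def powr_powr)
        also have "(real ?d - \<tau>) * real n = real n * real ?d + - (real n * \<tau>)" by (simp add: algebra_simps)
        finally show ?thesis .
      qed
      ultimately show ?thesis by (simp only: powr_add mult_ac)
    qed
    finally show "ennreal (?c n) * emeasure lborel (cball (0::'a) (2 ^ n)) = ennreal (2 powr \<tau> * ?V * q ^ n)" .
  qed
  also have "\<dots> < \<infinity>"
  proof (subst suminf_ennreal2)
    show "summable (\<lambda>n. 2 powr \<tau> * ?V * q ^ n)"
      by (rule summable_mult, rule summable_geometric) (use q q1 in simp)
  qed (use q in simp_all)
  finally have "(\<integral>\<^sup>+x. ennreal (inverse (1 + norm (x::'a) powr \<tau>)) \<partial>lborel) < \<infinity>" .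
  then show ?thesis by (intro integrableI_nonneg) simp_all
qed

section \<open>Compactly supported bumps whose transforms decay to a prescribed order\<close>

definition cutoff_profile :: "real \<Rightarrow> real \<Rightarrow> ('a::euclidean_space \<Rightarrow> real) \<Rightarrow> bool" where
  "cutoff_profile \<rho> R f \<longleftrightarrow> continuous_on UNIV f \<and> (\<forall>x. 0 \<le> f x \<and> f x \<le> 1) \<and>
     (\<forall>x. norm x \<le> \<rho> \<longrightarrow> f x = 1) \<and> (\<forall>x. R \<le> norm x \<longrightarrow> f x = 0)"

lemma cutoff_profile_integrable:
  fixes f :: "'a::euclidean_space \<Rightarrow> real"
  assumes f: "cutoff_profile \<rho> R f"
  shows "integrable lborel f"
proof (rule Bochner_Integration.integrable_bound)
  show "integrable lborel (indicator (cball 0 R) :: 'a \<Rightarrow> real)"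
    by (intro integrable_real_indicator) (auto simp: emeasure_lborel_cball_finite[unfolded infinity_ennreal_def])
  show "f \<in> borel_measurable lborel"
    using f by (auto simp: cutoff_profile_def intro: borel_measurable_continuous_onI)
  show "AE x in lborel. norm (f x) \<le> norm (indicator (cball 0 R) x :: real)"
    using f by (intro AE_I2) (auto simp: cutoff_profile_def indicator_def)
qed

text \<open>Averaging over the segment from \<open>- v\<close> to \<open>v\<close> makes the Fourier transform decay one order faster
  in direction \<open>v\<close>, and it keeps the value at points around which \<open>f\<close> is constant.\<close>

definition smear :: "'a::euclidean_space \<Rightarrow> ('a \<Rightarrow> real) \<Rightarrow> 'a \<Rightarrow> real" where
  "smear v f x = (LINT t|lborel. indicator {0..1} t * f (x + (2 * t - 1) *\<^sub>R v))"

text \<open>An average over points at distance at most \<open>norm v\<close> shrinks the plateau and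
  enlarges the support by no more than that. Tracking both radii allows the averaging to be iterated
  while the value at 0 and the support stay under control.\<close>

lemma smear_profile:
  fixes f :: "'a::euclidean_space \<Rightarrow> real"
  assumes f: "cutoff_profile \<rho> R f"
  shows "cutoff_profile (\<rho> - norm v) (R + norm v) (smear v f)"
proof -
  have cont: "continuous_on UNIV f" and b: "\<And>x. 0 \<le> f x" "\<And>x. f x \<le> 1"
    and one: "\<And>x. norm x \<le> \<rho> \<Longrightarrow> f x = 1" and zero: "\<And>x. R \<le> norm x \<Longrightarrow> f x = 0"
    using f by (auto simp: cutoff_profile_def)
  have [measurable]: "f \<in> borel_measurable borel" using cont by (rule borel_measurable_continuous_onI)
  have I: "integrable lborel (indicator {0..1} :: real \<Rightarrow> real)"
    by (intro integrable_real_indicator) auto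
  have int: "integrable lborel (\<lambda>t. indicator {0..1} t * f (x + (2 * t - 1) *\<^sub>R v))" for x
    by (rule Bochner_Integration.integrable_bound[OF I]) (use b in \<open>auto simp: indicator_def\<close>)
  have I1: "(LINT t|lborel. indicator {0..1::real} t) = (1::real)" by simp
  have small: "norm ((2 * t - 1) *\<^sub>R v) \<le> norm v" if "0 \<le> t" "t \<le> 1" for t :: real
  proof -
    have "\<bar>2 * t - 1\<bar> \<le> 1" using that by linarith
    then show ?thesis by (simp add: mult_left_le_one_le)
  qed
  have "continuous_on UNIV (smear v f)"
  proof -
    have "(\<lambda>n. smear v f (s n)) \<longlonglongrightarrow> smear v f x" if s: "s \<longlonglongrightarrow> x" for s x
      unfolding smear_def
    proof (rule integral_dominated_convergence[where w="indicator {0..1}"])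
      show "AE t in lborel. (\<lambda>n. indicator {0..1} t * f (s n + (2 * t - 1) *\<^sub>R v)) \<longlonglongrightarrow> indicator {0..1} t * f (x + (2 * t - 1) *\<^sub>R v)"
      proof (intro AE_I2 tendsto_mult tendsto_const)
        fix t :: real
        have "isCont f (x + (2 * t - 1) *\<^sub>R v)" using cont by (simp add: continuous_on_eq_continuous_at)
        then show "(\<lambda>n. f (s n + (2 * t - 1) *\<^sub>R v)) \<longlonglongrightarrow> f (x + (2 * t - 1) *\<^sub>R v)"
          by (rule isCont_tendsto_compose) (intro tendsto_add s tendsto_const)
      qed
    qed (use I b in \<open>auto simp: indicator_def\<close>)
    then show ?thesis by (auto simp: continuous_on_sequentially o_def)
  qed
  moreover have "0 \<le> smear v f x" for x
    unfolding smear_def by (intro Bochner_Integration.integral_nonneg) (use b in auto)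
  moreover have "smear v f x \<le> 1" for x
  proof -
    have "smear v f x \<le> (LINT t|lborel. indicator {0..1::real} t)"
      unfolding smear_def by (intro Bochner_Integration.integral_mono int I) (use b in \<open>auto simp: indicator_def\<close>)
    then show ?thesis by simp
  qed
  moreover have "smear v f x = 1" if "norm x \<le> \<rho> - norm v" for x
  proof -
    have "smear v f x = (LINT t|lborel. indicator {0..1::real} t)"
      unfolding smear_def
    proof (intro Bochner_Integration.integral_cong refl)
      fix t :: real
      show "indicator {0..1} t * f (x + (2 * t - 1) *\<^sub>R v) = indicator {0..1} t"
        using small[of t] that norm_triangle_ineq[of x "(2 * t - 1) *\<^sub>R v"]
        by (cases "0 \<le> t \<and> t \<le> 1") (auto intro!: one)
    qed
    then show ?thesis by simp
  qed
  moreover have "smear v f x = 0" if "R + norm v \<le> norm x" for x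
  proof -
    have "smear v f x = (LINT (t::real)|lborel. (0::real))"
      unfolding smear_def
    proof (intro Bochner_Integration.integral_cong refl)
      fix t :: real
      show "indicator {0..1} t * f (x + (2 * t - 1) *\<^sub>R v) = 0"
        using small[of t] that norm_diff_ineq[of x "(2 * t - 1) *\<^sub>R v"]
        by (cases "0 \<le> t \<and> t \<le> 1") (auto intro!: zero)
    qed
    then show ?thesis by simp
  qed
  ultimately show ?thesis by (auto simp: cutoff_profile_def)
qed

text \<open>For nonzero \<open>s\<close> the integral is \<open>sin s / s\<close>, the multiplier by
  which \<open>smear v\<close> acts on the transform at \<open>s = v \<bullet> w\<close>. One bound
  is trivial, the other comes from an antiderivative.\<close>

lemma norm_integral_cis_le:
  "cmod (LINT t|lborel. indicator {0..1} t *\<^sub>R cis ((2 * t - 1) * s)) \<le> 1 / max 1 \<bar>s\<bar>"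
proof -
  have b: "cmod (LINT t|lborel. indicator {0..1} t *\<^sub>R cis ((2 * t - 1) * s)) \<le> 1"
  proof -
    have "cmod (LINT t|lborel. indicator {0..1} t *\<^sub>R cis ((2 * t - 1) * s)) \<le> 
       (LINT t|lborel. norm (indicator {0..1::real} t *\<^sub>R cis ((2 * t - 1) * s)))" by (rule integral_norm_bound)
    also have "\<dots> = (LINT t|lborel. indicator {0..1::real} t)" by simp
    finally show ?thesis by simp
  qed
  show ?thesis
  proof (cases "\<bar>s\<bar> \<le> 1")
    case True then show ?thesis using b by (simp add: max_def)
  next
    case False
    then have s: "s \<noteq> 0" by auto
    let ?F = "\<lambda>t. cis ((2 * t - 1) * s) * (1 / (\<i> * complex_of_real (2 * s)))"
    have "(LINT t|lborel. indicator {0..1} t *\<^sub>R cis ((2 * t - 1) * s)) = ?F 1 - ?F 0"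
    proof (rule integral_FTC_Icc)
      fix t :: real
      have "((\<lambda>t. cis ((2 * t - 1) * s)) has_derivative (\<lambda>y. (2 * y * s) *\<^sub>R (\<i> * cis ((2 * t - 1) * s)))) (at t within {0..1})"
        by (rule has_derivative_cis) (auto intro!: derivative_eq_intros)
      from has_derivative_mult_left[OF this, of "1 / (\<i> * complex_of_real (2 * s))"]
      show "(?F has_vector_derivative cis ((2 * t - 1) * s)) (at t within {0..1})"
        unfolding has_vector_derivative_def
        by (rule has_derivative_eq_rhs) (use s in \<open>auto simp: fun_eq_iff scaleR_conv_of_real field_simps\<close>)
    qed (auto intro!: continuous_intros)
    also have "?F 1 - ?F 0 = (cis s - cis (- s)) * (1 / (\<i> * complex_of_real (2 * s)))"
      by (simp add: diff_divide_distrib)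
    also have "cmod \<dots> \<le> 2 * (1 / (2 * \<bar>s\<bar>))"
      unfolding norm_mult
      by (intro mult_mono order_trans[OF norm_triangle_ineq4]) (auto simp: norm_divide norm_mult)
    finally show ?thesis using False by (simp add: max_def)
  qed
qed

lemma ft_shift:
  fixes f :: "'a::euclidean_space \<Rightarrow> complex"
  shows "ft (\<lambda>x. f (x + v)) w = cis (v \<bullet> w) * ft f w"
proof -
  have "(LINT x|lborel. f x * cis (- (x \<bullet> w))) = (LINT x|lborel. f (v + x) * cis (- ((v + x) \<bullet> w)))"
    using lborel_integral_affine[of 1 "\<lambda>x. f x * cis (- (x \<bullet> w))" v] by simp
  also have "(\<lambda>x. f (v + x) * cis (- ((v + x) \<bullet> w))) = (\<lambda>x. cis (- (v \<bullet> w)) * (f (x + v) * cis (- (x \<bullet> w))))"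
  proof
    fix x
    have "cis (- ((v + x) \<bullet> w)) = cis (- (v \<bullet> w)) * cis (- (x \<bullet> w))"
      by (simp add: cis_mult inner_add_left)
    then show "f (v + x) * cis (- ((v + x) \<bullet> w)) = cis (- (v \<bullet> w)) * (f (x + v) * cis (- (x \<bullet> w)))"
      by (simp add: add.commute)
  qed
  finally have "(LINT x|lborel. f x * cis (- (x \<bullet> w))) = cis (- (v \<bullet> w)) * (LINT x|lborel. f (x + v) * cis (- (x \<bullet> w)))"
    by (simp only: integral_mult_right_zero)
  then have "cis (v \<bullet> w) * (LINT x|lborel. f x * cis (- (x \<bullet> w))) = (LINT x|lborel. f (x + v) * cis (- (x \<bullet> w)))"
    by (simp only: mult.assoc[symmetric] cis_mult) simp
  then show ?thesis
    unfolding ft_def by (simp only: mult.left_commute[of "cis _"])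
qed

lemma ft_smear:
  fixes f :: "'a::euclidean_space \<Rightarrow> real"
  assumes f: "cutoff_profile \<rho> R f"
  shows "ft (\<lambda>x. complex_of_real (smear v f x)) w =
     (LINT t|lborel. indicator {0..1} t *\<^sub>R cis ((2 * t - 1) * (v \<bullet> w))) * ft (\<lambda>x. complex_of_real (f x)) w"
proof -
  let ?C = "complex_of_real ((2 * pi) powr (- real DIM('a) / 2))"
  have cont: "continuous_on UNIV f"
    using f by (auto simp: cutoff_profile_def)
  have fi: "integrable lborel f" by (rule cutoff_profile_integrable[OF f])
  have [measurable]: "f \<in> borel_measurable borel" using cont by (rule borel_measurable_continuous_onI)
  let ?h = "\<lambda>(t::real) x. indicator {0..1} t *\<^sub>R (complex_of_real (f (x + (2 * t - 1) *\<^sub>R v)) * cis (- (x \<bullet> w)))"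
  have shi: "integrable lborel (\<lambda>x. f (x + y))" for y
    using lborel_integrable_affine[OF _ fi, of 1 y] by (simp add: add.commute)
  have sh: "(LINT x|lborel. f (x + y)) = (LINT x|lborel. f x)" for y
    using lborel_integral_affine[of 1 f y] by (simp add: add.commute)
  have int: "integrable (lborel \<Otimes>\<^sub>M lborel) (\<lambda>(t, x). ?h t x)"
  proof (rule lborel_pair.Fubini_integrable)
    have "(LINT x|lborel. norm (?h t x)) = indicator {0..1} t * (LINT x|lborel. f x)" for t
      using f by (simp add: norm_mult cutoff_profile_def sh)
    then show "integrable lborel (\<lambda>t. LINT x|lborel. norm (case (t, x) of (t, x) \<Rightarrow> ?h t x))"
      unfolding prod.case by (simp only:) (intro integrable_mult_left integrable_real_indicator, auto)
    show "AE t in lborel. integrable lborel (\<lambda>x. case (t, x) of (t, x) \<Rightarrow> ?h t x)"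
      using shi by (auto intro!: AE_I2 integrable_scaleR_right integrable_mult_cis integrable_of_real)
  qed measurable
  have "(LINT x|lborel. complex_of_real (smear v f x) * cis (- (x \<bullet> w))) = (LINT x|lborel. (LINT t|lborel. ?h t x))"
    unfolding smear_def integral_complex_of_real[symmetric] integral_mult_left_zero[symmetric]
    by (intro Bochner_Integration.integral_cong refl) (simp add: scaleR_conv_of_real)
  also have "\<dots> = (LINT t|lborel. (LINT x|lborel. ?h t x))"
    by (rule lborel_pair.Fubini_integral[OF int])
  finally have "ft (\<lambda>x. complex_of_real (smear v f x)) w = (LINT t|lborel. ?C * (LINT x|lborel. ?h t x))"
    by (simp only: ft_def integral_mult_right_zero)
  also have "\<dots> = (LINT t|lborel. indicator {0..1} t *\<^sub>R cis ((2 * t - 1) * (v \<bullet> w)) * ft (\<lambda>x. complex_of_real (f x)) w)"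
  proof (intro Bochner_Integration.integral_cong refl)
    fix t :: real
    have "?C * (LINT x|lborel. ?h t x) = indicator {0..1} t *\<^sub>R ft (\<lambda>x. complex_of_real (f (x + (2 * t - 1) *\<^sub>R v))) w"
      by (simp add: ft_def scaleR_conv_of_real mult.left_commute)
    then show "?C * (LINT x|lborel. ?h t x) = indicator {0..1} t *\<^sub>R cis ((2 * t - 1) * (v \<bullet> w)) * ft (\<lambda>x. complex_of_real (f x)) w"
      by (simp add: ft_shift[of "\<lambda>x. complex_of_real (f x)"])
  qed
  finally show ?thesis by (simp only: integral_mult_left_zero)
qed

text \<open>A list of directions, because the same direction is to occur several times: each
  occurrence gains one order of decay and costs \<open>norm v\<close> in both radii.\<close>

lemma cutoff_profile_smear_list:
  fixes vs :: "'a::euclidean_space list"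
  assumes "cutoff_profile \<rho> R f"
  shows "\<exists>g. cutoff_profile (\<rho> - (\<Sum>v\<leftarrow>vs. norm v)) (R + (\<Sum>v\<leftarrow>vs. norm v)) g \<and>
     (\<forall>w. cmod (ft (\<lambda>x. complex_of_real (g x)) w) \<le>
        (\<Prod>v\<leftarrow>vs. 1 / max 1 \<bar>v \<bullet> w\<bar>) * cmod (ft (\<lambda>x. complex_of_real (f x)) w))"
proof (induction vs)
  case Nil
  show ?case using assms by (intro exI[of _ f]) simp
next
  case (Cons v vs)
  let ?s = "\<Sum>v\<leftarrow>vs. norm v"
  obtain g where g: "cutoff_profile (\<rho> - ?s) (R + ?s) g"
    and le: "\<And>w. cmod (ft (\<lambda>x. complex_of_real (g x)) w) \<le>
        (\<Prod>v\<leftarrow>vs. 1 / max 1 \<bar>v \<bullet> w\<bar>) * cmod (ft (\<lambda>x. complex_of_real (f x)) w)"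
    using Cons.IH by blast
  show ?case
  proof (intro exI[of _ "smear v g"] conjI allI)
    show "cutoff_profile (\<rho> - (\<Sum>v\<leftarrow>v # vs. norm v)) (R + (\<Sum>v\<leftarrow>v # vs. norm v)) (smear v g)"
      using smear_profile[OF g, of v] by (simp add: algebra_simps)
    fix w
    show "cmod (ft (\<lambda>x. complex_of_real (smear v g x)) w) \<le>
        (\<Prod>v\<leftarrow>v # vs. 1 / max 1 \<bar>v \<bullet> w\<bar>) * cmod (ft (\<lambda>x. complex_of_real (f x)) w)"
      using mult_mono[OF norm_integral_cis_le[of "v \<bullet> w"] le[of w]]
      by (simp add: ft_smear[OF g] norm_mult mult.assoc)
  qed
qed

text \<open>A trapezoidal radial profile is smeared \<open>N\<close> times along every coordinate
  axis. Finitely many averages are enough because only a fixed finite order of decay is asked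
  for.\<close>

theorem bump_exists:
  obtains \<psi> :: "'a::euclidean_space \<Rightarrow> real" and A where
    "continuous_on UNIV \<psi>" "\<And>x. 0 \<le> \<psi> x" "\<And>x. \<psi> x \<le> 1" "\<psi> 0 = 1" "\<And>x. 1 \<le> norm x \<Longrightarrow> \<psi> x = 0"
    "integrable lborel \<psi>" "A \<ge> 0"
    "\<And>w. cmod (ft (\<lambda>x. complex_of_real (\<psi> x)) w) \<le> A * inverse (1 + norm w powr real N)"
proof -
  let ?d = "DIM('a)"
  \<comment> \<open>Plateau radius 1/2 and support radius 3/4: the smearing may consume 1/4 before
    the support leaves the unit ball, and then a plateau around 0 still remains.\<close>
  define f0 :: "'a \<Rightarrow> real" where "f0 x = max 0 (min 1 (3 - 4 * norm x))" for x
  have f0: "cutoff_profile (1/2) (3/4) f0"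
    unfolding cutoff_profile_def f0_def by (intro conjI allI continuous_intros) auto
  \<comment> \<open>The \<open>N * d\<close> segments of half-length \<open>a\<close> move the radii
    by \<open>N / (4 * (N + 1))\<close> in total, which is at most 1/4; the added 1 covers
    \<open>N = 0\<close>.\<close>
  define a where "a = 1 / (4 * real ?d * (real N + 1))"
  have a: "a > 0" by (simp add: a_def)
  obtain bs where bs: "set bs = (Basis :: 'a set)" "distinct bs"
    using finite_distinct_list[OF finite_Basis] by blast
  define vs where "vs = concat (replicate N (map (\<lambda>b. a *\<^sub>R b) bs))"
  have "(\<Sum>v\<leftarrow>vs. norm v) = real N * (\<Sum>b\<leftarrow>bs. a)"
  proof -
    have "(\<Sum>b\<leftarrow>bs. norm (a *\<^sub>R b)) = (\<Sum>b\<leftarrow>bs. a)"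
      using bs(1) a by (intro arg_cong[of _ _ sum_list] map_cong) auto
    then show ?thesis
      unfolding vs_def by (induction N) (auto simp: o_def distrib_right)
  qed
  also have "(\<Sum>b\<leftarrow>bs. a) = real ?d * a"
    using bs distinct_card[of bs] by (simp add: sum_list_triv)
  also have "real ?d * a = 1 / (4 * (real N + 1))"
    by (simp add: a_def)
  also have "real N * (1 / (4 * (real N + 1))) \<le> 1 / 4"
    by (simp add: field_simps)
  finally have vs: "(\<Sum>v\<leftarrow>vs. norm v) \<le> 1 / 4" .
  obtain g where g: "cutoff_profile (1/2 - (\<Sum>v\<leftarrow>vs. norm v)) (3/4 + (\<Sum>v\<leftarrow>vs. norm v)) g"
    and le: "\<And>w. cmod (ft (\<lambda>x. complex_of_real (g x)) w) \<le>
        (\<Prod>v\<leftarrow>vs. 1 / max 1 \<bar>v \<bullet> w\<bar>) * cmod (ft (\<lambda>x. complex_of_real (f0 x)) w)"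
    using cutoff_profile_smear_list[OF f0, of vs] by blast
  define A0 where "A0 = (2 * pi) powr (- real DIM('a) / 2) * (LINT x|lborel. cmod (complex_of_real (f0 x)))"
  have A0: "A0 \<ge> 0" unfolding A0_def by (intro mult_nonneg_nonneg Bochner_Integration.integral_nonneg) auto
  \<comment> \<open>The division by 2 shares the lower bound for the \<open>N\<close>-th power
    between the two terms of \<open>1 + norm w powr real N\<close>.\<close>
  define c where "c = min 1 ((a / real ?d) ^ N) / 2"
  have c: "c > 0" using a by (simp add: c_def)
  have pr: "(\<Prod>v\<leftarrow>vs. 1 / max 1 \<bar>v \<bullet> w\<bar>) \<le> inverse (c * (1 + norm w powr real N))" for w :: 'a
  proof -
    let ?P = "\<Prod>b\<in>Basis. 1 / max 1 \<bar>(a *\<^sub>R b) \<bullet> w\<bar>"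
    have "(\<Prod>v\<leftarrow>vs. 1 / max 1 \<bar>v \<bullet> w\<bar>) = (\<Prod>b\<leftarrow>bs. 1 / max 1 \<bar>(a *\<^sub>R b) \<bullet> w\<bar>) ^ N"
      unfolding vs_def by (induction N) (auto simp: o_def)
    also have "(\<Prod>b\<leftarrow>bs. 1 / max 1 \<bar>(a *\<^sub>R b) \<bullet> w\<bar>) = ?P"
      using prod.distinct_set_conv_list[OF bs(2), of "\<lambda>b. 1 / max 1 \<bar>(a *\<^sub>R b) \<bullet> w\<bar>"] bs(1) by simp
    also have "?P \<le> 1 / max 1 (a / real ?d * norm w)"
    proof -
      \<comment> \<open>Some coordinate carries at least the share \<open>1 / d\<close> of the norm
        of \<open>w\<close>. Its factor supplies all the decay, and the other factors are at most
        1.\<close>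
      obtain b where b: "b \<in> Basis" "norm w / real ?d \<le> \<bar>w \<bullet> b\<bar>"
      proof (rule ccontr)
        assume "\<not> thesis"
        then have "\<And>b. b \<in> Basis \<Longrightarrow> \<bar>w \<bullet> b\<bar> < norm w / real ?d" by (meson not_le that)
        then have "(\<Sum>b\<in>Basis. \<bar>w \<bullet> b\<bar>) < (\<Sum>b\<in>(Basis::'a set). norm w / real ?d)"
          by (intro sum_strict_mono) auto
        with norm_le_l1[of w] show False by simp
      qed
      have "?P = 1 / max 1 \<bar>(a *\<^sub>R b) \<bullet> w\<bar> * (\<Prod>b\<in>Basis - {b}. 1 / max 1 \<bar>(a *\<^sub>R b) \<bullet> w\<bar>)"
        by (rule prod.remove[OF finite_Basis b(1)])
      also have "\<dots> \<le> 1 / max 1 \<bar>(a *\<^sub>R b) \<bullet> w\<bar> * 1"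
        by (rule mult_left_mono, rule prod_le_1) simp_all
      also have "\<dots> \<le> 1 / max 1 (a / real ?d * norm w)"
      proof -
        have "a * (norm w / real ?d) \<le> a * \<bar>w \<bullet> b\<bar>" using a b by (intro mult_left_mono) auto
        then have "a / real ?d * norm w \<le> \<bar>(a *\<^sub>R b) \<bullet> w\<bar>" using a by (simp add: abs_mult inner_commute)
        then have "max 1 (a / real ?d * norm w) \<le> max 1 \<bar>(a *\<^sub>R b) \<bullet> w\<bar>" by (intro max.mono) auto
        then show ?thesis unfolding mult_1_right by (intro divide_left_mono) auto
      qed
      finally show ?thesis .
    qed
    then have "?P ^ N \<le> (1 / max 1 (a / real ?d * norm w)) ^ N"
      by (intro power_mono prod_nonneg) auto
    also have "\<dots> \<le> inverse (c * (1 + norm w powr real N))"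
    proof -
      let ?m = "max 1 (a / real ?d * norm w)"
      have 1: "1 \<le> ?m ^ N" by simp
      have "(a / real ?d * norm w) ^ N \<le> ?m ^ N" using a by (intro power_mono) auto
      then have 2: "(a / real ?d) ^ N * norm w ^ N \<le> ?m ^ N" by (simp only: power_mult_distrib)
      \<comment> \<open>Only an inequality: for \<open>w = 0\<close> and \<open>N = 0\<close> the
        left side is 0 and the right side is 1.\<close>
      have p: "norm w powr real N \<le> norm w ^ N" by (cases "w = 0") (auto simp: powr_realpow)
      have "c * (1 + norm w powr real N) \<le> c * (1 + norm w ^ N)" using c p by (intro mult_left_mono) auto
      also have "\<dots> = c + c * norm w ^ N" by (simp add: distrib_left)
      also have "\<dots> \<le> 1 / 2 + (a / real ?d) ^ N / 2 * norm w ^ N"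
        by (intro add_mono mult_right_mono) (auto simp: c_def)
      also have "\<dots> \<le> ?m ^ N" using 1 2 by linarith
      finally have "inverse (?m ^ N) \<le> inverse (c * (1 + norm w powr real N))"
        using c by (intro le_imp_inverse_le) (auto simp: add_pos_nonneg)
      then show ?thesis by (simp add: power_one_over inverse_eq_divide)
    qed
    finally show ?thesis .
  qed
  show ?thesis
  proof (rule that[of g "A0 / c"])
    show "continuous_on UNIV g" "\<And>x. 0 \<le> g x" "\<And>x. g x \<le> 1"
      using g by (auto simp: cutoff_profile_def)
    show "g 0 = 1" "\<And>x. 1 \<le> norm x \<Longrightarrow> g x = 0"
      using g vs by (auto simp: cutoff_profile_def)
    show "integrable lborel g" by (rule cutoff_profile_integrable[OF g])
    show "A0 / c \<ge> 0" using A0 c by simp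
    fix w
    have "cmod (ft (\<lambda>x. complex_of_real (g x)) w) \<le> inverse (c * (1 + norm w powr real N)) * A0"
    proof (rule order_trans[OF le mult_mono[OF pr]])
      show "cmod (ft (\<lambda>x. complex_of_real (f0 x)) w) \<le> A0" unfolding A0_def by (rule norm_ft_le)
      show "0 \<le> inverse (c * (1 + norm w powr real N))" using c by (simp add: add_nonneg_nonneg)
    qed simp
    then show "cmod (ft (\<lambda>x. complex_of_real (g x)) w) \<le> A0 / c * inverse (1 + norm w powr real N)"
      by (simp add: divide_inverse mult_ac)
  qed
qed

section \<open>Rescaled bumps as test functions; inversion for continuous functions\<close>

lemma ft_affine:
  fixes f :: "'a::euclidean_space \<Rightarrow> complex"
  assumes d: "\<delta> > 0"
  shows "ft (\<lambda>x. f ((x - y) /\<^sub>R \<delta>)) w = complex_of_real (\<delta> ^ DIM('a)) * cis (- (y \<bullet> w)) * ft f (\<delta> *\<^sub>R w)"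
proof -
  have "(LINT x|lborel. f ((x - y) /\<^sub>R \<delta>) * cis (- (x \<bullet> w))) =
      \<delta> ^ DIM('a) *\<^sub>R (LINT x|lborel. f x * cis (- ((y + \<delta> *\<^sub>R x) \<bullet> w)))"
    using d by (subst lborel_integral_affine[where c=\<delta> and t=y]) auto
  also have "(\<lambda>x. f x * cis (- ((y + \<delta> *\<^sub>R x) \<bullet> w))) = (\<lambda>x. cis (- (y \<bullet> w)) * (f x * cis (- (x \<bullet> (\<delta> *\<^sub>R w)))))"
    by (rule ext) (simp add: inner_add_left cis_mult flip: mult.left_commute)
  finally have "(LINT x|lborel. f ((x - y) /\<^sub>R \<delta>) * cis (- (x \<bullet> w))) =
      complex_of_real (\<delta> ^ DIM('a)) * (cis (- (y \<bullet> w)) * (LINT x|lborel. f x * cis (- (x \<bullet> (\<delta> *\<^sub>R w)))))"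
    by (simp only: integral_mult_right_zero scaleR_conv_of_real)
  then show ?thesis
    unfolding ft_def by (simp only: mult_ac)
qed

lemma bump_inversion:
  assumes N: "real N > real DIM('a)"
  obtains \<psi> :: "'a::euclidean_space \<Rightarrow> real" and A where
    "continuous_on UNIV \<psi>" "\<And>x. 0 \<le> \<psi> x" "\<And>x. \<psi> x \<le> 1" "\<psi> 0 = 1" "\<And>x. 1 \<le> norm x \<Longrightarrow> \<psi> x = 0"
    "integrable lborel \<psi>" "A \<ge> 0"
    "\<And>w. cmod (ft (\<lambda>x. complex_of_real (\<psi> x)) w) \<le> A * inverse (1 + norm w powr real N)"
    "integrable lborel (ft (\<lambda>x. complex_of_real (\<psi> x)))"
    "\<And>x. ft (ft (\<lambda>x. complex_of_real (\<psi> x))) (- x) = complex_of_real (\<psi> x)"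
proof -
  obtain \<psi> :: "'a \<Rightarrow> real" and A where cont: "continuous_on UNIV \<psi>" and \<psi>01: "\<And>x. 0 \<le> \<psi> x" "\<And>x. \<psi> x \<le> 1"
    and \<psi>0: "\<psi> 0 = 1" and supp: "\<And>x. 1 \<le> norm x \<Longrightarrow> \<psi> x = 0" and \<psi>i: "integrable lborel \<psi>" and A: "A \<ge> 0"
    and decay: "\<And>w. cmod (ft (\<lambda>x. complex_of_real (\<psi> x)) w) \<le> A * inverse (1 + norm w powr real N)"
    using bump_exists[of N] by blast
  let ?F = "ft (\<lambda>x. complex_of_real (\<psi> x))"
  have \<psi>ci: "integrable lborel (\<lambda>x. complex_of_real (\<psi> x))" using \<psi>i by (rule integrable_of_real)
  have [measurable]: "\<psi> \<in> borel_measurable borel" using cont by (rule borel_measurable_continuous_onI)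
  have Fi: "integrable lborel ?F"
  proof (rule Bochner_Integration.integrable_bound)
    show "integrable lborel (\<lambda>\<omega>::'a. A * inverse (1 + norm \<omega> powr real N))"
      by (intro integrable_mult_right integrable_decay N)
    show "AE \<omega> in lborel. cmod (?F \<omega>) \<le> norm (A * inverse (1 + norm \<omega> powr real N))"
      using A by (intro AE_I2 order_trans[OF decay]) simp
  qed measurable
  have inv: "ft ?F (- x) = complex_of_real (\<psi> x)" for x
    by (rule ft_inversion[OF \<psi>ci _ _ Fi, where B=1])
       (use \<psi>01 cont in \<open>auto simp: continuous_on_eq_continuous_at intro!: continuous_intros\<close>)
  show ?thesis
    by (rule that[OF cont \<psi>01 \<psi>0 supp \<psi>i A decay Fi inv])
qed

text \<open>Test functions localised near an arbitrary point, for separating continuous functions.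
  Since the transform is integrable too, they can stand on either side of the multiplication
  formula.\<close>

lemma bump_test_function:
  fixes y :: "'a::euclidean_space"
  assumes d: "\<delta> > 0"
  obtains \<phi> :: "'a \<Rightarrow> real" where
    "continuous_on UNIV \<phi>" "\<And>x. 0 \<le> \<phi> x" "\<And>x. \<phi> x \<le> 1" "\<And>x. \<delta> \<le> dist x y \<Longrightarrow> \<phi> x = 0"
    "integrable lborel \<phi>" "(LINT x|lborel. \<phi> x) > 0" "integrable lborel (ft (\<lambda>x. complex_of_real (\<phi> x)))"
proof -
  have N: "real (Suc DIM('a)) > real DIM('a)" by simp
  obtain \<psi> :: "'a \<Rightarrow> real" where cont: "continuous_on UNIV \<psi>" and \<psi>01: "\<And>x. 0 \<le> \<psi> x" "\<And>x. \<psi> x \<le> 1"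
    and \<psi>0: "\<psi> 0 = 1" and supp: "\<And>x. 1 \<le> norm x \<Longrightarrow> \<psi> x = 0" and \<psi>i: "integrable lborel \<psi>"
    and Fi: "integrable lborel (ft (\<lambda>x. complex_of_real (\<psi> x)))"
    and inv: "\<And>x. ft (ft (\<lambda>x. complex_of_real (\<psi> x))) (- x) = complex_of_real (\<psi> x)"
    using bump_inversion[OF N] by metis
  let ?F = "ft (\<lambda>x. complex_of_real (\<psi> x))"
  have [measurable]: "\<psi> \<in> borel_measurable borel" using cont by (rule borel_measurable_continuous_onI)
  \<comment> \<open>A vanishing integral would make \<open>\<psi>\<close> zero almost everywhere and
    its transform identically zero, against the inversion formula at 0.\<close>
  have pos: "(LINT x|lborel. \<psi> x) > 0"
  proof (rule ccontr)
    assume "\<not> ?thesis"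
    moreover have "(LINT x|lborel. \<psi> x) \<ge> 0" by (intro Bochner_Integration.integral_nonneg \<psi>01)
    ultimately have "(LINT x|lborel. \<psi> x) = 0" by simp
    then have "AE x in lborel. \<psi> x = 0"
      using integral_nonneg_eq_0_iff_AE[OF \<psi>i] \<psi>01 by simp
    then have "?F = ft (\<lambda>x. 0)"
      by (intro ft_eq_AE) auto
    then have "?F = (\<lambda>w. 0)" by (simp add: ft_def fun_eq_iff)
    then show False using inv[of 0] by (simp add: \<psi>0 ft_def)
  qed
  let ?\<phi> = "\<lambda>x. \<psi> ((x - y) /\<^sub>R \<delta>)"
  show ?thesis
  proof (rule that[of ?\<phi>])
    show "continuous_on UNIV ?\<phi>"
      by (intro continuous_on_compose2[OF cont] continuous_intros) auto
    show "\<And>x. 0 \<le> ?\<phi> x" "\<And>x. ?\<phi> x \<le> 1" by (rule \<psi>01)+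
    show "?\<phi> x = 0" if "\<delta> \<le> dist x y" for x
    proof (rule supp)
      have "norm ((x - y) /\<^sub>R \<delta>) = dist x y / \<delta>" using d by (simp add: dist_norm divide_inverse mult.commute)
      then show "1 \<le> norm ((x - y) /\<^sub>R \<delta>)" using d that by simp
    qed
    have "(\<lambda>x. ?\<phi> x) = (\<lambda>x. \<psi> ((- (y /\<^sub>R \<delta>)) + (1 / \<delta>) *\<^sub>R x))"
      by (simp add: fun_eq_iff scaleR_diff_right inverse_eq_divide)
    then show "integrable lborel ?\<phi>"
      using lborel_integrable_affine[OF _ \<psi>i, of "1 / \<delta>" "- (y /\<^sub>R \<delta>)"] d by simp
    have "(LINT x|lborel. ?\<phi> x) = \<delta> ^ DIM('a) *\<^sub>R (LINT x|lborel. \<psi> x)"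
      using d by (subst lborel_integral_affine[where c=\<delta> and t=y]) auto
    then show "(LINT x|lborel. ?\<phi> x) > 0" using pos d by simp
    have "integrable lborel (\<lambda>w. complex_of_real (\<delta> ^ DIM('a)) * (?F (0 + \<delta> *\<^sub>R w) * cis (- (y \<bullet> w))))"
      by (intro integrable_mult_right integrable_mult_cis lborel_integrable_affine[OF _ Fi]) (use d in auto)
    moreover have "ft (\<lambda>x. complex_of_real (?\<phi> x)) = (\<lambda>w. complex_of_real (\<delta> ^ DIM('a)) * (?F (0 + \<delta> *\<^sub>R w) * cis (- (y \<bullet> w))))"
      using ft_affine[OF d, of "\<lambda>x. complex_of_real (\<psi> x)" y] by (simp add: fun_eq_iff mult_ac)
    ultimately show "integrable lborel (ft (\<lambda>x. complex_of_real (?\<phi> x)))" by simp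
  qed
qed

text \<open>Tested against bump functions, \<open>f\<close> and the inverse Fourier integral of \<open>F\<close> agree; being continuous,
  they agree at every point.\<close>

theorem fourier_transform_inversion:
  fixes f :: "real^'d \<Rightarrow> real"
  assumes F: "is_fourier_transform f F" and cont: "continuous_on UNIV f" and Fi: "integrable lborel F"
  shows "complex_of_real (f x) = ft F (- x)"
proof (rule ccontr)
  from F have [measurable]: "f \<in> borel_measurable borel" "F \<in> borel_measurable borel"
    and f2: "integrable lborel (\<lambda>x. (f x)\<^sup>2)" and F2: "integrable lborel (\<lambda>x. (cmod (F x))\<^sup>2)"
    and lim: "((\<lambda>R. nsq (\<lambda>w. ft (cutoff R f) w - F w)) \<longlongrightarrow> 0) at_top"
    unfolding is_fourier_transform_iff by auto
  let ?D = "\<lambda>y. complex_of_real (f y) - ft F (- y)"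
  assume neq: "complex_of_real (f x) \<noteq> ft F (- x)"
  define \<epsilon> where "\<epsilon> = cmod (?D x) / 2"
  have \<epsilon>: "\<epsilon> > 0" using neq by (simp add: \<epsilon>_def)
  have "continuous_on UNIV (\<lambda>y. ft F (- y))"
    by (intro continuous_on_compose2[OF continuous_on_ft[OF Fi, of UNIV]] continuous_intros) auto
  then have "continuous_on UNIV ?D" by (intro continuous_intros cont)
  then have "isCont ?D x" by (simp add: continuous_on_eq_continuous_at)
  then obtain \<delta> where \<delta>: "\<delta> > 0" and near: "\<And>y. dist y x < \<delta> \<Longrightarrow> dist (?D y) (?D x) < \<epsilon>"
    using \<epsilon> unfolding continuous_at_eps_delta by blast
  obtain \<phi> :: "real^'d \<Rightarrow> real" where \<phi>c: "continuous_on UNIV \<phi>" and \<phi>0: "\<And>x. 0 \<le> \<phi> x" and \<phi>1: "\<And>x. \<phi> x \<le> 1"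
    and supp: "\<And>y. \<delta> \<le> dist y x \<Longrightarrow> \<phi> y = 0"
    and \<phi>i: "integrable lborel \<phi>" and \<phi>pos: "(LINT x|lborel. \<phi> x) > 0" and \<phi>F: "integrable lborel (ft (\<lambda>x. complex_of_real (\<phi> x)))"
    using bump_test_function[OF \<delta>] by metis
  let ?\<phi> = "\<lambda>x. complex_of_real (\<phi> x)"
  have \<phi>ci: "integrable lborel ?\<phi>" using \<phi>i by (rule integrable_of_real)
  have [measurable]: "\<phi> \<in> borel_measurable borel" using \<phi>c by (rule borel_measurable_continuous_onI)
  have \<phi>2: "integrable lborel (\<lambda>x. (cmod (?\<phi> x))\<^sup>2)"
  proof (rule Bochner_Integration.integrable_bound[OF \<phi>i])
    show "AE x in lborel. norm ((cmod (?\<phi> x))\<^sup>2) \<le> norm (\<phi> x)"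
    proof (intro AE_I2)
      fix x
      have "\<phi> x * \<phi> x \<le> \<phi> x * 1" using \<phi>0 \<phi>1 by (intro mult_left_mono)
      then show "norm ((cmod (?\<phi> x))\<^sup>2) \<le> norm (\<phi> x)" using \<phi>0[of x] by (simp add: power2_eq_square)
    qed
  qed measurable
  have \<phi>F2: "nsq (ft ?\<phi>) < \<infinity>"
  proof (rule le_less_trans[OF nsq_ft_le[OF \<phi>ci]])
    show "nsq ?\<phi> < \<infinity>" using \<phi>2 by (subst (asm) integrable_nsq_finite) auto
  qed
  then have \<phi>F2i: "integrable lborel (\<lambda>x. (cmod (ft ?\<phi> x))\<^sup>2)"
    by (simp add: integrable_nsq_finite)
  have inv: "ft (ft ?\<phi>) (- y) = ?\<phi> y" for y
    by (rule ft_inversion[OF \<phi>ci _ _ \<phi>F, where B=1])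
       (use \<phi>0 \<phi>1 \<phi>c in \<open>auto simp: continuous_on_eq_continuous_at intro!: continuous_intros\<close>)
  have ci: "integrable lborel (cutoff R f)" for R by (intro integrable_cutoff f2) auto
  have cF2: "integrable lborel (\<lambda>w. (cmod (ft (cutoff R f) w))\<^sup>2)" for R
  proof -
    have "integrable lborel (\<lambda>x. (cmod (cutoff R f x))\<^sup>2)"
      by (rule Bochner_Integration.integrable_bound[OF f2]) (auto simp: cutoff_def indicator_def)
    then have "nsq (cutoff R f) < \<infinity>" by (subst (asm) integrable_nsq_finite) auto
    with nsq_ft_le[OF ci[of R]] have "nsq (ft (cutoff R f)) < \<infinity>" by (rule le_less_trans)
    then show ?thesis by (subst integrable_nsq_finite) auto
  qed
  let ?I = "\<lambda>R. LINT w|lborel. cnj (ft (cutoff R f) w) * ft ?\<phi> w"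
  have "(?I \<longlongrightarrow> (LINT w|lborel. cnj (F w) * ft ?\<phi> w)) at_top"
  proof (rule tendsto_integral_mult_L2)
    show "((\<lambda>R. nsq (\<lambda>w. cnj (ft (cutoff R f) w) - cnj (F w))) \<longlongrightarrow> 0) at_top"
      using lim unfolding nsq_def complex_cnj_diff[symmetric] complex_mod_cnj .
    show "integrable lborel (\<lambda>w. cnj (ft (cutoff R f) w) * ft ?\<phi> w)" for R
      by (intro integrable_mult_L2) (use cF2 \<phi>F2i in auto)
    show "integrable lborel (\<lambda>w. cnj (F w) * ft ?\<phi> w)"
      by (intro integrable_mult_L2) (use F2 \<phi>F2i in auto)
  qed (use \<phi>F2 in measurable)
  \<comment> \<open>The truncated pairing is eventually constant in \<open>R\<close>: a large ball
    contains the support of \<open>\<phi>\<close>.\<close>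
  moreover have "eventually (\<lambda>R. ?I R = (LINT y|lborel. complex_of_real (f y) * ?\<phi> y)) at_top"
    using eventually_ge_at_top[of "norm x + \<delta>"]
  proof eventually_elim
    fix R assume R: "norm x + \<delta> \<le> R"
    have "?I R = (LINT y|lborel. cnj (cutoff R f y) * ?\<phi> y)"
      unfolding integral_cnj_ft_mult[OF ci \<phi>F] inv ..
    also have "\<dots> = (LINT y|lborel. complex_of_real (f y) * ?\<phi> y)"
    proof (intro Bochner_Integration.integral_cong refl)
      fix y
      show "cnj (cutoff R f y) * ?\<phi> y = complex_of_real (f y) * ?\<phi> y"
      proof (cases "dist y x < \<delta>")
        case True
        then have "norm y \<le> R" using R norm_triangle_sub[of y x] by (simp add: dist_norm)
        then show ?thesis by (simp add: cutoff_def)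
      qed (simp add: supp)
    qed
    finally show "?I R = (LINT y|lborel. complex_of_real (f y) * ?\<phi> y)" .
  qed
  ultimately have "((\<lambda>_. LINT y|lborel. complex_of_real (f y) * ?\<phi> y) \<longlongrightarrow> (LINT w|lborel. cnj (F w) * ft ?\<phi> w)) (at_top :: real filter)"
    by (rule Lim_transform_eventually)
  then have eq1: "(LINT y|lborel. complex_of_real (f y) * ?\<phi> y) = (LINT w|lborel. cnj (F w) * ft ?\<phi> w)"
    by (simp add: tendsto_const_iff)
  have "(LINT y|lborel. complex_of_real (f y) * ?\<phi> y) = cnj (LINT y|lborel. complex_of_real (f y) * ?\<phi> y)"
    unfolding Bochner_Integration.integral_cnj[symmetric] by simp
  also have "\<dots> = (LINT w|lborel. cnj (ft ?\<phi> w) * F w)"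
    unfolding eq1 Bochner_Integration.integral_cnj[symmetric] by (simp add: mult.commute)
  also have "\<dots> = (LINT y|lborel. cnj (?\<phi> y) * ft F (- y))"
    by (rule integral_cnj_ft_mult[OF \<phi>ci Fi])
  finally have eq: "(LINT y|lborel. complex_of_real (f y) * ?\<phi> y) = (LINT y|lborel. ft F (- y) * ?\<phi> y)"
    by (simp add: mult.commute)
  have i1: "integrable lborel (\<lambda>y. complex_of_real (f y) * ?\<phi> y)"
    by (intro integrable_mult_L2) (use f2 \<phi>2 in auto)
  have i2: "integrable lborel (\<lambda>y. ft F (- y) * ?\<phi> y)"
    by (rule integrable_bounded_mult[OF \<phi>ci _ norm_ft_le]) measurable
  have i3: "integrable lborel (\<lambda>y. ?D x * ?\<phi> y)"
    by (intro integrable_mult_right \<phi>ci)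
  have Di: "integrable lborel (\<lambda>y. (?D y - ?D x) * ?\<phi> y)"
    using Bochner_Integration.integrable_diff[OF Bochner_Integration.integrable_diff[OF i1 i2] i3] by (simp add: left_diff_distrib)
  \<comment> \<open>Writing \<open>?D y\<close> as \<open>?D x\<close> plus a deviation isolates the
    value at \<open>x\<close>. On the support of \<open>\<phi>\<close> the deviation is at most
    \<open>\<epsilon>\<close>, half of \<open>cmod (?D x)\<close>, which is incompatible with the
    vanishing of the pairing of \<open>?D\<close> with \<open>\<phi>\<close>.\<close>
  have "(LINT y|lborel. (?D y - ?D x) * ?\<phi> y) = (LINT y|lborel. complex_of_real (f y) * ?\<phi> y) - (LINT y|lborel. ft F (- y) * ?\<phi> y) - (LINT y|lborel. ?D x * ?\<phi> y)"
  proof -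
    have "(?D y - ?D x) * ?\<phi> y = complex_of_real (f y) * ?\<phi> y - ft F (- y) * ?\<phi> y - ?D x * ?\<phi> y" for y
      by (simp add: left_diff_distrib)
    then show ?thesis
      by (simp only: Bochner_Integration.integral_diff Bochner_Integration.integrable_diff i1 i2 i3)
  qed
  also have "\<dots> = - (?D x * complex_of_real (LINT y|lborel. \<phi> y))"
    unfolding eq integral_mult_right_zero integral_complex_of_real by simp
  finally have "cmod (?D x) * (LINT y|lborel. \<phi> y) = cmod (LINT y|lborel. (?D y - ?D x) * ?\<phi> y)"
    using \<phi>pos by (simp add: norm_mult)
  also have "\<dots> \<le> (LINT y|lborel. \<epsilon> * \<phi> y)"
  proof (rule Bochner_Integration.integral_norm_bound_integral[OF Di])
    show "integrable lborel (\<lambda>y. \<epsilon> * \<phi> y)" by (intro integrable_mult_right \<phi>i)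
    fix y
    show "cmod ((?D y - ?D x) * ?\<phi> y) \<le> \<epsilon> * \<phi> y"
    proof (cases "dist y x < \<delta>")
      case True
      then have "cmod (?D y - ?D x) \<le> \<epsilon>" using near[OF True] unfolding dist_norm by simp
      then show ?thesis using \<phi>0[of y] by (simp add: norm_mult mult_right_mono)
    qed (simp add: supp)
  qed
  also have "\<dots> = \<epsilon> * (LINT y|lborel. \<phi> y)" by simp
  finally have "cmod (?D x) \<le> \<epsilon>" using \<phi>pos by (simp only: mult_le_cancel_right_pos)
  then show False using \<epsilon> unfolding \<epsilon>_def by linarith
qed

section \<open>Reproducing kernel Hilbert spaces\<close>

locale hilbert_functions =
  fixes H :: "('a \<Rightarrow> real) set" and ip :: "('a \<Rightarrow> real) \<Rightarrow> ('a \<Rightarrow> real) \<Rightarrow> real"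
  assumes hilbert: "hilbert_function_space H ip"
begin

lemma add_mem: "f \<in> H \<Longrightarrow> g \<in> H \<Longrightarrow> (\<lambda>x. f x + g x) \<in> H"
  and scale_mem: "f \<in> H \<Longrightarrow> (\<lambda>x. a * f x) \<in> H"
  and zero_mem: "(\<lambda>x. 0) \<in> H"
  and ip_commute: "f \<in> H \<Longrightarrow> g \<in> H \<Longrightarrow> ip f g = ip g f"
  and ip_add_left: "f \<in> H \<Longrightarrow> g \<in> H \<Longrightarrow> h \<in> H \<Longrightarrow> ip (\<lambda>x. f x + g x) h = ip f h + ip g h"
  and ip_scale_left: "f \<in> H \<Longrightarrow> g \<in> H \<Longrightarrow> ip (\<lambda>x. a * f x) g = a * ip f g"
  and ip_nonneg: "f \<in> H \<Longrightarrow> 0 \<le> ip f f"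
  and ip_definite: "f \<in> H \<Longrightarrow> ip f f = 0 \<Longrightarrow> f = (\<lambda>x. 0)"
  and complete: "(\<And>n. s n \<in> H) \<Longrightarrow> (\<And>e. e > 0 \<Longrightarrow> \<exists>N::nat. \<forall>i\<ge>N. \<forall>j\<ge>N. ip_norm ip (\<lambda>x. s i x - s j x) < e) \<Longrightarrow>
     \<exists>f\<in>H. (\<lambda>n. ip_norm ip (\<lambda>x. s n x - f x)) \<longlonglongrightarrow> 0"
  using hilbert unfolding hilbert_function_space_def by blast+

lemma diff_mem: "f \<in> H \<Longrightarrow> g \<in> H \<Longrightarrow> (\<lambda>x. f x - g x) \<in> H"
  using add_mem[of f "\<lambda>x. (-1) * g x"] scale_mem[of g "-1"] by simp

lemma ip_add_right: "f \<in> H \<Longrightarrow> g \<in> H \<Longrightarrow> h \<in> H \<Longrightarrow> ip h (\<lambda>x. f x + g x) = ip h f + ip h g"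
  by (simp only: ip_commute[of h] add_mem ip_add_left)

lemma ip_scale_right: "f \<in> H \<Longrightarrow> g \<in> H \<Longrightarrow> ip g (\<lambda>x. a * f x) = a * ip g f"
  by (simp only: ip_commute[of g] scale_mem ip_scale_left)

lemma ip_diff_left: "f \<in> H \<Longrightarrow> g \<in> H \<Longrightarrow> h \<in> H \<Longrightarrow> ip (\<lambda>x. f x - g x) h = ip f h - ip g h"
  using ip_add_left[of f "\<lambda>x. (-1) * g x" h] scale_mem[of g "-1"] ip_scale_left[of g h "-1"] by simp

lemma ip_add_scaled:
  assumes "f \<in> H" "g \<in> H"
  shows "ip (\<lambda>x. f x + t * g x) (\<lambda>x. f x + t * g x) = ip f f + 2 * t * ip f g + t\<^sup>2 * ip g g"
proof -
  let ?h = "\<lambda>x. t * g x"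
  have h: "?h \<in> H" by (rule scale_mem[OF assms(2)])
  have "ip (\<lambda>x. f x + ?h x) (\<lambda>x. f x + ?h x) = (ip f f + ip f ?h) + (ip ?h f + ip ?h ?h)"
    unfolding ip_add_left[OF assms(1) h add_mem[OF assms(1) h]] ip_add_right[OF assms(1) h assms(1)]
      ip_add_right[OF assms(1) h h] ..
  also have "ip f ?h = t * ip f g" by (rule ip_scale_right[OF assms(2,1)])
  also have "ip ?h f = t * ip f g" using ip_scale_left[OF assms(2,1)] ip_commute[OF assms] by simp
  also have "ip ?h ?h = t * (t * ip g g)"
    unfolding ip_scale_left[OF assms(2) h] ip_scale_right[OF assms(2,2)] ..
  finally show ?thesis by (simp add: power2_eq_square)
qed

lemma ip_diff_self:
  assumes "f \<in> H" "g \<in> H"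
  shows "ip (\<lambda>x. f x - g x) (\<lambda>x. f x - g x) = ip f f - 2 * ip f g + ip g g"
  using ip_add_scaled[OF assms, of "-1"] by simp

lemma parallelogram:
  assumes "f \<in> H" "g \<in> H"
  shows "ip (\<lambda>x. f x - g x) (\<lambda>x. f x - g x) =
     2 * ip f f + 2 * ip g g - 4 * ip (\<lambda>x. (f x + g x) / 2) (\<lambda>x. (f x + g x) / 2)"
proof -
  have "(\<lambda>x. (f x + g x) / 2) = (\<lambda>x. (1/2) * (f x + 1 * g x))" by (simp add: fun_eq_iff)
  then have "ip (\<lambda>x. (f x + g x) / 2) (\<lambda>x. (f x + g x) / 2) = (1/4) * ip (\<lambda>x. f x + 1 * g x) (\<lambda>x. f x + 1 * g x)"
  proof (simp only: mult_1)
    have s: "(\<lambda>x. f x + g x) \<in> H" by (rule add_mem[OF assms])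
    show "ip (\<lambda>x. 1 / 2 * (f x + g x)) (\<lambda>x. 1 / 2 * (f x + g x)) = 1 / 4 * ip (\<lambda>x. f x + g x) (\<lambda>x. f x + g x)"
      unfolding ip_scale_left[OF s scale_mem[OF s]] ip_scale_right[OF s s] by simp
  qed
  then show ?thesis
    using ip_add_scaled[OF assms, of 1] ip_diff_self[OF assms] by simp
qed

lemma half_sum_mem: "f \<in> H \<Longrightarrow> g \<in> H \<Longrightarrow> (\<lambda>x. (f x + g x) / 2) \<in> H"
  using scale_mem[OF add_mem, of f g "1/2"] by simp

lemma Cauchy_Schwarz:
  assumes "f \<in> H" "g \<in> H"
  shows "(ip f g)\<^sup>2 \<le> ip f f * ip g g"
proof (cases "ip g g = 0")
  case True
  then have "g = (\<lambda>x. 0)" using ip_definite assms by blast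
  then have "g = (\<lambda>x. 0 * f x)" by simp
  then have "ip f g = 0" using ip_scale_right[of f f 0] assms by simp
  then show ?thesis using True by simp
next
  case False
  then have pos: "ip g g > 0" using ip_nonneg[OF assms(2)] by simp
  let ?t = "- ip f g / ip g g"
  have "0 \<le> ip f f + 2 * ?t * ip f g + ?t\<^sup>2 * ip g g"
    using ip_add_scaled[OF assms, of ?t] ip_nonneg[OF add_mem[OF assms(1) scale_mem[OF assms(2)]], of ?t] by simp
  also have "\<dots> = ip f f - (ip f g)\<^sup>2 / ip g g"
    using pos by (simp add: power2_eq_square field_simps)
  finally show ?thesis using pos by (simp add: pos_divide_le_eq)
qed

lemma ip_tendsto:
  assumes s: "\<And>n. s n \<in> H" and f: "f \<in> H" and g: "g \<in> H"
    and lim: "(\<lambda>n. ip_norm ip (\<lambda>x. s n x - f x)) \<longlonglongrightarrow> 0"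
  shows "(\<lambda>n. ip (s n) g) \<longlonglongrightarrow> ip f g"
proof -
  let ?d = "\<lambda>n x. s n x - f x"
  have "(\<lambda>n. sqrt (ip (?d n) (?d n)) * sqrt (ip g g)) \<longlonglongrightarrow> 0 * sqrt (ip g g)"
    using lim unfolding ip_norm_def by (intro tendsto_mult tendsto_const)
  then have up: "(\<lambda>n. sqrt (ip (?d n) (?d n)) * sqrt (ip g g)) \<longlonglongrightarrow> 0"
    by simp
  have "(\<lambda>n. ip (s n) g - ip f g) \<longlonglongrightarrow> 0"
  proof (rule Lim_null_comparison[OF _ up])
    show "\<forall>\<^sub>F n in sequentially. norm (ip (s n) g - ip f g) \<le> sqrt (ip (?d n) (?d n)) * sqrt (ip g g)"
    proof (intro always_eventually allI)
      fix n
      have "(ip (?d n) g)\<^sup>2 \<le> ip (?d n) (?d n) * ip g g"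
        by (intro Cauchy_Schwarz diff_mem s f g)
      from real_sqrt_le_mono[OF this]
      have "\<bar>ip (?d n) g\<bar> \<le> sqrt (ip (?d n) (?d n)) * sqrt (ip g g)"
        by (simp add: real_sqrt_mult)
      then show "norm (ip (s n) g - ip f g) \<le> sqrt (ip (?d n) (?d n)) * sqrt (ip g g)"
        by (simp add: ip_diff_left s f g)
    qed
  qed
  then show ?thesis by (simp add: LIM_zero_iff)
qed

lemma ip_self_tendsto:
  assumes s: "\<And>n. s n \<in> H" and f: "f \<in> H"
    and lim: "(\<lambda>n. ip_norm ip (\<lambda>x. s n x - f x)) \<longlonglongrightarrow> 0"
  shows "(\<lambda>n. ip (s n) (s n)) \<longlonglongrightarrow> ip f f"
proof -
  let ?d = "\<lambda>n x. s n x - f x"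
  have eq: "ip (s n) (s n) = (ip_norm ip (?d n))\<^sup>2 + 2 * ip (s n) f - ip f f" for n
    using ip_diff_self[OF s f, of n] ip_nonneg[OF diff_mem[OF s f], of n] by (simp add: ip_norm_def)
  have "(\<lambda>n. (ip_norm ip (?d n))\<^sup>2 + 2 * ip (s n) f - ip f f) \<longlonglongrightarrow> 0\<^sup>2 + 2 * ip f f - ip f f"
    by (rule tendsto_diff[OF tendsto_add[OF tendsto_power[OF lim] tendsto_mult[OF tendsto_const ip_tendsto[OF s f f lim]]] tendsto_const])
  then show ?thesis unfolding eq by simp
qed

text \<open>The quadratic functional \<open>J (g, l) = ip g g - 2 * l\<close> on pairs, where \<open>l\<close> stands for the value of
  a linear functional at \<open>g\<close>, covers both the minimal norm problem (\<open>l = 0\<close>) and the Riesz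
  representation of a functional given on a dense subspace only.\<close>

lemma minimizing_sequence:
  assumes S: "S \<noteq> {}" "\<And>p. p \<in> S \<Longrightarrow> fst p \<in> H"
    and mid: "\<And>p q. p \<in> S \<Longrightarrow> q \<in> S \<Longrightarrow> ((\<lambda>x. (fst p x + fst q x) / 2), (snd p + snd q) / 2) \<in> S"
    and bdd: "bdd_below ((\<lambda>p. ip (fst p) (fst p) - 2 * snd p) ` S)"
  shows "\<exists>s f. (\<forall>n::nat. s n \<in> S) \<and> f \<in> H \<and>
    (\<lambda>n. ip (fst (s n)) (fst (s n)) - 2 * snd (s n)) \<longlonglongrightarrow> (INF p\<in>S. ip (fst p) (fst p) - 2 * snd p) \<and>
    (\<lambda>n. ip_norm ip (\<lambda>x. fst (s n) x - f x)) \<longlonglongrightarrow> 0"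
proof -
  let ?J = "\<lambda>p. ip (fst p) (fst p) - 2 * snd p"
  define m where "m = (INF p\<in>S. ?J p)"
  have m: "m \<le> ?J p" if "p \<in> S" for p
    unfolding m_def using bdd that by (rule cINF_lower)
  have "\<exists>p\<in>S. ?J p < m + 1 / real (Suc n)" for n
  proof -
    have "m < m + 1 / real (Suc n)" by simp
    then show ?thesis unfolding m_def by (subst (asm) cINF_less_iff) (use S(1) bdd in auto)
  qed
  then obtain s where s: "\<And>n. s n \<in> S" and sm: "\<And>n. ?J (s n) < m + 1 / real (Suc n)" by metis
  have sH: "fst (s n) \<in> H" for n by (intro S s)
  have cauchy: "ip (\<lambda>x. fst (s i) x - fst (s j) x) (\<lambda>x. fst (s i) x - fst (s j) x) \<le> 2 / real (Suc i) + 2 / real (Suc j)" for i j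
  proof -
    \<comment> \<open>The linear terms cancel in the parallelogram law, so the squared distance is
      at most twice the sum of the two excesses of \<open>?J\<close> over its infimum.\<close>
    have "m \<le> ip (\<lambda>x. (fst (s i) x + fst (s j) x) / 2) (\<lambda>x. (fst (s i) x + fst (s j) x) / 2) - (snd (s i) + snd (s j))"
      using m[OF mid[OF s s], of i j] by (simp add: add_divide_distrib)
    moreover have "2 / real (Suc k) = 2 * (1 / real (Suc k))" for k by simp
    ultimately show ?thesis
      using sm[of i] sm[of j] unfolding parallelogram[OF sH sH] by linarith
  qed
  have "\<exists>f\<in>H. (\<lambda>n. ip_norm ip (\<lambda>x. fst (s n) x - f x)) \<longlonglongrightarrow> 0"
  proof (rule complete[OF sH])
    fix e :: real assume e: "e > 0"
    then obtain N where N: "1 / real (Suc N) < e\<^sup>2 / 4" using nat_approx_posE[of "e\<^sup>2 / 4"] by auto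
    have "ip_norm ip (\<lambda>x. fst (s i) x - fst (s j) x) < e" if "i \<ge> N" "j \<ge> N" for i j
    proof -
      have "1 / real (Suc i) \<le> 1 / real (Suc N)" "1 / real (Suc j) \<le> 1 / real (Suc N)"
        using that by (auto intro!: divide_left_mono)
      then have "ip (\<lambda>x. fst (s i) x - fst (s j) x) (\<lambda>x. fst (s i) x - fst (s j) x) < e\<^sup>2"
        using cauchy[of i j] N by linarith
      then have "ip_norm ip (\<lambda>x. fst (s i) x - fst (s j) x) < sqrt (e\<^sup>2)"
        unfolding ip_norm_def by (rule real_sqrt_less_mono)
      then show ?thesis using e by simp
    qed
    then show "\<exists>N. \<forall>i\<ge>N. \<forall>j\<ge>N. ip_norm ip (\<lambda>x. fst (s i) x - fst (s j) x) < e" by blast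
  qed
  moreover have "(\<lambda>n. ?J (s n)) \<longlonglongrightarrow> m"
  proof (rule tendsto_sandwich[where f="\<lambda>_. m" and h="\<lambda>n. m + 1 / real (Suc n)"])
    have "(\<lambda>n. m + 1 / real (Suc n)) \<longlonglongrightarrow> m + 0"
      by (intro tendsto_add tendsto_const LIMSEQ_Suc[OF lim_1_over_n])
    then show "(\<lambda>n. m + 1 / real (Suc n)) \<longlonglongrightarrow> m" by simp
    show "\<forall>\<^sub>F n in sequentially. m \<le> ?J (s n)" using m s by simp
    show "\<forall>\<^sub>F n in sequentially. ?J (s n) \<le> m + 1 / real (Suc n)" by (intro always_eventually allI less_imp_le sm)
  qed auto
  ultimately show ?thesis using s unfolding m_def by blast
qed

end

section \<open>Reproducing kernels, membership by duality and minimal norms\<close>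

locale native =
  fixes K :: "'a \<Rightarrow> 'a \<Rightarrow> real" and H ip
  assumes native: "native_space K H ip"

sublocale native \<subseteq> hilbert_functions
  using native by unfold_locales (simp add: native_space_def)

context native
begin

lemma kernel_mem: "(\<lambda>y. K y x) \<in> H"
  and reproducing: "f \<in> H \<Longrightarrow> f x = ip f (\<lambda>y. K y x)"
  using native by (auto simp: native_space_def)

lemma eval_tendsto:
  assumes s: "\<And>n. s n \<in> H" and f: "f \<in> H" and lim: "(\<lambda>n. ip_norm ip (\<lambda>x. s n x - f x)) \<longlonglongrightarrow> 0"
  shows "(\<lambda>n. s n x) \<longlonglongrightarrow> f x"
  using ip_tendsto[OF s f kernel_mem lim, of x] unfolding reproducing[OF s, symmetric] reproducing[OF f, symmetric] .

lemma sum_kernel_mem: "finite I \<Longrightarrow> (\<lambda>y. \<Sum>i\<in>I. c i * K y (p i)) \<in> H"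
  by (induction I rule: finite_induct) (auto intro!: zero_mem add_mem scale_mem kernel_mem)

lemma ip_sum_kernel:
  assumes "finite I" "f \<in> H"
  shows "ip f (\<lambda>y. \<Sum>i\<in>I. c i * K y (p i)) = (\<Sum>i\<in>I. c i * f (p i))"
  using assms(1)
proof (induction I rule: finite_induct)
  case empty
  have "ip f (\<lambda>x. 0 * f x) = 0" using assms(2) by (subst ip_scale_right) auto
  then show ?case by simp
next
  case (insert i I)
  then show ?case
    using assms(2) by (simp add: ip_add_right ip_scale_right scale_mem kernel_mem sum_kernel_mem
        reproducing[symmetric])
qed

lemma ip_sum_kernel_self:
  assumes "finite I"
  shows "ip (\<lambda>y. \<Sum>i\<in>I. c i * K y (p i)) (\<lambda>y. \<Sum>i\<in>I. c i * K y (p i)) = (\<Sum>i\<in>I. \<Sum>j\<in>I. c i * c j * K (p i) (p j))"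
  using ip_sum_kernel[OF assms sum_kernel_mem[OF assms, of c p], of c p]
  by (simp add: sum_distrib_left mult.assoc)

text \<open>Cauchy-Schwarz against the combination of kernel sections that represents the functional
  on the left. The points form an indexed family, so that an arithmetic progression can be inserted
  directly.\<close>

lemma sum_bound:
  assumes "finite I" "f \<in> H"
  shows "(\<Sum>i\<in>I. c i * f (p i))\<^sup>2 \<le> ip f f * (\<Sum>i\<in>I. \<Sum>j\<in>I. c i * c j * K (p i) (p j))"
  using Cauchy_Schwarz[OF assms(2) sum_kernel_mem[OF assms(1), of c p]]
  by (simp add: ip_sum_kernel[OF assms] ip_sum_kernel_self[OF assms(1)])

text \<open>The converse of \<open>sum_bound\<close>. The values of \<open>f\<close> define a
  bounded functional on the span of the kernel sections, and by the reproducing property its Riesz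
  representer \<open>g\<close> has the same values as \<open>f\<close>. The representer is obtained
  as the limit of a minimising sequence for \<open>ip g g - 2 * l\<close>, which is bounded below by
  \<open>- M\<^sup>2\<close>.\<close>

lemma mem_if_sum_bound:
  assumes M: "M \<ge> 0"
    and bound: "\<And>X c. finite X \<Longrightarrow> (\<Sum>x\<in>X. c x * f x)\<^sup>2 \<le> M\<^sup>2 * (\<Sum>x\<in>X. \<Sum>y\<in>X. c x * c y * K x y)"
  shows "f \<in> H" "ip f f \<le> M\<^sup>2"
proof -
  define G where "G X c = (\<lambda>y. \<Sum>x\<in>X. c x * K y x)" for X and c :: "'a \<Rightarrow> real"
  define L where "L X c = (\<Sum>x\<in>X. c x * f x)" for X and c :: "'a \<Rightarrow> real"
  have GH: "finite X \<Longrightarrow> G X c \<in> H" for X c unfolding G_def using sum_kernel_mem[of X c "\<lambda>x. x"] by simp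
  have LG: "finite X \<Longrightarrow> (L X c)\<^sup>2 \<le> M\<^sup>2 * ip (G X c) (G X c)" for X c
    using bound[of X c] ip_sum_kernel_self[of X c "\<lambda>x. x"] by (simp add: G_def L_def)
  \<comment> \<open>Pairs of a combination and the value of the functional: one function may arise
    from several coefficient families, and the pair keeps the value without deciding whether the
    function alone determines it.\<close>
  define S where "S = {(G X c, L X c) | X c. finite X}"
  have comb: "((\<lambda>x. a * fst p x + b * fst q x), a * snd p + b * snd q) \<in> S" if pq: "p \<in> S" "q \<in> S" for p q a b
  proof -
    obtain X c Y d where X: "finite X" "p = (G X c, L X c)" and Y: "finite Y" "q = (G Y d, L Y d)"
      using pq by (auto simp: S_def)
    let ?c = "\<lambda>x. a * (if x \<in> X then c x else 0) + b * (if x \<in> Y then d x else 0)"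
    have *: "(\<Sum>x\<in>X \<union> Y. ?c x * k x) = a * (\<Sum>x\<in>X. c x * k x) + b * (\<Sum>x\<in>Y. d x * k x)" for k :: "'a \<Rightarrow> real"
    proof -
      have "(\<Sum>x\<in>X. c x * k x) = (\<Sum>x\<in>X \<union> Y. (if x \<in> X then c x else 0) * k x)"
        using X(1) Y(1) by (intro sum.mono_neutral_cong_left) auto
      moreover have "(\<Sum>x\<in>Y. d x * k x) = (\<Sum>x\<in>X \<union> Y. (if x \<in> Y then d x else 0) * k x)"
        using X(1) Y(1) by (intro sum.mono_neutral_cong_left) auto
      ultimately show ?thesis
        by (simp only: sum_distrib_left sum.distrib[symmetric]) (simp add: algebra_simps)
    qed
    have "((\<lambda>x. a * fst p x + b * fst q x), a * snd p + b * snd q) = (G (X \<union> Y) ?c, L (X \<union> Y) ?c)"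
      unfolding G_def L_def * X(2) Y(2) by simp
    then show ?thesis unfolding S_def using X(1) Y(1) by blast
  qed
  have SH: "p \<in> S \<Longrightarrow> fst p \<in> H" for p by (auto simp: S_def GH)
  have SL: "\<bar>snd p\<bar> \<le> M * sqrt (ip (fst p) (fst p))" if "p \<in> S" for p
  proof -
    have "(snd p)\<^sup>2 \<le> M\<^sup>2 * ip (fst p) (fst p)" using that LG by (auto simp: S_def)
    then have "sqrt ((snd p)\<^sup>2) \<le> sqrt (M\<^sup>2 * ip (fst p) (fst p))" by (rule real_sqrt_le_mono)
    then show ?thesis using M by (simp add: real_sqrt_mult)
  qed
  let ?J = "\<lambda>p. ip (fst p) (fst p) - 2 * snd p"
  have Jlow: "- M\<^sup>2 \<le> ?J p" if "p \<in> S" for p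
  proof -
    define t where "t = sqrt (ip (fst p) (fst p))"
    have "ip (fst p) (fst p) = t\<^sup>2" using ip_nonneg[OF SH[OF that]] by (simp add: t_def)
    moreover have "0 \<le> (t - M)\<^sup>2" by simp
    then have "2 * (M * t) \<le> t\<^sup>2 + M\<^sup>2" by (simp add: power2_diff mult.commute)
    ultimately show ?thesis using SL[OF that] unfolding t_def[symmetric] by linarith
  qed
  have bdd: "bdd_below (?J ` S)" using Jlow by (auto intro!: bdd_belowI2)
  have "\<exists>s g. (\<forall>n::nat. s n \<in> S) \<and> g \<in> H \<and> (\<lambda>n. ?J (s n)) \<longlonglongrightarrow> (INF p\<in>S. ?J p) \<and>
      (\<lambda>n. ip_norm ip (\<lambda>x. fst (s n) x - g x)) \<longlonglongrightarrow> 0"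
  proof (rule minimizing_sequence)
    show "S \<noteq> {}" unfolding S_def by blast
    show "((\<lambda>x. (fst p x + fst q x) / 2), (snd p + snd q) / 2) \<in> S" if "p \<in> S" "q \<in> S" for p q
      using comb[OF that, of "1/2" "1/2"] by (simp add: add_divide_distrib)
    show "bdd_below (?J ` S)" by (rule bdd)
  qed (rule SH)
  then obtain s g where s: "\<And>n. s n \<in> S" and g: "g \<in> H"
    and J: "(\<lambda>n. ?J (s n)) \<longlonglongrightarrow> (INF p\<in>S. ?J p)"
    and lim: "(\<lambda>n. ip_norm ip (\<lambda>x. fst (s n) x - g x)) \<longlonglongrightarrow> 0"
    by blast
  define m where "m = (INF p\<in>S. ?J p)"
  have m: "m \<le> ?J p" if "p \<in> S" for p
    unfolding m_def using bdd that by (rule cINF_lower)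
  have sH: "fst (s n) \<in> H" for n by (intro SH s)
  have "f x = g x" for x
  proof -
    have k: "((\<lambda>y. K y x), f x) \<in> S"
    proof -
      have "((\<lambda>y. K y x), f x) = (G {x} (\<lambda>_. 1), L {x} (\<lambda>_. 1))" by (simp add: G_def L_def)
      then show ?thesis unfolding S_def by blast
    qed
    \<comment> \<open>The first-order condition: adding \<open>t\<close> times the kernel section at
      \<open>x\<close> cannot push the functional below \<open>m\<close>. In the limit the excess
      \<open>?J (s n) - m\<close> disappears, which forces the linear coefficient
      \<open>g x - f x\<close> to vanish.\<close>
    have ineq: "0 \<le> (?J (s n) - m) + 2 * t * (fst (s n) x - f x) + t\<^sup>2 * K x x" for n t
    proof -
      have "m \<le> ?J ((\<lambda>y. 1 * fst (s n) y + t * K y x), 1 * snd (s n) + t * f x)"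
        using m[OF comb[OF s k, of 1 n t]] by simp
      then show ?thesis
        using ip_add_scaled[OF sH kernel_mem, of n t x] reproducing[OF sH, of n x] reproducing[OF kernel_mem, of x x]
        by (simp add: algebra_simps)
    qed
    have "0 \<le> 0 + 2 * t * (g x - f x) + t\<^sup>2 * K x x" for t
    proof (rule tendsto_lowerbound)
      have "(\<lambda>n. (?J (s n) - m) + 2 * t * (fst (s n) x - f x) + t\<^sup>2 * K x x) \<longlonglongrightarrow> (m - m) + 2 * t * (g x - f x) + t\<^sup>2 * K x x"
        using J unfolding m_def[symmetric] by (intro tendsto_add tendsto_diff tendsto_mult tendsto_const eval_tendsto[OF sH g lim])
      then show "(\<lambda>n. (?J (s n) - m) + 2 * t * (fst (s n) x - f x) + t\<^sup>2 * K x x) \<longlonglongrightarrow> 0 + 2 * t * (g x - f x) + t\<^sup>2 * K x x" by simp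
    qed (use ineq in auto)
    then have q: "0 \<le> 2 * t * (g x - f x) + t\<^sup>2 * K x x" for t by simp
    have K0: "0 \<le> K x x" using ip_nonneg[OF kernel_mem, of x] reproducing[OF kernel_mem, of x x] by simp
    \<comment> \<open>The optimal step divides by \<open>K x x\<close>, which may be 0 here; adding
      1 keeps the denominator positive.\<close>
    let ?u = "g x - f x" and ?k = "K x x + 1"
    have "0 \<le> 2 * (- ?u / ?k) * ?u + (- ?u / ?k)\<^sup>2 * ?k"
    proof -
      have "(- ?u / ?k)\<^sup>2 * K x x \<le> (- ?u / ?k)\<^sup>2 * ?k" by (intro mult_left_mono) auto
      then show ?thesis using q[of "- ?u / ?k"] by linarith
    qed
    also have "\<dots> = - (?u\<^sup>2 / ?k)"
    proof -
      have gen: "2 * (- u / k) * u + (- u / k)\<^sup>2 * k = - (u\<^sup>2 / k)" if "k > 0" for u k :: real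
        using that by (simp add: power2_eq_square field_simps)
      show ?thesis by (rule gen) (use K0 in simp)
    qed
    finally have "?u\<^sup>2 / ?k \<le> 0" by simp
    then have "?u\<^sup>2 \<le> 0" using K0 by (simp add: divide_le_0_iff)
    then show ?thesis by simp
  qed
  then have fg: "f = g" by auto
  show fH: "f \<in> H" using g fg by simp
  \<comment> \<open>On the members of the sequence the inner product with \<open>f\<close> is the
    value of the functional, hence at most \<open>M\<close> times the norm; this passes to the
    limit.\<close>
  have "ip f f \<le> M * sqrt (ip f f)"
  proof (rule tendsto_le[OF sequentially_bot])
    show "(\<lambda>n. ip (fst (s n)) f) \<longlonglongrightarrow> ip f f" using ip_tendsto[OF sH g g lim] fg by simp
    show "(\<lambda>n. M * sqrt (ip (fst (s n)) (fst (s n)))) \<longlonglongrightarrow> M * sqrt (ip f f)"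
      unfolding fg by (intro tendsto_mult tendsto_const tendsto_real_sqrt ip_self_tendsto[OF sH g lim])
    show "\<forall>\<^sub>F n in sequentially. ip (fst (s n)) f \<le> M * sqrt (ip (fst (s n)) (fst (s n)))"
    proof (intro always_eventually allI)
      fix n
      obtain X c where X: "finite X" "s n = (G X c, L X c)" using s[of n] by (auto simp: S_def)
      have "ip (fst (s n)) f = snd (s n)"
        using ip_sum_kernel[OF X(1) fH, of c "\<lambda>x. x"] ip_commute[OF sH fH, of n] X(2) by (simp add: G_def L_def)
      then show "ip (fst (s n)) f \<le> M * sqrt (ip (fst (s n)) (fst (s n)))" using SL[OF s, of n] by simp
    qed
  qed
  then have "sqrt (ip f f) * sqrt (ip f f) \<le> M * sqrt (ip f f)"
    using ip_nonneg[OF fH] by simp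
  then have "sqrt (ip f f) \<le> M"
  proof (cases "sqrt (ip f f) = 0")
    case True
    then show ?thesis using M by linarith
  next
    case False
    assume le: "sqrt (ip f f) * sqrt (ip f f) \<le> M * sqrt (ip f f)"
    have "0 < sqrt (ip f f)" using False ip_nonneg[OF fH] by simp
    with le show ?thesis by (rule mult_right_le_imp_le)
  qed
  then have "(sqrt (ip f f))\<^sup>2 \<le> M\<^sup>2" by (intro power_mono) (auto simp: ip_nonneg fH)
  then show "ip f f \<le> M\<^sup>2" using ip_nonneg[OF fH] by simp
qed

text \<open>The element of least norm in a closed convex set. Closedness refers to pointwise limits,
  which norm convergence provides by \<open>eval_tendsto\<close>; sets given by prescribed values,
  such as bumps, satisfy it at once.\<close>

lemma ip_norm_eq_inf_unique:
  assumes B: "B \<subseteq> H" "B \<noteq> {}" "\<And>f g. f \<in> B \<Longrightarrow> g \<in> B \<Longrightarrow> (\<lambda>x. (f x + g x) / 2) \<in> B"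
    and closed: "\<And>s f. (\<And>n. s n \<in> B) \<Longrightarrow> f \<in> H \<Longrightarrow> (\<And>x. (\<lambda>n. s n x) \<longlonglongrightarrow> f x) \<Longrightarrow> f \<in> B"
  shows "\<exists>!b. b \<in> B \<and> ip_norm ip b = (INF b\<in>B. ip_norm ip b)"
proof -
  let ?S = "(\<lambda>b. (b, 0::real)) ` B"
  define \<mu> where "\<mu> = (INF b\<in>B. ip_norm ip b)"
  have ipn: "ip_norm ip b \<ge> 0" if "b \<in> B" for b using ip_nonneg that B(1) by (auto simp: ip_norm_def)
  have sq: "(ip_norm ip b)\<^sup>2 = ip b b" if "b \<in> B" for b using ip_nonneg that B(1) by (auto simp: ip_norm_def)
  have bddN: "bdd_below (ip_norm ip ` B)" using ipn by (auto intro!: bdd_belowI2)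
  have \<mu>: "\<mu> \<le> ip_norm ip b" if "b \<in> B" for b
    unfolding \<mu>_def using bddN that by (rule cINF_lower)
  have \<mu>0: "\<mu> \<ge> 0" unfolding \<mu>_def using B(2) ipn by (intro cINF_greatest) auto
  have bdd: "bdd_below ((\<lambda>p. ip (fst p) (fst p) - 2 * snd p) ` ?S)"
    using ip_nonneg B(1) by (auto intro!: bdd_belowI2[of _ 0])
  have "\<exists>s f. (\<forall>n::nat. s n \<in> ?S) \<and> f \<in> H \<and>
      (\<lambda>n. ip (fst (s n)) (fst (s n)) - 2 * snd (s n)) \<longlonglongrightarrow> (INF p\<in>?S. ip (fst p) (fst p) - 2 * snd p) \<and>
      (\<lambda>n. ip_norm ip (\<lambda>x. fst (s n) x - f x)) \<longlonglongrightarrow> 0"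
  proof (rule minimizing_sequence)
    show "?S \<noteq> {}" "\<And>p. p \<in> ?S \<Longrightarrow> fst p \<in> H" using B by auto
    show "\<And>p q. p \<in> ?S \<Longrightarrow> q \<in> ?S \<Longrightarrow> ((\<lambda>x. (fst p x + fst q x) / 2), (snd p + snd q) / 2) \<in> ?S"
      using B(3) by (auto simp: image_iff)
  qed (rule bdd)
  then obtain s f where s: "\<And>n. s n \<in> ?S" and f: "f \<in> H"
    and J: "(\<lambda>n. ip (fst (s n)) (fst (s n)) - 2 * snd (s n)) \<longlonglongrightarrow> (INF p\<in>?S. ip (fst p) (fst p) - 2 * snd p)"
    and lim: "(\<lambda>n. ip_norm ip (\<lambda>x. fst (s n) x - f x)) \<longlonglongrightarrow> 0"
    by blast
  have sB: "fst (s n) \<in> B" and s0: "snd (s n) = 0" for n using s[of n] by auto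
  have sH: "fst (s n) \<in> H" for n using sB B(1) by auto
  have fB: "f \<in> B" using closed[OF sB f eval_tendsto[OF sH f lim]] .
  have min: "ip f f \<le> ip b b" if "b \<in> B" for b
  proof -
    have "(\<lambda>n. ip (fst (s n)) (fst (s n)) - 2 * snd (s n)) \<longlonglongrightarrow> ip f f"
      unfolding s0 using ip_self_tendsto[OF sH f lim] by simp
    from LIMSEQ_unique[OF this J] have "ip f f = (INF p\<in>?S. ip (fst p) (fst p) - 2 * snd p)" .
    also have "\<dots> \<le> ip b b"
      using cINF_lower[OF bdd, of "(b, 0)"] that by auto
    finally show ?thesis .
  qed
  have f\<mu>: "ip_norm ip f = \<mu>"
  proof (rule antisym)
    show "ip_norm ip f \<le> \<mu>"
      unfolding \<mu>_def using min B(2) by (intro cINF_greatest) (auto simp: ip_norm_def)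
  qed (rule \<mu>[OF fB])
  show ?thesis
    unfolding \<mu>_def[symmetric]
  proof (rule ex1I[of _ f])
    show "f \<in> B \<and> ip_norm ip f = \<mu>" using fB f\<mu> by simp
    fix b assume b: "b \<in> B \<and> ip_norm ip b = \<mu>"
    have fH: "f \<in> H" "b \<in> H" using fB b B(1) by auto
    have "ip b b = \<mu>\<^sup>2" "ip f f = \<mu>\<^sup>2" using b sq[of b] sq[OF fB] f\<mu> by auto
    \<comment> \<open>The midpoint of two minimisers still has norm at least \<open>\<mu>\<close>,
      so the parallelogram law leaves no distance between them.\<close>
    moreover have "\<mu>\<^sup>2 \<le> ip (\<lambda>x. (b x + f x) / 2) (\<lambda>x. (b x + f x) / 2)"
      using \<mu>[OF B(3)[of b f]] sq[OF B(3)[of b f]] b fB \<mu>0 by (metis power_mono)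
    ultimately have "ip (\<lambda>x. b x - f x) (\<lambda>x. b x - f x) \<le> 0"
      unfolding parallelogram[OF fH(2,1)] by simp
    then have "ip (\<lambda>x. b x - f x) (\<lambda>x. b x - f x) = 0" using ip_nonneg[OF diff_mem[OF fH(2,1)]] by simp
    from ip_definite[OF diff_mem[OF fH(2,1)] this] show "b = f" by (auto simp: fun_eq_iff)
  qed
qed

end

section \<open>Kernels with algebraically decaying Fourier transform\<close>

lemma norm_cis_minus_1_le: "cmod (cis s - 1) \<le> \<bar>s\<bar>"
  using dist_exp_i_1[of s] abs_sin_x_le_abs_x[of "s / 2"] by (simp add: cis_conv_exp)

text \<open>In use, \<open>t\<close> is \<open>norm (r *\<^sub>R \<omega>)\<close> and
  \<open>R\<close> is \<open>r powr \<tau>\<close>, which is what the constant 1 becomes under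
  rescaling. For \<open>t \<le> 1\<close> the zero of order \<open>2 * k\<close> is absorbed by
  \<open>t powr \<tau>\<close>; for larger \<open>t\<close> the bound 2 costs the factor
  \<open>4 ^ k\<close>.\<close>

lemma min_power_le:
  fixes t \<tau> R :: real
  assumes t: "0 \<le> t" and \<tau>: "0 < \<tau>" "\<tau> \<le> 2 * real k" and R: "0 \<le> R"
  shows "(min 2 t) ^ (2 * k) * (1 + t powr \<tau>) \<le> 2 * 4 ^ k * (R + t powr \<tau>)"
proof (cases "t \<le> 1")
  case True
  have k: "k \<noteq> 0" using \<tau> by (intro notI) simp
  have "t ^ (2 * k) \<le> t powr \<tau>"
  proof (cases "t = 0")
    case True
    then show ?thesis using k by (simp add: power_0_left)
  next
    case False
    then have "t ^ (2 * k) = t powr (real (2 * k))" using t by (subst powr_realpow) auto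
    also have "\<dots> \<le> t powr \<tau>" using \<tau> True t by (intro powr_mono') auto
    finally show ?thesis .
  qed
  moreover have "t powr \<tau> \<le> 1" using \<tau> True t by (intro powr_le1) auto
  ultimately have "t ^ (2 * k) * (1 + t powr \<tau>) \<le> t powr \<tau> * 2"
    using t by (intro mult_mono) auto
  also have "\<dots> \<le> 2 * (4 ^ k * (R + t powr \<tau>))"
    using mult_mono[of 1 "4 ^ k" "t powr \<tau>" "R + t powr \<tau>"] R by simp
  finally show ?thesis using True by (simp add: min_def)
next
  case False
  have "(min 2 t) ^ (2 * k) \<le> 2 ^ (2 * k)" using t by (intro power_mono) auto
  moreover have "1 \<le> t powr \<tau>" using False \<tau> by (intro ge_one_powr_ge_zero) auto
  then have "1 + t powr \<tau> \<le> 2 * (R + t powr \<tau>)" using R unfolding distrib_left by linarith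
  ultimately have "(min 2 t) ^ (2 * k) * (1 + t powr \<tau>) \<le> 2 ^ (2 * k) * (2 * (R + t powr \<tau>))"
    using t by (intro mult_mono) auto
  also have "2 ^ (2 * k) = (4::real) ^ k" by (simp add: power_mult)
  finally show ?thesis by (simp only: mult_ac)
qed

lemma sum_cis_double:
  fixes p :: "'i \<Rightarrow> 'a::euclidean_space" and c :: "'i \<Rightarrow> real"
  shows "(\<Sum>i\<in>I. \<Sum>j\<in>I. complex_of_real (c i * c j) * cis ((p i - p j) \<bullet> w)) =
     complex_of_real ((cmod (\<Sum>i\<in>I. complex_of_real (c i) * cis (p i \<bullet> w)))\<^sup>2)"
  unfolding complex_norm_square cnj_sum sum_product
  by (intro sum.cong refl) (simp add: cis_cnj cis_mult inner_diff_left mult_ac flip: mult.assoc)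

text \<open>The computation behind the easy half of Bochner's theorem: expanding the squared modulus
  of the exponential sum gives one phase for each pair of points.\<close>

lemma quadratic_form_integral:
  fixes p :: "'i \<Rightarrow> 'a::euclidean_space" and c :: "'i \<Rightarrow> real"
  assumes w: "integrable lborel w"
    and K: "\<And>x y. complex_of_real (K x y) = (LINT \<omega>|lborel. complex_of_real (w \<omega>) * cis ((x - y) \<bullet> \<omega>))"
  shows "(\<Sum>i\<in>I. \<Sum>j\<in>I. c i * c j * K (p i) (p j)) =
     (LINT \<omega>|lborel. w \<omega> * (cmod (\<Sum>i\<in>I. complex_of_real (c i) * cis (p i \<bullet> \<omega>)))\<^sup>2)"
proof -
  have int: "integrable lborel (\<lambda>\<omega>. complex_of_real (w \<omega>) * cis (y \<bullet> \<omega>))" for y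
    by (intro integrable_mult_cis integrable_of_real w) auto
  have "complex_of_real (\<Sum>i\<in>I. \<Sum>j\<in>I. c i * c j * K (p i) (p j)) =
     (\<Sum>i\<in>I. \<Sum>j\<in>I. complex_of_real (c i * c j) * (LINT \<omega>|lborel. complex_of_real (w \<omega>) * cis ((p i - p j) \<bullet> \<omega>)))"
    by (simp add: K)
  also have "\<dots> = (\<Sum>i\<in>I. \<Sum>j\<in>I. (LINT \<omega>|lborel. complex_of_real (c i * c j) * (complex_of_real (w \<omega>) * cis ((p i - p j) \<bullet> \<omega>))))"
    by (simp only: integral_mult_right_zero)
  also have "\<dots> = (LINT \<omega>|lborel. (\<Sum>i\<in>I. \<Sum>j\<in>I. complex_of_real (c i * c j) * (complex_of_real (w \<omega>) * cis ((p i - p j) \<bullet> \<omega>))))"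
    using int by (subst Bochner_Integration.integral_sum, simp)+ (rule refl)
  also have "\<dots> = (LINT \<omega>|lborel. complex_of_real (w \<omega> * (cmod (\<Sum>i\<in>I. complex_of_real (c i) * cis (p i \<bullet> \<omega>)))\<^sup>2))"
    by (intro Bochner_Integration.integral_cong refl)
       (simp only: of_real_mult[of "w _"] sum_cis_double[symmetric] sum_distrib_left mult.left_commute)
  finally show ?thesis
    by (simp only: integral_complex_of_real of_real_eq_iff)
qed

text \<open>\<open>w\<close> is the spectral density with all normalising constants absorbed, so
  that a given \<open>\<Phi>hat\<close> and the inverse Sobolev weight become instances of the same
  argument.\<close>

locale decaying_kernel = native K H ip
  for K :: "real^'d \<Rightarrow> real^'d \<Rightarrow> real" and H ip +
  fixes w :: "real^'d \<Rightarrow> real" and \<tau> c C :: real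
  assumes \<tau>: "\<tau> > real CARD('d)"
    and w_measurable [measurable]: "w \<in> borel_measurable borel"
    and c: "c > 0"
    and w_lower: "\<And>\<omega>. c * inverse (1 + norm \<omega> powr \<tau>) \<le> w \<omega>"
    and w_upper: "\<And>\<omega>. w \<omega> \<le> C * inverse (1 + norm \<omega> powr \<tau>)"
    and K_eq: "\<And>x y. complex_of_real (K x y) = (LINT \<omega>|lborel. complex_of_real (w \<omega>) * cis ((x - y) \<bullet> \<omega>))"
begin

lemma w_pos: "w \<omega> > 0"
proof -
  have "0 < c * inverse (1 + norm \<omega> powr \<tau>)" using c by (simp add: add_pos_nonneg)
  also note w_lower
  finally show ?thesis .
qed

lemma C_pos: "C > 0"
proof -
  have "0 < C * inverse (1 + norm (0::real^'d) powr \<tau>)" using w_pos[of 0] w_upper[of 0] by linarith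
  then show ?thesis by simp
qed

lemma decay_integrable: "integrable lborel (\<lambda>\<omega>::real^'d. inverse (1 + norm \<omega> powr \<tau>))"
  using \<tau> by (intro integrable_decay) simp

lemma w_integrable: "integrable lborel w"
proof (rule Bochner_Integration.integrable_bound)
  show "integrable lborel (\<lambda>\<omega>::real^'d. C * inverse (1 + norm \<omega> powr \<tau>))"
    by (intro integrable_mult_right decay_integrable)
  show "AE \<omega> in lborel. norm (w \<omega>) \<le> norm (C * inverse (1 + norm \<omega> powr \<tau>))"
    using w_pos w_upper by (intro AE_I2) (smt (verit) real_norm_def)
qed simp

lemma quadratic_form:
  "(\<Sum>i\<in>I. \<Sum>j\<in>I. a i * a j * K (p i) (p j)) =
     (LINT \<omega>|lborel. w \<omega> * (cmod (\<Sum>i\<in>I. complex_of_real (a i) * cis (p i \<bullet> \<omega>)))\<^sup>2)"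
  by (rule quadratic_form_integral[OF w_integrable K_eq])

section \<open>The lower bound by finite differences\<close>

lemma bump_lower:
  obtains E where "E > 0" "\<And>r b. r > 0 \<Longrightarrow> b \<in> bumps H r \<Longrightarrow> E * r powr (real CARD('d) - \<tau>) \<le> ip b b"
proof -
  \<comment> \<open>The order of the difference; twice it has to reach \<open>\<tau>\<close> for
    \<open>min_power_le\<close>.\<close>
  obtain k :: nat where k: "\<tau> \<le> 2 * real k" 
  proof -
    obtain k :: nat where "\<tau> \<le> real k" using real_arch_simple by blast
    then have "\<tau> \<le> 2 * real k" by simp
    then show thesis by (rule that)
  qed
  let ?d = "CARD('d)"
  have \<tau>0: "\<tau> > 0" using \<tau> by (rule less_trans[rotated]) simp
  obtain e :: "real^'d" where e: "norm e = 1" using vector_choose_size[of 1] by auto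
  define I where "I = (LINT \<omega>|lborel. inverse (1 + norm (\<omega>::real^'d) powr \<tau>))"
  \<comment> \<open>\<open>C\<close> bounds the density, \<open>2 * 4 ^ k\<close> comes from
    \<open>min_power_le\<close>, and \<open>I\<close> is the integral left after rescaling the
    frequency.\<close>
  define D where "D = C * (2 * 4 ^ k * I)"
  have bound: "1 \<le> ip b b * (D * r powr (\<tau> - real ?d))" if r: "r > 0" and b: "b \<in> bumps H r" for r b
  proof -
    have bH: "b \<in> H" and b0: "b 0 = 1" and bz: "\<And>y. r \<le> norm y \<Longrightarrow> b y = 0"
      using b by (auto simp: bumps_def)
    define p :: "nat \<Rightarrow> real^'d" where "p j = (real j * r) *\<^sub>R e" for j
    \<comment> \<open>Alternating binomial weights, with weight 1 at the node 0. On exponentials the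
      difference multiplies by \<open>(1 - cis (r * (e \<bullet> \<omega>))) ^ k\<close>, and the
      step \<open>r\<close> is the smallest that puts every other node outside the open ball of
      radius \<open>r\<close>.\<close>
    define a where "a j = (- 1) ^ j * real (k choose j)" for j
    have bp: "b (p j) = 0" if "j > 0" for j
    proof (rule bz)
      have "1 * r \<le> real j * r" using that r by (intro mult_right_mono) auto
      then show "r \<le> norm (p j)" using r by (simp add: p_def e)
    qed
    have "(\<Sum>j\<le>k. a j * b (p j)) = (\<Sum>j\<in>{0}. a j * b (p j))"
      by (rule sum.mono_neutral_right) (use bp in auto)
    also have "\<dots> = 1" by (simp add: a_def p_def b0)
    finally have "1 \<le> ip b b * (\<Sum>i\<le>k. \<Sum>j\<le>k. a i * a j * K (p i) (p j))"
      using sum_bound[of "{..k}" b a p] bH by simp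
    also have "(\<Sum>i\<le>k. \<Sum>j\<le>k. a i * a j * K (p i) (p j)) \<le> D * r powr (\<tau> - real ?d)"
    proof -
      let ?P = "\<lambda>\<omega>. \<Sum>j\<le>k. complex_of_real (a j) * cis (p j \<bullet> \<omega>)"
      have P: "?P \<omega> = (1 - cis (r * (e \<bullet> \<omega>))) ^ k" for \<omega>
      proof -
        have "(1 - cis (r * (e \<bullet> \<omega>))) ^ k = (- cis (r * (e \<bullet> \<omega>)) + 1) ^ k" by simp
        also have "\<dots> = (\<Sum>j\<le>k. of_nat (k choose j) * (- cis (r * (e \<bullet> \<omega>))) ^ j * 1 ^ (k - j))"
          by (rule binomial_ring)
        also have "\<dots> = ?P \<omega>"
        proof (intro sum.cong refl)
          fix j
          have "(- cis (r * (e \<bullet> \<omega>))) ^ j = (- 1) ^ j * cis (p j \<bullet> \<omega>)"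
            unfolding power_minus[of "cis _"] Complex.DeMoivre by (simp add: p_def mult.assoc)
          then show "of_nat (k choose j) * (- cis (r * (e \<bullet> \<omega>))) ^ j * 1 ^ (k - j) = complex_of_real (a j) * cis (p j \<bullet> \<omega>)"
            by (simp add: a_def mult_ac)
        qed
        finally show ?thesis ..
      qed
      have Pb: "(cmod (?P \<omega>))\<^sup>2 \<le> (min 2 (norm (r *\<^sub>R \<omega>))) ^ (2 * k)" for \<omega>
      proof -
        let ?s = "r * (e \<bullet> \<omega>)"
        have "cmod (1 - cis ?s) \<le> 2" using norm_triangle_ineq4[of 1 "cis ?s"] by simp
        moreover have "cmod (1 - cis ?s) \<le> \<bar>?s\<bar>"
          using norm_cis_minus_1_le[of ?s] by (simp add: norm_minus_commute)
        moreover have "\<bar>?s\<bar> \<le> norm (r *\<^sub>R \<omega>)"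
          using Cauchy_Schwarz_ineq2[of e \<omega>] r by (simp add: abs_mult e mult_left_mono)
        ultimately have "cmod (1 - cis ?s) \<le> min 2 (norm (r *\<^sub>R \<omega>))" by simp
        then have "cmod (1 - cis ?s) ^ (2 * k) \<le> (min 2 (norm (r *\<^sub>R \<omega>))) ^ (2 * k)" by (intro power_mono) auto
        then show ?thesis unfolding P by (simp add: norm_power power_mult mult.commute[of 2])
      qed
      \<comment> \<open>Multiplied by \<open>r powr \<tau>\<close>, the denominator at
        \<open>\<omega>\<close> becomes
        \<open>r powr \<tau> + norm (r *\<^sub>R \<omega>) powr \<tau>\<close>, the form needed in
        \<open>min_power_le\<close>. What remains is integrable in the rescaled frequency.\<close>
      have key: "w \<omega> * (cmod (?P \<omega>))\<^sup>2 \<le> C * (2 * 4 ^ k * r powr \<tau> * inverse (1 + norm (r *\<^sub>R \<omega>) powr \<tau>))" for \<omega>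
      proof -
        let ?x = "norm (r *\<^sub>R \<omega>)"
        have rp: "r powr \<tau> > 0" using r by simp
        have x: "?x powr \<tau> = r powr \<tau> * norm \<omega> powr \<tau>" using r by (simp add: powr_mult)
        have "inverse (1 + norm \<omega> powr \<tau>) * (min 2 ?x) ^ (2 * k) \<le> 2 * 4 ^ k * r powr \<tau> * inverse (1 + ?x powr \<tau>)"
        proof -
          have "(min 2 ?x) ^ (2 * k) * (1 + ?x powr \<tau>) \<le> 2 * 4 ^ k * (r powr \<tau> + ?x powr \<tau>)"
            by (rule min_power_le) (use \<tau>0 k in auto)
          moreover have "r powr \<tau> + ?x powr \<tau> = r powr \<tau> * (1 + norm \<omega> powr \<tau>)"
            unfolding x by (simp only: distrib_left mult_1_right)
          moreover have "0 < 1 + norm \<omega> powr \<tau>" "0 < 1 + ?x powr \<tau>" by (auto simp: add_pos_nonneg)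
          ultimately show ?thesis by (simp add: field_simps)
        qed
        moreover have "w \<omega> * (cmod (?P \<omega>))\<^sup>2 \<le> (C * inverse (1 + norm \<omega> powr \<tau>)) * (min 2 ?x) ^ (2 * k)"
          using w_upper[of \<omega>] Pb[of \<omega>] C_pos by (intro mult_mono) auto
        ultimately show ?thesis using C_pos by (smt (verit) mult.assoc mult_left_mono)
      qed
      have ri: "integrable lborel (\<lambda>\<omega>::real^'d. inverse (1 + norm (r *\<^sub>R \<omega>) powr \<tau>))"
        using lborel_integrable_affine[OF _ decay_integrable, of r 0] r by simp
      have rI: "(LINT \<omega>|lborel. inverse (1 + norm (r *\<^sub>R (\<omega>::real^'d)) powr \<tau>)) = I * r powr (- real ?d)"
      proof -
        have "I = r ^ ?d * (LINT \<omega>|lborel. inverse (1 + norm (r *\<^sub>R (\<omega>::real^'d)) powr \<tau>))"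
          unfolding I_def using r by (subst lborel_integral_affine[where c=r and t=0]) auto
        then show ?thesis using r by (simp add: powr_minus powr_realpow field_simps)
      qed
      have "(\<Sum>i\<le>k. \<Sum>j\<le>k. a i * a j * K (p i) (p j)) = (LINT \<omega>|lborel. w \<omega> * (cmod (?P \<omega>))\<^sup>2)"
        by (rule quadratic_form)
      also have "\<dots> \<le> (LINT (\<omega>::real^'d)|lborel. C * (2 * 4 ^ k * r powr \<tau> * inverse (1 + norm (r *\<^sub>R \<omega>) powr \<tau>)))"
      proof (rule integral_mono_AE')
        show "integrable lborel (\<lambda>\<omega>. C * (2 * 4 ^ k * r powr \<tau> * inverse (1 + norm (r *\<^sub>R (\<omega>::real^'d)) powr \<tau>)))"
          by (intro integrable_mult_right ri)
        show "AE \<omega> in lborel. w \<omega> * (cmod (?P \<omega>))\<^sup>2 \<le> C * (2 * 4 ^ k * r powr \<tau> * inverse (1 + norm (r *\<^sub>R \<omega>) powr \<tau>))"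
          using key by (intro AE_I2)
        show "AE \<omega> in lborel. 0 \<le> C * (2 * 4 ^ k * r powr \<tau> * inverse (1 + norm (r *\<^sub>R (\<omega>::real^'d)) powr \<tau>))"
          using C_pos by (intro AE_I2) (simp add: add_nonneg_nonneg)
      qed
      also have "\<dots> = C * (2 * 4 ^ k * r powr \<tau> * (I * r powr (- real ?d)))"
        by (simp only: integral_mult_right_zero rI)
      also have "\<dots> = D * r powr (\<tau> - real ?d)"
        by (simp add: D_def powr_diff powr_minus divide_inverse)
      finally show ?thesis .
    qed
    finally show ?thesis using ip_nonneg[OF bH] by (auto intro: mult_left_mono)
  qed
  show ?thesis
  \<comment> \<open>For \<open>D \<le> 0\<close> the estimate \<open>bound\<close> would give
    \<open>1 \<le> 0\<close>, so there would be no bumps at all and any constant would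
    serve.\<close>
  proof (cases "D > 0")
    case True
    show ?thesis
    proof (rule that[of "1 / D"])
      show "1 / D > 0" using True by simp
      fix r b assume rb: "r > (0::real)" "b \<in> bumps H r"
      have "r powr (real ?d - \<tau>) * 1 \<le> r powr (real ?d - \<tau>) * (ip b b * (D * r powr (\<tau> - real ?d)))"
        by (intro mult_left_mono bound rb) simp
      also have "\<dots> = ip b b * D * (r powr (real ?d - \<tau>) * r powr (\<tau> - real ?d))" by simp
      also have "r powr (real ?d - \<tau>) * r powr (\<tau> - real ?d) = 1" using rb by (simp flip: powr_add)
      finally show "1 / D * r powr (real ?d - \<tau>) \<le> ip b b" using True by (simp add: field_simps)
    qed
  next
    case False
    show ?thesis
    proof (rule that[of 1])
      fix r b assume rb: "r > (0::real)" "b \<in> bumps H r"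
      have "ip b b * (D * r powr (\<tau> - real ?d)) \<le> 0"
      proof (rule mult_nonneg_nonpos)
        show "0 \<le> ip b b" using rb by (intro ip_nonneg) (simp add: bumps_def)
        show "D * r powr (\<tau> - real ?d) \<le> 0" using False by (intro mult_nonpos_nonneg) auto
      qed
      with bound[OF rb] show "1 * r powr (real ?d - \<tau>) \<le> ip b b" by simp
    qed simp
  qed
qed

section \<open>The upper bound by a rescaled bump\<close>

lemma bump_upper:
  obtains E where "E \<ge> 0" "\<And>r. 0 < r \<Longrightarrow> r \<le> 1 \<Longrightarrow> \<exists>b. b \<in> bumps H r \<and> ip b b \<le> E * r powr (real CARD('d) - \<tau>)"
proof -
  let ?d = "CARD('d)" and ?C0 = "(2 * pi) powr (- real CARD('d) / 2)"
  have \<tau>0: "\<tau> > 0" using \<tau> by (rule less_trans[rotated]) simp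
  \<comment> \<open>The choice \<open>N \<ge> \<tau>\<close> does two things: \<open>N\<close>
    exceeds the dimension, and of the two powers of \<open>1 + norm \<xi> powr real N\<close> in the
    squared decay one absorbs the weight \<open>1 + norm \<xi> powr \<tau>\<close> while the other
    is left for integrability.\<close>
  obtain N :: nat where N: "\<tau> \<le> real N" using real_arch_simple by blast
  have dN: "real N > real DIM(real^'d)" using N \<tau> by simp
  obtain \<psi> :: "real^'d \<Rightarrow> real" and A where cont: "continuous_on UNIV \<psi>"
    and \<psi>0: "\<psi> 0 = 1" and supp: "\<And>x. 1 \<le> norm x \<Longrightarrow> \<psi> x = 0"
    and decay: "\<And>w. cmod (ft (\<lambda>x. complex_of_real (\<psi> x)) w) \<le> A * inverse (1 + norm w powr real N)"
    and Fi: "integrable lborel (ft (\<lambda>x. complex_of_real (\<psi> x)))"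
    and inv: "\<And>x. ft (ft (\<lambda>x. complex_of_real (\<psi> x))) (- x) = complex_of_real (\<psi> x)"
    using bump_inversion[OF dN] by metis
  let ?F = "ft (\<lambda>x. complex_of_real (\<psi> x))"
  have [measurable]: "\<psi> \<in> borel_measurable borel" using cont by (rule borel_measurable_continuous_onI)
  have Ni: "integrable lborel (\<lambda>\<omega>::real^'d. inverse (1 + norm \<omega> powr real N))"
    by (rule integrable_decay[OF dN])
  let ?h = "\<lambda>\<xi>. (cmod (?F \<xi>))\<^sup>2 * (1 + norm \<xi> powr \<tau>)"
  have hi: "integrable lborel ?h"
  proof (rule Bochner_Integration.integrable_bound)
    show "integrable lborel (\<lambda>\<omega>::real^'d. 2 * A\<^sup>2 * inverse (1 + norm \<omega> powr real N))"
      by (intro integrable_mult_right Ni)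
    show "AE \<xi> in lborel. norm (?h \<xi>) \<le> norm (2 * A\<^sup>2 * inverse (1 + norm \<xi> powr real N))"
    proof (intro AE_I2)
      fix \<xi> :: "real^'d"
      let ?g = "1 + norm \<xi> powr real N"
      have g: "?g > 0" by (simp add: add_pos_nonneg)
      have canc: "(A * inverse g)\<^sup>2 * (2 * g) = 2 * A\<^sup>2 * inverse g" if "g > 0" for g
        using that by (simp add: power2_eq_square field_simps)
      have sq: "(cmod (?F \<xi>))\<^sup>2 \<le> (A * inverse ?g)\<^sup>2" by (intro power_mono decay) simp
      have two: "1 + a \<le> 2 * (1 + b)" if "a \<le> 1 \<or> a \<le> b" "0 \<le> b" for a b :: real
        using that by auto
      have "1 + norm \<xi> powr \<tau> \<le> 2 * ?g"
      proof (cases "norm \<xi> \<le> 1")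
        case True
        then have "norm \<xi> powr \<tau> \<le> 1" using \<tau>0 by (intro powr_le1) auto
        then show ?thesis by (intro two) auto
      next
        case False
        then have "norm \<xi> powr \<tau> \<le> norm \<xi> powr real N" using N by (intro powr_mono) auto
        then show ?thesis by (intro two) auto
      qed
      with sq have "?h \<xi> \<le> (A * inverse ?g)\<^sup>2 * (2 * ?g)" by (intro mult_mono) (auto simp: add_nonneg_nonneg)
      also have "\<dots> = 2 * A\<^sup>2 * inverse ?g" by (rule canc[OF g])
      finally show "norm (?h \<xi>) \<le> norm (2 * A\<^sup>2 * inverse ?g)" using g by (simp add: abs_mult add_nonneg_nonneg)
    qed
  qed measurable
  define D where "D = (LINT \<xi>|lborel. ?h \<xi>)"
  have D: "D \<ge> 0" unfolding D_def by (intro Bochner_Integration.integral_nonneg) (simp add: add_nonneg_nonneg)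
  define E where "E = ?C0\<^sup>2 * D / c"
  show ?thesis
  proof (rule that[of E])
    show E: "E \<ge> 0" using D c by (simp add: E_def)
    fix r :: real assume r: "0 < r" "r \<le> 1"
    define b where "b x = \<psi> (x /\<^sub>R r)" for x
    \<comment> \<open>The unitary transform of \<open>b\<close>, by scaling that of
      \<open>\<psi>\<close>.\<close>
    define B where "B \<omega> = complex_of_real (r ^ ?d) * ?F (r *\<^sub>R \<omega>)" for \<omega>
    have Bi: "integrable lborel B"
      unfolding B_def using lborel_integrable_affine[OF _ Fi, of r 0] r by simp
    have [measurable]: "B \<in> borel_measurable borel" using Bi by auto
    have bB: "complex_of_real (b x) = complex_of_real ?C0 * (LINT \<omega>|lborel. B \<omega> * cis (x \<bullet> \<omega>))" for x
    proof -
      have "complex_of_real (b x) = ft ?F (- (x /\<^sub>R r))" by (simp only: inv b_def)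
      also have "\<dots> = complex_of_real ?C0 * (LINT \<xi>|lborel. ?F \<xi> * cis (\<xi> \<bullet> (x /\<^sub>R r)))"
        by (simp add: ft_def)
      also have "(LINT \<xi>|lborel. ?F \<xi> * cis (\<xi> \<bullet> (x /\<^sub>R r))) = r ^ ?d *\<^sub>R (LINT \<omega>|lborel. ?F (r *\<^sub>R \<omega>) * cis (\<omega> \<bullet> x))"
        using r by (subst lborel_integral_affine[where c=r and t=0]) (auto simp flip: mult.assoc)
      also have "\<dots> = (LINT \<omega>|lborel. B \<omega> * cis (x \<bullet> \<omega>))"
        by (simp add: B_def scaleR_conv_of_real mult.assoc inner_commute)
      finally show ?thesis .
    qed
    \<comment> \<open>Up to the factor \<open>?C0\<^sup>2\<close>, the integral of \<open>?q\<close>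
      is the spectral expression for the squared native norm of \<open>b\<close>.\<close>
    let ?q = "\<lambda>\<omega>. (cmod (B \<omega>))\<^sup>2 / w \<omega>"
    have qle: "?q \<omega> \<le> 1 / c * (r ^ ?d)\<^sup>2 * r powr (- \<tau>) * ?h (r *\<^sub>R \<omega>)" for \<omega>
    proof -
      have g: "1 + norm \<omega> powr \<tau> > 0" by (simp add: add_pos_nonneg)
      have "1 / w \<omega> \<le> 1 / (c * inverse (1 + norm \<omega> powr \<tau>))"
        using w_lower[of \<omega>] w_pos[of \<omega>] c g by (intro divide_left_mono) auto
      also have "\<dots> = 1 / c * (1 + norm \<omega> powr \<tau>)" using c g by (simp add: field_simps)
      \<comment> \<open>Here \<open>r \<le> 1\<close> enters:
        \<open>1 \<le> r powr (- \<tau>)\<close> lets the constant term be compared together with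
        the power.\<close>
      also have "\<dots> \<le> 1 / c * (r powr (- \<tau>) * (1 + norm (r *\<^sub>R \<omega>) powr \<tau>))"
      proof (intro mult_left_mono)
        have "1 \<le> r powr (- \<tau>)" using r \<tau>0 by (simp add: powr_minus one_le_inverse powr_le1)
        moreover have "r powr (- \<tau>) * norm (r *\<^sub>R \<omega>) powr \<tau> = norm \<omega> powr \<tau>"
          using r by (simp add: powr_mult powr_minus)
        ultimately show "1 + norm \<omega> powr \<tau> \<le> r powr (- \<tau>) * (1 + norm (r *\<^sub>R \<omega>) powr \<tau>)"
          by (simp add: distrib_left)
      qed (use c in simp)
      finally have le: "(cmod (B \<omega>))\<^sup>2 * (1 / w \<omega>) \<le> (cmod (B \<omega>))\<^sup>2 * (1 / c * (r powr (- \<tau>) * (1 + norm (r *\<^sub>R \<omega>) powr \<tau>)))"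
        by (intro mult_left_mono) auto
      have "(cmod (B \<omega>))\<^sup>2 = (r ^ ?d)\<^sup>2 * (cmod (?F (r *\<^sub>R \<omega>)))\<^sup>2"
        using r by (simp add: B_def norm_mult power_mult_distrib norm_power)
      with le show ?thesis by (simp add: mult_ac)
    qed
    have hri: "integrable lborel (\<lambda>\<omega>. ?h (r *\<^sub>R \<omega>))"
      using lborel_integrable_affine[OF _ hi, of r 0] r by simp
    have q0: "?q \<omega> \<ge> 0" for \<omega> using w_pos[of \<omega>] by simp
    have qi: "integrable lborel ?q"
    proof (rule Bochner_Integration.integrable_bound)
      show "integrable lborel (\<lambda>\<omega>. 1 / c * (r ^ ?d)\<^sup>2 * r powr (- \<tau>) * ?h (r *\<^sub>R \<omega>))"
        by (intro integrable_mult_right hri)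
      show "AE \<omega> in lborel. norm (?q \<omega>) \<le> norm (1 / c * (r ^ ?d)\<^sup>2 * r powr (- \<tau>) * ?h (r *\<^sub>R \<omega>))"
      proof (intro AE_I2)
        fix \<omega>
        show "norm (?q \<omega>) \<le> norm (1 / c * (r ^ ?d)\<^sup>2 * r powr (- \<tau>) * ?h (r *\<^sub>R \<omega>))"
          using qle[of \<omega>] q0[of \<omega>] unfolding real_norm_def by linarith
      qed
    qed measurable
    have qI: "?C0\<^sup>2 * (LINT \<omega>|lborel. ?q \<omega>) \<le> E * r powr (real ?d - \<tau>)"
    proof -
      have "D = r ^ ?d * (LINT \<omega>|lborel. ?h (r *\<^sub>R \<omega>))"
        unfolding D_def using r by (subst lborel_integral_affine[where c=r and t=0]) auto
      then have hI: "(LINT \<omega>|lborel. ?h (r *\<^sub>R \<omega>)) = D / r ^ ?d" using r by simp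
      have "(LINT \<omega>|lborel. ?q \<omega>) \<le> (LINT \<omega>|lborel. 1 / c * (r ^ ?d)\<^sup>2 * r powr (- \<tau>) * ?h (r *\<^sub>R \<omega>))"
        by (intro Bochner_Integration.integral_mono qi integrable_mult_right hri qle)
      also have "\<dots> = 1 / c * (r ^ ?d)\<^sup>2 * r powr (- \<tau>) * (D / r ^ ?d)"
        by (simp only: integral_mult_right_zero hI)
      also have "\<dots> = D / c * (r ^ ?d * r powr (- \<tau>))"
        using r by (simp add: power2_eq_square)
      also have "r ^ ?d * r powr (- \<tau>) = r powr (real ?d - \<tau>)"
        using r by (simp add: powr_diff powr_minus divide_inverse powr_realpow)
      finally have "?C0\<^sup>2 * (LINT \<omega>|lborel. ?q \<omega>) \<le> ?C0\<^sup>2 * (D / c * r powr (real ?d - \<tau>))"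
        by (intro mult_left_mono) auto
      then show ?thesis by (simp add: E_def)
    qed
    define M where "M = sqrt (E * r powr (real ?d - \<tau>))"
    have M: "M \<ge> 0" and M2: "M\<^sup>2 = E * r powr (real ?d - \<tau>)" using E by (auto simp: M_def)
    have crit: "(\<Sum>x\<in>X. a x * b x)\<^sup>2 \<le> M\<^sup>2 * (\<Sum>x\<in>X. \<Sum>y\<in>X. a x * a y * K x y)" if "finite X" for X a
    proof -
      let ?P = "\<lambda>\<omega>. \<Sum>x\<in>X. complex_of_real (a x) * cis (x \<bullet> \<omega>)"
      \<comment> \<open>Dividing and multiplying by \<open>sqrt (w \<omega>)\<close> prepares
        Cauchy-Schwarz: the squared norm of \<open>?u\<close> is the integral of \<open>?q\<close>,
        that of \<open>?v\<close> the quadratic form \<open>Q\<close>.\<close>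
      let ?u = "\<lambda>\<omega>. B \<omega> / complex_of_real (sqrt (w \<omega>))" and ?v = "\<lambda>\<omega>. complex_of_real (sqrt (w \<omega>)) * ?P \<omega>"
      define Q where "Q = (\<Sum>x\<in>X. \<Sum>y\<in>X. a x * a y * K x y)"
      have Q: "Q = (LINT \<omega>|lborel. w \<omega> * (cmod (?P \<omega>))\<^sup>2)" unfolding Q_def by (rule quadratic_form)
      have Pm [measurable]: "?P \<in> borel_measurable borel" by measurable
      have Pb: "cmod (?P \<omega>) \<le> (\<Sum>x\<in>X. \<bar>a x\<bar>)" for \<omega>
        by (rule order_trans[OF norm_sum]) (simp add: norm_mult)
      have wPi: "integrable lborel (\<lambda>\<omega>. w \<omega> * (cmod (?P \<omega>))\<^sup>2)"
      proof (rule Bochner_Integration.integrable_bound)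
        show "integrable lborel (\<lambda>\<omega>. w \<omega> * (\<Sum>x\<in>X. \<bar>a x\<bar>)\<^sup>2)" by (intro integrable_mult_left w_integrable)
        show "AE \<omega> in lborel. norm (w \<omega> * (cmod (?P \<omega>))\<^sup>2) \<le> norm (w \<omega> * (\<Sum>x\<in>X. \<bar>a x\<bar>)\<^sup>2)"
        proof (intro AE_I2)
          fix \<omega>
          have "(cmod (?P \<omega>))\<^sup>2 \<le> (\<Sum>x\<in>X. \<bar>a x\<bar>)\<^sup>2" by (intro power_mono Pb) simp
          then show "norm (w \<omega> * (cmod (?P \<omega>))\<^sup>2) \<le> norm (w \<omega> * (\<Sum>x\<in>X. \<bar>a x\<bar>)\<^sup>2)"
            using w_pos[of \<omega>] by (simp add: abs_mult mult_left_mono)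
        qed
      qed measurable
      have u2: "(cmod (?u \<omega>))\<^sup>2 = ?q \<omega>" for \<omega>
        using w_pos[of \<omega>] by (simp add: norm_divide power_divide)
      have v2: "(cmod (?v \<omega>))\<^sup>2 = w \<omega> * (cmod (?P \<omega>))\<^sup>2" for \<omega>
        using w_pos[of \<omega>] by (simp add: norm_mult power_mult_distrib)
      have ns: "nsq ?u = ennreal (LINT \<omega>|lborel. ?q \<omega>)" "nsq ?v = ennreal Q"
        unfolding Q by (subst nsq_eq_integral; (simp only: u2 v2 qi wPi)?)+
      have "complex_of_real (\<Sum>x\<in>X. a x * b x) = complex_of_real ?C0 * (LINT \<omega>|lborel. ?u \<omega> * ?v \<omega>)"
      proof -
        have int: "integrable lborel (\<lambda>\<omega>. B \<omega> * cis (x \<bullet> \<omega>))" for x by (intro integrable_mult_cis Bi) auto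
        have "complex_of_real (\<Sum>x\<in>X. a x * b x) = complex_of_real ?C0 * (\<Sum>x\<in>X. (LINT \<omega>|lborel. complex_of_real (a x) * (B \<omega> * cis (x \<bullet> \<omega>))))"
        proof -
          have "complex_of_real (a x) * (complex_of_real ?C0 * (LINT \<omega>|lborel. B \<omega> * cis (x \<bullet> \<omega>))) =
              complex_of_real ?C0 * (LINT \<omega>|lborel. complex_of_real (a x) * (B \<omega> * cis (x \<bullet> \<omega>)))" for x
            unfolding integral_mult_right_zero by (rule mult.left_commute)
          then show ?thesis
            by (simp only: of_real_sum of_real_mult bB sum_distrib_left)
        qed
        also have "(\<Sum>x\<in>X. (LINT \<omega>|lborel. complex_of_real (a x) * (B \<omega> * cis (x \<bullet> \<omega>)))) = (LINT \<omega>|lborel. (\<Sum>x\<in>X. complex_of_real (a x) * (B \<omega> * cis (x \<bullet> \<omega>))))"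
          using int by (subst Bochner_Integration.integral_sum) auto
        also have "\<dots> = (LINT \<omega>|lborel. ?u \<omega> * ?v \<omega>)"
        proof (intro Bochner_Integration.integral_cong refl)
          fix \<omega>
          have "complex_of_real (sqrt (w \<omega>)) \<noteq> 0" using w_pos[of \<omega>] by simp
          then show "(\<Sum>x\<in>X. complex_of_real (a x) * (B \<omega> * cis (x \<bullet> \<omega>))) = ?u \<omega> * ?v \<omega>"
            by (simp add: sum_distrib_left mult.left_commute)
        qed
        finally show ?thesis .
      qed
      then have "cmod (complex_of_real (\<Sum>x\<in>X. a x * b x)) = cmod (complex_of_real ?C0 * (LINT \<omega>|lborel. ?u \<omega> * ?v \<omega>))"
        by (rule arg_cong)
      then have "\<bar>\<Sum>x\<in>X. a x * b x\<bar> = ?C0 * cmod (LINT \<omega>|lborel. ?u \<omega> * ?v \<omega>)"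
        unfolding norm_mult norm_of_real by simp
      from arg_cong[OF this, of "\<lambda>t. t\<^sup>2"]
      have "(\<Sum>x\<in>X. a x * b x)\<^sup>2 = ?C0\<^sup>2 * (cmod (LINT \<omega>|lborel. ?u \<omega> * ?v \<omega>))\<^sup>2"
        by (simp only: power2_abs power_mult_distrib)
      moreover have "(cmod (LINT \<omega>|lborel. ?u \<omega> * ?v \<omega>))\<^sup>2 \<le> (LINT \<omega>|lborel. ?q \<omega>) * Q"
      proof -
        have Q0: "0 \<le> Q" unfolding Q using w_pos by (intro Bochner_Integration.integral_nonneg) (simp add: less_imp_le)
        have I0: "0 \<le> (LINT \<omega>|lborel. ?q \<omega>)" by (intro Bochner_Integration.integral_nonneg q0)
        have "ennreal ((cmod (LINT \<omega>|lborel. ?u \<omega> * ?v \<omega>))\<^sup>2) \<le> ennreal ((LINT \<omega>|lborel. ?q \<omega>) * Q)"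
          using norm_integral_mult_le[of ?u ?v] unfolding ns by (simp add: ennreal_power ennreal_mult Q0 I0)
        then show ?thesis using Q0 I0 by (subst (asm) ennreal_le_iff) auto
      qed
      ultimately have "(\<Sum>x\<in>X. a x * b x)\<^sup>2 \<le> ?C0\<^sup>2 * ((LINT \<omega>|lborel. ?q \<omega>) * Q)"
        by (simp add: mult_left_mono)
      also have "\<dots> \<le> E * r powr (real ?d - \<tau>) * Q"
        unfolding mult.assoc[symmetric] using qI
      proof (rule mult_right_mono)
        show "0 \<le> Q" unfolding Q using w_pos by (intro Bochner_Integration.integral_nonneg) (simp add: less_imp_le)
      qed
      finally show ?thesis unfolding M2 Q_def .
    qed
    note bH = mem_if_sum_bound[OF M crit]
    have "b \<in> bumps H r"
    proof -
      have "b y = 0" if "r \<le> norm y" for y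
        unfolding b_def
      proof (rule supp)
        have "norm (y /\<^sub>R r) = norm y / r" using r by (simp add: divide_inverse mult.commute)
        then show "1 \<le> norm (y /\<^sub>R r)" using r that by simp
      qed
      moreover have "b 0 = 1" by (simp add: b_def \<psi>0)
      ultimately show ?thesis using bH(1) by (simp add: bumps_def)
    qed
    then show "\<exists>b. b \<in> bumps H r \<and> ip b b \<le> E * r powr (real CARD('d) - \<tau>)"
      using bH(2) unfolding M2 by blast
  qed
qed

text \<open>The minimiser exists for every \<open>r > 0\<close>, since a bump of radius
  \<open>min r 1\<close> is also one of radius \<open>r\<close>. The two-sided rate is claimed with
  \<open>r0 = 1\<close>, the range covered by \<open>bump_upper\<close>.\<close>

theorem bump_norm_asymptotics:
  "(\<forall>r>0. (\<exists>!b. b \<in> bumps H r \<and> ip_norm ip b = bump_norm H ip r) \<and>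
          bump_norm H ip r = ip_norm ip (optimal_bump H ip r)) \<and>
   (\<exists>c' C' r0. 0 < c' \<and> c' \<le> C' \<and> 0 < r0 \<and>
     (\<forall>r. 0 < r \<and> r \<le> r0 \<longrightarrow>
        c' * r powr (real CARD('d) / 2 - \<tau> / 2) \<le> bump_norm H ip r \<and>
        bump_norm H ip r \<le> C' * r powr (real CARD('d) / 2 - \<tau> / 2)))"
proof -
  let ?d = "CARD('d)"
  obtain L where L: "L > 0" "\<And>r b. r > 0 \<Longrightarrow> b \<in> bumps H r \<Longrightarrow> L * r powr (real ?d - \<tau>) \<le> ip b b"
    using bump_lower by blast
  obtain U where U: "U \<ge> 0" "\<And>r. 0 < r \<Longrightarrow> r \<le> 1 \<Longrightarrow> \<exists>b. b \<in> bumps H r \<and> ip b b \<le> U * r powr (real ?d - \<tau>)"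
    using bump_upper by blast
  have ne: "bumps H r \<noteq> {}" if r: "r > 0" for r
  proof -
    obtain b where "b \<in> bumps H (min r 1)" using U(2)[of "min r 1"] r by auto
    then have "b \<in> bumps H r" by (auto simp: bumps_def)
    then show ?thesis by blast
  qed
  have bdd: "bdd_below (ip_norm ip ` bumps H r)" for r
    by (auto intro!: bdd_belowI2[of _ 0] simp: ip_norm_def bumps_def ip_nonneg)
  have unique: "\<exists>!b. b \<in> bumps H r \<and> ip_norm ip b = bump_norm H ip r" if r: "r > 0" for r
    unfolding bump_norm_def
  proof (rule ip_norm_eq_inf_unique)
    show "bumps H r \<subseteq> H" by (auto simp: bumps_def)
    show "bumps H r \<noteq> {}" by (rule ne[OF r])
    show "(\<lambda>x. (f x + g x) / 2) \<in> bumps H r" if "f \<in> bumps H r" "g \<in> bumps H r" for f g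
      using that by (auto simp: bumps_def half_sum_mem)
    show "f \<in> bumps H r" if s: "\<And>n. s n \<in> bumps H r" and f: "f \<in> H" and lim: "\<And>x. (\<lambda>n. s n x) \<longlonglongrightarrow> f x" for s f
    proof -
      have "f 0 = 1" using LIMSEQ_unique[OF lim[of 0], of 1] s by (simp add: bumps_def)
      moreover have "f y = 0" if "r \<le> norm y" for y
        using LIMSEQ_unique[OF lim[of y], of 0] s that by (simp add: bumps_def)
      ultimately show ?thesis using f by (simp add: bumps_def)
    qed
  qed
  have opt: "bump_norm H ip r = ip_norm ip (optimal_bump H ip r)" if r: "r > 0" for r
    using theI'[OF unique[OF r]] unfolding optimal_bump_def by simp
  have sq: "sqrt (x * r powr (real ?d - \<tau>)) = sqrt x * r powr (real ?d / 2 - \<tau> / 2)" if "r > 0" for x r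
    using that by (simp add: real_sqrt_mult powr_half_sqrt[symmetric] powr_powr diff_divide_distrib)
  have lower: "sqrt L * r powr (real ?d / 2 - \<tau> / 2) \<le> bump_norm H ip r" if r: "r > 0" for r
    unfolding bump_norm_def
  proof (rule cINF_greatest[OF ne[OF r]])
    fix b assume "b \<in> bumps H r"
    from real_sqrt_le_mono[OF L(2)[OF r this]]
    show "sqrt L * r powr (real ?d / 2 - \<tau> / 2) \<le> ip_norm ip b" by (simp add: ip_norm_def sq r)
  qed
  have upper: "bump_norm H ip r \<le> sqrt U * r powr (real ?d / 2 - \<tau> / 2)" if r: "r > 0" "r \<le> 1" for r
  proof -
    obtain b where b: "b \<in> bumps H r" "ip b b \<le> U * r powr (real ?d - \<tau>)" using U(2)[OF r] by blast
    have "bump_norm H ip r \<le> ip_norm ip b" unfolding bump_norm_def by (rule cINF_lower[OF bdd b(1)])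
    also have "\<dots> \<le> sqrt U * r powr (real ?d / 2 - \<tau> / 2)"
      using real_sqrt_le_mono[OF b(2)] by (simp add: ip_norm_def sq r)
    finally show ?thesis .
  qed
  \<comment> \<open>The order of the constants is read off at \<open>r = 1\<close>, where both
    bounds apply and the power is 1.\<close>
  have "sqrt L \<le> sqrt U" using order_trans[OF lower[of 1] upper[of 1]] by simp
  then show ?thesis
    using unique opt lower upper L(1)
    by (intro conjI allI impI exI[of _ "sqrt L"] exI[of _ "sqrt U"] exI[of _ 1]) auto
qed

end

section \<open>The Sobolev space as a native space\<close>

lemma nsq_reflect:
  fixes f :: "'a::euclidean_space \<Rightarrow> complex"
  assumes [measurable]: "f \<in> borel_measurable borel"
  shows "nsq (\<lambda>x. f (- x)) = nsq f"
  unfolding nsq_def by (subst (2) lborel_nn_integral_affine[where c="-1" and t=0]) auto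

lemma is_fourier_transform_zero: "is_fourier_transform (\<lambda>x::real^'d. 0) (\<lambda>w. 0)"
proof -
  have "is_fourier_transform (\<lambda>x::real^'d. 0) (fourier_transform (\<lambda>x. 0))"
    by (rule fourier_transform_exists) auto
  from is_fourier_transform_add[OF this this, of 0 0] show ?thesis by simp
qed

text \<open>The parameter \<open>dim\<close> only serves to fix the type \<open>'d\<close>.\<close>

locale sobolev =
  fixes m :: real and dim :: "'d::finite itself"
  assumes m: "m > real CARD('d) / 2"
begin

abbreviation "S \<equiv> (sobolev_space m :: (real^'d \<Rightarrow> real) set)"

definition W :: "real^'d \<Rightarrow> real" where "W \<omega> = (1 + (norm \<omega>)\<^sup>2) powr m"

lemma m_pos: "m > 0"
  using m by (rule le_less_trans[rotated]) simp

lemma W_measurable [measurable]: "W \<in> borel_measurable borel"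
  unfolding W_def by measurable

lemma W_ge_1: "W \<omega> \<ge> 1"
  unfolding W_def using m_pos by (intro ge_one_powr_ge_zero) auto

lemma W_pos: "W \<omega> > 0"
  using W_ge_1[of \<omega>] by linarith

lemma norm_square_powr: "(norm (\<omega>::real^'d))\<^sup>2 powr m = norm \<omega> powr (2 * m)"
  by (cases "\<omega> = 0") (simp_all add: powr_powr flip: powr_numeral)

lemma W_lower: "1 + norm \<omega> powr (2 * m) \<le> 2 * W \<omega>"
proof -
  have "norm \<omega> powr (2 * m) \<le> W \<omega>"
    unfolding W_def norm_square_powr[symmetric] using m_pos by (intro powr_mono2) auto
  then show ?thesis using W_ge_1[of \<omega>] by linarith
qed

lemma W_upper: "W \<omega> \<le> 2 powr m * (1 + norm \<omega> powr (2 * m))"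
proof -
  let ?t = "(norm \<omega>)\<^sup>2"
  have "W \<omega> \<le> (2 * max 1 ?t) powr m"
    unfolding W_def using m_pos by (intro powr_mono2) auto
  also have "\<dots> = 2 powr m * max 1 ?t powr m" by (simp add: powr_mult)
  also have "max 1 ?t powr m \<le> 1 + ?t powr m" by (auto simp: max_def)
  finally show ?thesis by (simp add: norm_square_powr mult_left_mono)
qed

lemma W_inverse_integrable: "integrable lborel (\<lambda>\<omega>. inverse (W \<omega>))"
proof (rule Bochner_Integration.integrable_bound)
  show "integrable lborel (\<lambda>\<omega>::real^'d. 2 * inverse (1 + norm \<omega> powr (2 * m)))"
    using m by (intro integrable_mult_right integrable_decay) simp
  show "AE \<omega> in lborel. norm (inverse (W \<omega>)) \<le> norm (2 * inverse (1 + norm \<omega> powr (2 * m)))"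
  proof (intro AE_I2)
    fix \<omega> :: "real^'d"
    have p: "1 + norm \<omega> powr (2 * m) > 0" by (simp add: add_pos_nonneg)
    have "inverse (2 * W \<omega>) \<le> inverse (1 + norm \<omega> powr (2 * m))"
      by (intro le_imp_inverse_le W_lower p)
    then have "inverse (W \<omega>) \<le> 2 * inverse (1 + norm \<omega> powr (2 * m))" by simp
    then show "norm (inverse (W \<omega>)) \<le> norm (2 * inverse (1 + norm \<omega> powr (2 * m)))"
      using W_pos[of \<omega>] p by simp
  qed
qed measurable

text \<open>The Sobolev embedding in Fourier form: by the arithmetic-geometric mean inequality
  \<open>cmod (F \<omega>)\<close> is at most \<open>W \<omega> * (cmod (F \<omega>))\<^sup>2 +
  inverse (W \<omega>)\<close>, and \<open>m > d / 2\<close> makes the last term integrable.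
  Integrable transforms give pointwise inversion, on which evaluation at points rests.\<close>

lemma weighted_L2_integrable:
  assumes [measurable]: "F \<in> borel_measurable borel" and F: "integrable lborel (\<lambda>\<omega>. W \<omega> * (cmod (F \<omega>))\<^sup>2)"
  shows "integrable lborel F" "integrable lborel (\<lambda>\<omega>. (cmod (F \<omega>))\<^sup>2)"
proof -
  show "integrable lborel F"
  proof (rule Bochner_Integration.integrable_bound)
    show "integrable lborel (\<lambda>\<omega>. W \<omega> * (cmod (F \<omega>))\<^sup>2 + inverse (W \<omega>))"
      by (intro Bochner_Integration.integrable_add F W_inverse_integrable)
    show "AE \<omega> in lborel. cmod (F \<omega>) \<le> norm (W \<omega> * (cmod (F \<omega>))\<^sup>2 + inverse (W \<omega>))"
    proof (intro AE_I2)
      fix \<omega>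
      let ?a = "sqrt (W \<omega>) * cmod (F \<omega>)" and ?b = "1 / sqrt (W \<omega>)"
      have "2 * ?a * ?b \<le> ?a\<^sup>2 + ?b\<^sup>2" by (rule sum_squares_bound)
      moreover have "2 * ?a * ?b = 2 * cmod (F \<omega>)" using W_pos[of \<omega>] by simp
      moreover have "?a\<^sup>2 + ?b\<^sup>2 = W \<omega> * (cmod (F \<omega>))\<^sup>2 + inverse (W \<omega>)"
        using W_pos[of \<omega>] by (simp add: power_mult_distrib power_divide inverse_eq_divide)
      ultimately show "cmod (F \<omega>) \<le> norm (W \<omega> * (cmod (F \<omega>))\<^sup>2 + inverse (W \<omega>))"
        using norm_ge_zero[of "F \<omega>"] unfolding real_norm_def by linarith
    qed
  qed measurable
  show "integrable lborel (\<lambda>\<omega>. (cmod (F \<omega>))\<^sup>2)"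
  proof (rule Bochner_Integration.integrable_bound[OF F])
    show "AE \<omega> in lborel. norm ((cmod (F \<omega>))\<^sup>2) \<le> norm (W \<omega> * (cmod (F \<omega>))\<^sup>2)"
    proof (intro AE_I2)
      fix \<omega>
      have "1 * (cmod (F \<omega>))\<^sup>2 \<le> W \<omega> * (cmod (F \<omega>))\<^sup>2" by (intro mult_right_mono W_ge_1) simp
      then show "norm ((cmod (F \<omega>))\<^sup>2) \<le> norm (W \<omega> * (cmod (F \<omega>))\<^sup>2)" by simp
    qed
  qed measurable
qed

text \<open>\<open>fourier_transform f\<close> is a choice from a class of functions that agree almost everywhere; the
  following lemmas allow any other representative in its place.\<close>

lemma mem_iff:
  assumes F: "is_fourier_transform f F"
  shows "f \<in> S \<longleftrightarrow> continuous_on UNIV f \<and> integrable lborel (\<lambda>\<omega>. W \<omega> * (cmod (F \<omega>))\<^sup>2)"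
proof -
  from F have [measurable]: "f \<in> borel_measurable borel" "F \<in> borel_measurable borel"
    and f2: "integrable lborel (\<lambda>x. (f x)\<^sup>2)"
    unfolding is_fourier_transform_iff by auto
  have ft: "is_fourier_transform f (fourier_transform f)" by (rule fourier_transform_exists[OF _ f2]) auto
  then have [measurable]: "fourier_transform f \<in> borel_measurable borel"
    unfolding is_fourier_transform_iff by auto
  have "integrable lborel (\<lambda>\<omega>. W \<omega> * (cmod (fourier_transform f \<omega>))\<^sup>2) \<longleftrightarrow> integrable lborel (\<lambda>\<omega>. W \<omega> * (cmod (F \<omega>))\<^sup>2)"
    by (rule integrable_cong_AE) (use fourier_transform_unique[OF ft F] in auto)
  then show ?thesis using f2 by (simp add: sobolev_space_def W_def)
qed

lemma mem_transform:
  assumes "f \<in> S"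
  shows "is_fourier_transform f (fourier_transform f)"
    and "continuous_on UNIV f"
    and "integrable lborel (\<lambda>\<omega>. W \<omega> * (cmod (fourier_transform f \<omega>))\<^sup>2)"
    and "fourier_transform f \<in> borel_measurable borel"
proof -
  have "continuous_on UNIV f" "integrable lborel (\<lambda>x. (f x)\<^sup>2)"
    using assms by (auto simp: sobolev_space_def)
  then show 1: "is_fourier_transform f (fourier_transform f)"
    by (intro fourier_transform_exists borel_measurable_continuous_onI)
  show "continuous_on UNIV f" "integrable lborel (\<lambda>\<omega>. W \<omega> * (cmod (fourier_transform f \<omega>))\<^sup>2)"
    using assms mem_iff[OF 1] by auto
  show "fourier_transform f \<in> borel_measurable borel" using 1 unfolding is_fourier_transform_iff by auto
qed

lemma inner_eq:
  assumes F: "is_fourier_transform f F" and G: "is_fourier_transform g G"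
  shows "sobolev_inner m f g = (LINT \<omega>|lborel. W \<omega> * Re (F \<omega> * cnj (G \<omega>)))"
proof -
  from F G have [measurable]: "f \<in> borel_measurable borel" "F \<in> borel_measurable borel"
      "g \<in> borel_measurable borel" "G \<in> borel_measurable borel"
    and f2: "integrable lborel (\<lambda>x. (f x)\<^sup>2)" and g2: "integrable lborel (\<lambda>x. (g x)\<^sup>2)"
    unfolding is_fourier_transform_iff by auto
  have ft: "is_fourier_transform f (fourier_transform f)" by (rule fourier_transform_exists[OF _ f2]) auto
  have gt: "is_fourier_transform g (fourier_transform g)" by (rule fourier_transform_exists[OF _ g2]) auto
  from ft gt have [measurable]: "fourier_transform f \<in> borel_measurable borel" "fourier_transform g \<in> borel_measurable borel"
    unfolding is_fourier_transform_iff by auto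
  show ?thesis
    unfolding sobolev_inner_def W_def[symmetric]
  proof (rule integral_cong_AE)
    show "AE \<omega> in lborel. W \<omega> * Re (fourier_transform f \<omega> * cnj (fourier_transform g \<omega>)) = W \<omega> * Re (F \<omega> * cnj (G \<omega>))"
      using fourier_transform_unique[OF ft F] fourier_transform_unique[OF gt G] by eventually_elim simp
  qed measurable
qed

lemma inner_self:
  assumes F: "is_fourier_transform f F"
  shows "sobolev_inner m f f = (LINT \<omega>|lborel. W \<omega> * (cmod (F \<omega>))\<^sup>2)"
  unfolding inner_eq[OF F F] cmod_power2 by (simp add: power2_eq_square)

lemma inner_integrable:
  assumes [measurable]: "F \<in> borel_measurable borel" "G \<in> borel_measurable borel"
    and F: "integrable lborel (\<lambda>\<omega>. W \<omega> * (cmod (F \<omega>))\<^sup>2)" and G: "integrable lborel (\<lambda>\<omega>. W \<omega> * (cmod (G \<omega>))\<^sup>2)"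
  shows "integrable lborel (\<lambda>\<omega>. W \<omega> * Re (F \<omega> * cnj (G \<omega>)))"
proof (rule Bochner_Integration.integrable_bound[OF Bochner_Integration.integrable_add[OF F G]])
  show "AE \<omega> in lborel. norm (W \<omega> * Re (F \<omega> * cnj (G \<omega>))) \<le> norm (W \<omega> * (cmod (F \<omega>))\<^sup>2 + W \<omega> * (cmod (G \<omega>))\<^sup>2)"
  proof (intro AE_I2)
    fix \<omega>
    have "\<bar>Re (F \<omega> * cnj (G \<omega>))\<bar> \<le> cmod (F \<omega>) * cmod (G \<omega>)"
      using abs_Re_le_cmod[of "F \<omega> * cnj (G \<omega>)"] by (simp only: norm_mult complex_mod_cnj)
    also have "\<dots> \<le> (cmod (F \<omega>))\<^sup>2 + (cmod (G \<omega>))\<^sup>2"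
      using sum_squares_bound[of "cmod (F \<omega>)" "cmod (G \<omega>)"] mult_nonneg_nonneg[OF norm_ge_zero[of "F \<omega>"] norm_ge_zero[of "G \<omega>"]]
      by linarith
    finally have "W \<omega> * \<bar>Re (F \<omega> * cnj (G \<omega>))\<bar> \<le> W \<omega> * ((cmod (F \<omega>))\<^sup>2 + (cmod (G \<omega>))\<^sup>2)"
      using W_pos[of \<omega>] by (intro mult_left_mono) auto
    then show "norm (W \<omega> * Re (F \<omega> * cnj (G \<omega>))) \<le> norm (W \<omega> * (cmod (F \<omega>))\<^sup>2 + W \<omega> * (cmod (G \<omega>))\<^sup>2)"
      using W_pos[of \<omega>] by (simp only: real_norm_def abs_mult abs_of_pos distrib_left[symmetric]) 
        (simp add: abs_mult)
  qed
qed measurable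

lemma linear_mem:
  assumes f: "f \<in> S" and g: "g \<in> S"
  shows "is_fourier_transform (\<lambda>x. a * f x + b * g x) (\<lambda>\<omega>. complex_of_real a * fourier_transform f \<omega> + complex_of_real b * fourier_transform g \<omega>)"
    and "(\<lambda>x. a * f x + b * g x) \<in> S"
proof -
  note F = mem_transform[OF f] and G = mem_transform[OF g]
  note [measurable] = F(4) G(4)
  let ?H = "\<lambda>\<omega>. complex_of_real a * fourier_transform f \<omega> + complex_of_real b * fourier_transform g \<omega>"
  show t: "is_fourier_transform (\<lambda>x. a * f x + b * g x) ?H"
    by (rule is_fourier_transform_add[OF F(1) G(1)])
  have "W \<omega> * (cmod (?H \<omega>))\<^sup>2 = a\<^sup>2 * (W \<omega> * (cmod (fourier_transform f \<omega>))\<^sup>2)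
     + b\<^sup>2 * (W \<omega> * (cmod (fourier_transform g \<omega>))\<^sup>2)
     + 2 * a * b * (W \<omega> * Re (fourier_transform f \<omega> * cnj (fourier_transform g \<omega>)))" for \<omega>
    unfolding cmod_power2 by (simp add: power2_eq_square algebra_simps)
  then have "integrable lborel (\<lambda>\<omega>. W \<omega> * (cmod (?H \<omega>))\<^sup>2)"
    by (simp only:) (intro Bochner_Integration.integrable_add integrable_mult_right F(3) G(3) inner_integrable F(4) G(4))
  moreover have "continuous_on UNIV (\<lambda>x. a * f x + b * g x)"
    by (intro continuous_intros F(2) G(2))
  ultimately show "(\<lambda>x. a * f x + b * g x) \<in> S"
    by (simp add: mem_iff[OF t])
qed

lemma inversion:
  assumes "f \<in> S"
  shows "complex_of_real (f x) = ft (fourier_transform f) (- x)"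
  using mem_transform[OF assms] by (intro fourier_transform_inversion weighted_L2_integrable(1)) auto

text \<open>Plancherel's equality for the limit transform \<open>G\<close>, which \<open>is_fourier_transform_inverse\<close> asks for, is
  inherited from the members of the sequence.\<close>

lemma complete:
  fixes s :: "nat \<Rightarrow> real^'d \<Rightarrow> real"
  assumes s: "\<And>n. s n \<in> S"
    and C: "\<And>e. e > 0 \<Longrightarrow> \<exists>N. \<forall>i\<ge>N. \<forall>j\<ge>N. ip_norm (sobolev_inner m) (\<lambda>x. s i x - s j x) < e"
  shows "\<exists>f\<in>S. (\<lambda>n. ip_norm (sobolev_inner m) (\<lambda>x. s n x - f x)) \<longlonglongrightarrow> 0"
proof -
  define F where "F n = fourier_transform (s n)" for n
  note Ft = mem_transform[OF s, folded F_def]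
  note [measurable] = Ft(4)
  \<comment> \<open>Multiplication by the square root of the weight is an isometry from the Sobolev
    norm to plain L2, where \<open>L2_complete\<close> supplies the limit.\<close>
  define r where "r \<omega> = complex_of_real (sqrt (W \<omega>))" for \<omega>
  have [measurable]: "r \<in> borel_measurable borel" unfolding r_def by measurable
  have r: "(cmod (r \<omega> * z))\<^sup>2 = W \<omega> * (cmod z)\<^sup>2" and r0: "r \<omega> \<noteq> 0" for \<omega> z
    using W_pos[of \<omega>] by (auto simp: r_def norm_mult power_mult_distrib)
  define U where "U n \<omega> = r \<omega> * F n \<omega>" for n \<omega>
  have [measurable]: "U n \<in> borel_measurable borel" for n unfolding U_def by measurable
  have diff_t: "is_fourier_transform (\<lambda>x. s i x - s j x) (\<lambda>\<omega>. F i \<omega> - F j \<omega>)" for i j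
    using is_fourier_transform_add[OF Ft(1)[of i] Ft(1)[of j], of 1 "-1"] by simp
  have diff_mem: "(\<lambda>x. s i x - s j x) \<in> S" for i j
    using linear_mem(2)[OF s[of i] s[of j], of 1 "-1"] by simp
  have nU: "nsq (\<lambda>\<omega>. U i \<omega> - U j \<omega>) = ennreal (sobolev_inner m (\<lambda>x. s i x - s j x) (\<lambda>x. s i x - s j x))" for i j
  proof -
    have "integrable lborel (\<lambda>\<omega>. (cmod (r \<omega> * (F i \<omega> - F j \<omega>)))\<^sup>2)"
      unfolding r using diff_mem[of i j] mem_iff[OF diff_t[of i j]] by simp
    from nsq_eq_integral[OF this] show ?thesis
      unfolding inner_self[OF diff_t] r by (simp add: U_def right_diff_distrib)
  qed
  obtain V where [measurable]: "V \<in> borel_measurable borel" and V: "(\<lambda>n. nsq (\<lambda>\<omega>. U n \<omega> - V \<omega>)) \<longlonglongrightarrow> 0"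
  proof (rule L2_complete[of U])
    fix e :: real assume "e > 0"
    then obtain N where N: "\<And>i j. i \<ge> N \<Longrightarrow> j \<ge> N \<Longrightarrow> ip_norm (sobolev_inner m) (\<lambda>x. s i x - s j x) < sqrt e"
      using C[of "sqrt e"] by auto
    have "nsq (\<lambda>\<omega>. U i \<omega> - U j \<omega>) \<le> ennreal e" if "i \<ge> N" "j \<ge> N" for i j
      unfolding nU using N[OF that] by (intro ennreal_leI) (simp add: ip_norm_def)
    then show "\<exists>N. \<forall>m\<ge>N. \<forall>n\<ge>N. nsq (\<lambda>x. U m x - U n x) \<le> ennreal e" by blast
  qed measurable
  define G where "G \<omega> = V \<omega> / r \<omega>" for \<omega>
  have [measurable]: "G \<in> borel_measurable borel" unfolding G_def by measurable
  have VG: "V \<omega> = r \<omega> * G \<omega>" for \<omega> using r0 by (simp add: G_def)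
  have U2: "nsq (U n) < \<infinity>" for n
  proof -
    have "integrable lborel (\<lambda>\<omega>. (cmod (U n \<omega>))\<^sup>2)" unfolding U_def r by (rule Ft(3))
    then show ?thesis by (subst (asm) integrable_nsq_finite) auto
  qed
  have "nsq V < \<infinity>"
  proof -
    have "\<forall>\<^sub>F n in sequentially. nsq (\<lambda>\<omega>. U n \<omega> - V \<omega>) < 1" by (rule order_tendstoD(2)[OF V]) simp
    then obtain n where n: "nsq (\<lambda>\<omega>. U n \<omega> - V \<omega>) < 1" by (auto simp: eventually_sequentially)
    have "nsq V \<le> ennreal (1 + 1) * nsq (U n) + ennreal (1 + 1 / 1) * nsq (\<lambda>x. V x - U n x)"
      by (rule nsq_le) auto
    also have "\<dots> < \<infinity>"
      using U2[of n] n unfolding nsq_minus_commute[of V]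
      by (auto simp: ennreal_mult_less_top intro: less_trans)
    finally show ?thesis .
  qed
  then have "integrable lborel (\<lambda>\<omega>. (cmod (V \<omega>))\<^sup>2)" by (subst integrable_nsq_finite) auto
  then have WG: "integrable lborel (\<lambda>\<omega>. W \<omega> * (cmod (G \<omega>))\<^sup>2)" unfolding VG r .
  note G1 = weighted_L2_integrable[OF _ WG, simplified]
  \<comment> \<open>The weight is at least 1, so the weighted convergence dominates plain L2
    convergence of the transforms.\<close>
  have FG: "(\<lambda>n. nsq (\<lambda>\<omega>. F n \<omega> - G \<omega>)) \<longlonglongrightarrow> 0"
  proof (rule tendsto_sandwich[OF always_eventually[OF allI] always_eventually[OF allI] tendsto_const V])
    fix n
    show "nsq (\<lambda>\<omega>. F n \<omega> - G \<omega>) \<le> nsq (\<lambda>\<omega>. U n \<omega> - V \<omega>)"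
      unfolding nsq_def
    proof (intro nn_integral_mono ennreal_leI)
      fix \<omega>
      have "1 * (cmod (F n \<omega> - G \<omega>))\<^sup>2 \<le> W \<omega> * (cmod (F n \<omega> - G \<omega>))\<^sup>2"
        by (intro mult_right_mono W_ge_1) simp
      also have "\<dots> = (cmod (U n \<omega> - V \<omega>))\<^sup>2"
        unfolding r[symmetric] by (simp add: U_def VG right_diff_distrib)
      finally show "(cmod (F n \<omega> - G \<omega>))\<^sup>2 \<le> (cmod (U n \<omega> - V \<omega>))\<^sup>2" by simp
    qed
  qed simp
  have pt: "(\<lambda>n. complex_of_real (s n x)) \<longlonglongrightarrow> ft G (- x)" for x
  proof -
    \<comment> \<open>Pairing \<open>U n\<close> with \<open>g\<close> evaluates \<open>s n\<close>
      at \<open>x\<close>, up to a constant. Since \<open>inverse (W \<omega>)\<close> is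
      integrable, \<open>g\<close> is square integrable, and evaluation passes to the limit.\<close>
    define g where "g \<omega> = cis (\<omega> \<bullet> x) / r \<omega>" for \<omega>
    have [measurable]: "g \<in> borel_measurable borel" unfolding g_def by measurable
    have Ug: "U n \<omega> * g \<omega> = F n \<omega> * cis (\<omega> \<bullet> x)" and Vg: "V \<omega> * g \<omega> = G \<omega> * cis (\<omega> \<bullet> x)" for n \<omega>
      using r0 by (auto simp: U_def VG g_def)
    have "(cmod (g \<omega>))\<^sup>2 = inverse (W \<omega>)" for \<omega>
      using W_pos[of \<omega>] by (simp add: g_def r_def norm_divide power_divide inverse_eq_divide)
    then have "integrable lborel (\<lambda>\<omega>. (cmod (g \<omega>))\<^sup>2)" using W_inverse_integrable by simp
    then have g2: "nsq g < \<infinity>" by (subst (asm) integrable_nsq_finite) auto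
    have "(\<lambda>n. LINT \<omega>|lborel. U n \<omega> * g \<omega>) \<longlonglongrightarrow> (LINT \<omega>|lborel. V \<omega> * g \<omega>)"
    proof (rule tendsto_integral_mult_L2[OF _ _ _ _ _ V g2])
      show "integrable lborel (\<lambda>\<omega>. U n \<omega> * g \<omega>)" for n
        unfolding Ug by (intro integrable_mult_cis weighted_L2_integrable(1) Ft(3,4)) auto
      show "integrable lborel (\<lambda>\<omega>. V \<omega> * g \<omega>)"
        unfolding Vg by (intro integrable_mult_cis G1(1)) auto
    qed measurable
    from tendsto_mult[OF tendsto_const this, of "complex_of_real ((2 * pi) powr (- real DIM(real^'d) / 2))"]
    have "(\<lambda>n. ft (F n) (- x)) \<longlonglongrightarrow> ft G (- x)"
      unfolding Ug Vg ft_def by simp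
    then show ?thesis unfolding F_def inversion[OF s, symmetric] .
  qed
  define f where "f x = Re (ft G (- x))" for x
  \<comment> \<open>A limit of real values is real, so nothing is lost by taking the real
    part.\<close>
  have f: "complex_of_real (f x) = ft G (- x)" for x
  proof -
    have "(\<lambda>n. Im (complex_of_real (s n x))) \<longlonglongrightarrow> Im (ft G (- x))" by (rule tendsto_Im[OF pt])
    then have "Im (ft G (- x)) = 0" by (simp add: LIMSEQ_const_iff)
    then show ?thesis by (simp add: f_def complex_eq_iff)
  qed
  have cont: "continuous_on UNIV f"
    unfolding f_def
    by (intro continuous_on_Re continuous_on_compose2[OF continuous_on_ft[OF G1(1), of UNIV]] continuous_intros) auto
  have [measurable]: "f \<in> borel_measurable borel" by (rule borel_measurable_continuous_onI[OF cont])
  have [measurable]: "s n \<in> borel_measurable borel" for n by (rule borel_measurable_continuous_onI[OF Ft(2)])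
  have Fi: "integrable lborel (F n)" for n by (rule weighted_L2_integrable(1)[OF Ft(4,3)])
  have sf: "(\<lambda>n. nsq (\<lambda>x. complex_of_real (s n x) - complex_of_real (f x))) \<longlonglongrightarrow> 0"
  proof (rule tendsto_sandwich[OF always_eventually[OF allI] always_eventually[OF allI] tendsto_const FG])
    fix n
    have "nsq (\<lambda>x. complex_of_real (s n x) - complex_of_real (f x)) = nsq (\<lambda>x. ft (\<lambda>\<omega>. F n \<omega> - G \<omega>) (- x))"
      unfolding f inversion[OF s] F_def[symmetric] ft_diff[OF Fi G1(1)] ..
    also have "\<dots> = nsq (ft (\<lambda>\<omega>. F n \<omega> - G \<omega>))" by (rule nsq_reflect) measurable
    also have "\<dots> \<le> nsq (\<lambda>\<omega>. F n \<omega> - G \<omega>)"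
      by (intro nsq_ft_le Bochner_Integration.integrable_diff Fi G1(1))
    finally show "nsq (\<lambda>x. complex_of_real (s n x) - complex_of_real (f x)) \<le> nsq (\<lambda>\<omega>. F n \<omega> - G \<omega>)" .
  qed simp
  have "nsq G \<le> nsq (\<lambda>x. complex_of_real (f x))"
    by (rule nsq_tendsto_le[OF sequentially_bot _ _ _ _ sf FG nsq_fourier_transform_le[OF Ft(1)]]) measurable
  then have fG: "is_fourier_transform f G"
    by (intro is_fourier_transform_inverse G1 f)
  have fS: "f \<in> S" using mem_iff[OF fG] cont WG by simp
  have "ip_norm (sobolev_inner m) (\<lambda>x. s n x - f x) = sqrt (LINT \<omega>|lborel. W \<omega> * (cmod (F n \<omega> - G \<omega>))\<^sup>2)" for n
  proof -
    have "is_fourier_transform (\<lambda>x. s n x - f x) (\<lambda>\<omega>. F n \<omega> - G \<omega>)"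
      using is_fourier_transform_add[OF Ft(1)[of n] fG, of 1 "-1"] by simp
    from inner_self[OF this] show ?thesis by (simp add: ip_norm_def)
  qed
  moreover have "(\<lambda>n. sqrt (LINT \<omega>|lborel. W \<omega> * (cmod (F n \<omega> - G \<omega>))\<^sup>2)) \<longlonglongrightarrow> sqrt 0"
  proof (rule tendsto_real_sqrt)
    have "nsq (\<lambda>\<omega>. U n \<omega> - V \<omega>) = ennreal (LINT \<omega>|lborel. W \<omega> * (cmod (F n \<omega> - G \<omega>))\<^sup>2)" for n
    proof -
      have t: "is_fourier_transform (\<lambda>x. s n x - f x) (\<lambda>\<omega>. F n \<omega> - G \<omega>)"
        using is_fourier_transform_add[OF Ft(1)[of n] fG, of 1 "-1"] by simp
      have "(\<lambda>x. s n x - f x) \<in> S" using linear_mem(2)[OF s[of n] fS, of 1 "-1"] by simp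
      then have "integrable lborel (\<lambda>\<omega>. (cmod (r \<omega> * (F n \<omega> - G \<omega>)))\<^sup>2)"
        unfolding r using mem_iff[OF t] by simp
      from nsq_eq_integral[OF this] show ?thesis
        unfolding r by (simp add: U_def VG right_diff_distrib)
    qed
    then have "(\<lambda>n. ennreal (LINT \<omega>|lborel. W \<omega> * (cmod (F n \<omega> - G \<omega>))\<^sup>2)) \<longlonglongrightarrow> ennreal 0"
      using V by simp
    moreover have "0 \<le> (LINT \<omega>|lborel. W \<omega> * (cmod (F n \<omega> - G \<omega>))\<^sup>2)" for n
      using W_pos by (intro Bochner_Integration.integral_nonneg) (simp add: less_imp_le)
    ultimately show "(\<lambda>n. LINT \<omega>|lborel. W \<omega> * (cmod (F n \<omega> - G \<omega>))\<^sup>2) \<longlonglongrightarrow> 0"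
      by (subst (asm) tendsto_ennreal_iff) (auto intro!: always_eventually)
  qed
  ultimately have "(\<lambda>n. ip_norm (sobolev_inner m) (\<lambda>x. s n x - f x)) \<longlonglongrightarrow> 0" by simp
  then show ?thesis using fS by blast
qed

lemma hilbert: "hilbert_function_space S (sobolev_inner m)"
  unfolding hilbert_function_space_def
proof (intro conjI ballI allI impI)
  show "(\<lambda>x. 0) \<in> S" using mem_iff[OF is_fourier_transform_zero] by simp
  show add: "(\<lambda>x. f x + g x) \<in> S" if "f \<in> S" "g \<in> S" for f g
    using linear_mem(2)[OF that, of 1 1] by simp
  show scale: "(\<lambda>x. a * f x) \<in> S" if "f \<in> S" for f a
    using linear_mem(2)[OF that that, of a 0] by simp
  show "sobolev_inner m f g = sobolev_inner m g f" for f g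
    unfolding sobolev_inner_def by (simp add: mult.commute)
  show "sobolev_inner m (\<lambda>x. f x + g x) h = sobolev_inner m f h + sobolev_inner m g h"
    if "f \<in> S" "g \<in> S" "h \<in> S" for f g h
  proof -
    note F = mem_transform[OF that(1)] and G = mem_transform[OF that(2)] and H = mem_transform[OF that(3)]
    have t: "is_fourier_transform (\<lambda>x. f x + g x) (\<lambda>\<omega>. fourier_transform f \<omega> + fourier_transform g \<omega>)"
      using linear_mem(1)[OF that(1,2), of 1 1] by simp
    have "sobolev_inner m (\<lambda>x. f x + g x) h = (LINT \<omega>|lborel. W \<omega> * Re (fourier_transform f \<omega> * cnj (fourier_transform h \<omega>))
        + W \<omega> * Re (fourier_transform g \<omega> * cnj (fourier_transform h \<omega>)))"
      unfolding inner_eq[OF t H(1)]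
      by (intro Bochner_Integration.integral_cong refl) (simp only: distrib_right distrib_left plus_complex.sel)
    also have "\<dots> = sobolev_inner m f h + sobolev_inner m g h"
      unfolding inner_eq[OF F(1) H(1)] inner_eq[OF G(1) H(1)]
      by (intro Bochner_Integration.integral_add inner_integrable F G H)
    finally show ?thesis .
  qed
  show "sobolev_inner m (\<lambda>x. a * f x) g = a * sobolev_inner m f g" if "f \<in> S" "g \<in> S" for a f g
  proof -
    note F = mem_transform[OF that(1)] and G = mem_transform[OF that(2)]
    have t: "is_fourier_transform (\<lambda>x. a * f x) (\<lambda>\<omega>. complex_of_real a * fourier_transform f \<omega>)"
      using linear_mem(1)[OF that(1,1), of a 0] by simp
    show ?thesis
      unfolding inner_eq[OF t G(1)] inner_eq[OF F(1) G(1)] integral_mult_right_zero[symmetric]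
      by (intro Bochner_Integration.integral_cong refl) (simp add: algebra_simps)
  qed
  show "0 \<le> sobolev_inner m f f" if "f \<in> S" for f
    unfolding inner_self[OF mem_transform(1)[OF that]]
    using W_pos by (intro Bochner_Integration.integral_nonneg) (simp add: less_imp_le)
  show "f = (\<lambda>x. 0)" if f: "f \<in> S" and 0: "sobolev_inner m f f = 0" for f
  proof
    fix x
    note F = mem_transform[OF f]
    have [measurable]: "fourier_transform f \<in> borel_measurable borel" by (rule F(4))
    have "AE \<omega> in lborel. W \<omega> * (cmod (fourier_transform f \<omega>))\<^sup>2 = 0"
      using 0 unfolding inner_self[OF F(1)]
      by (subst (asm) integral_nonneg_eq_0_iff_AE[OF F(3)]) (use W_pos in \<open>auto simp: less_imp_le\<close>)
    then have "AE \<omega> in lborel. fourier_transform f \<omega> = 0"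
    proof eventually_elim
      case (elim \<omega>)
      then show ?case using W_pos[of \<omega>] by simp
    qed
    then have "ft (fourier_transform f) = ft (\<lambda>\<omega>. 0)" by (intro ft_eq_AE) auto
    then have "complex_of_real (f x) = 0" unfolding inversion[OF f] by (simp add: ft_def)
    then show "f x = 0" by simp
  qed
  show "\<exists>f\<in>S. (\<lambda>n. ip_norm (sobolev_inner m) (\<lambda>x. s n x - f x)) \<longlonglongrightarrow> 0"
    if "(\<forall>n. s n \<in> S) \<and> (\<forall>e>0. \<exists>N::nat. \<forall>i\<ge>N. \<forall>j\<ge>N. ip_norm (sobolev_inner m) (\<lambda>x. s i x - s j x) < e)" for s
    using that by (intro complete) auto
qed

section \<open>The reproducing kernel of the Sobolev space\<close>

definition C0 :: real where "C0 = (2 * pi) powr (- real CARD('d) / 2)"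

text \<open>The Whittle-Matern kernel up to a positive factor, given by its spectral density. One
  factor \<open>C0\<close> belongs to the inverse transform, the other to the representer of point
  evaluation in \<open>kernel_transform\<close>.\<close>

definition kernel :: "real^'d \<Rightarrow> real^'d \<Rightarrow> real" where
  "kernel x y = Re (LINT \<omega>|lborel. complex_of_real (C0\<^sup>2 * inverse (W \<omega>)) * cis ((x - y) \<bullet> \<omega>))"

text \<open>The density is even, so reflecting the frequency conjugates the integral without
  changing it: the real part in \<open>kernel\<close> is the whole integral.\<close>

lemma kernel_eq:
  "complex_of_real (kernel x y) = (LINT \<omega>|lborel. complex_of_real (C0\<^sup>2 * inverse (W \<omega>)) * cis ((x - y) \<bullet> \<omega>))"
proof -
  let ?I = "LINT \<omega>|lborel. complex_of_real (C0\<^sup>2 * inverse (W \<omega>)) * cis ((x - y) \<bullet> \<omega>)"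
  have "?I = (LINT \<omega>|lborel. complex_of_real (C0\<^sup>2 * inverse (W \<omega>)) * cis (- ((x - y) \<bullet> \<omega>)))"
    by (subst lborel_integral_affine[where c="-1" and t=0]) (auto simp: W_def)
  also have "\<dots> = cnj ?I"
    unfolding Bochner_Integration.integral_cnj[symmetric] by (simp add: cis_cnj)
  finally have "Im ?I = 0" by (metis Im_complex_of_real Reals_cnj_iff complex_is_Real_iff)
  then show ?thesis unfolding kernel_def by (simp add: complex_eq_iff)
qed

text \<open>Chosen so that the weight \<open>W\<close> cancels in the inner product with a member of
  the space and leaves the inversion integral at \<open>y\<close>.\<close>

definition kernel_transform :: "real^'d \<Rightarrow> real^'d \<Rightarrow> complex" where
  "kernel_transform y \<omega> = complex_of_real (C0 * inverse (W \<omega>)) * cis (- (y \<bullet> \<omega>))"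

lemma kernel_transform_props:
  shows "kernel_transform y \<in> borel_measurable borel"
    and "integrable lborel (\<lambda>\<omega>. W \<omega> * (cmod (kernel_transform y \<omega>))\<^sup>2)"
    and "is_fourier_transform (\<lambda>x. kernel x y) (kernel_transform y)"
    and "continuous_on UNIV (\<lambda>x. kernel x y)"
proof -
  let ?G = "kernel_transform y"
  show meas [measurable]: "?G \<in> borel_measurable borel" unfolding kernel_transform_def by measurable
  have "W \<omega> * (cmod (?G \<omega>))\<^sup>2 = C0\<^sup>2 * inverse (W \<omega>)" for \<omega>
  proof -
    have "cmod (?G \<omega>) = \<bar>C0\<bar> * inverse (W \<omega>)"
      using W_pos[of \<omega>] by (simp add: kernel_transform_def norm_mult norm_inverse)
    then show ?thesis
      using W_pos[of \<omega>] by (simp add: power_mult_distrib power2_eq_square[of "inverse _"])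
  qed
  then show WG: "integrable lborel (\<lambda>\<omega>. W \<omega> * (cmod (?G \<omega>))\<^sup>2)"
    using W_inverse_integrable by simp
  note G = weighted_L2_integrable[OF meas WG]
  have inv: "complex_of_real (kernel x y) = ft ?G (- x)" for x
  proof -
    have "complex_of_real (kernel x y) = (LINT \<omega>|lborel. complex_of_real C0 * (?G \<omega> * cis (- (\<omega> \<bullet> - x))))"
      unfolding kernel_eq
    proof (intro Bochner_Integration.integral_cong refl)
      fix \<omega>
      have "cis ((x - y) \<bullet> \<omega>) = cis (- (y \<bullet> \<omega>)) * cis (- (\<omega> \<bullet> - x))"
      proof -
        have "(x - y) \<bullet> \<omega> = - (y \<bullet> \<omega>) + - (\<omega> \<bullet> - x)" by (simp add: inner_diff_left inner_commute[of \<omega>])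
        then show ?thesis by (simp only: cis_mult)
      qed
      then show "complex_of_real (C0\<^sup>2 * inverse (W \<omega>)) * cis ((x - y) \<bullet> \<omega>) = complex_of_real C0 * (?G \<omega> * cis (- (\<omega> \<bullet> - x)))"
        by (simp add: kernel_transform_def power2_eq_square)
    qed
    then show ?thesis by (simp add: ft_def C0_def)
  qed
  have "isCont W \<omega>" for \<omega>
    unfolding W_def by (intro continuous_intros) (auto simp: add_nonneg_eq_0_iff)
  then have cG: "isCont ?G \<omega>" for \<omega>
    unfolding kernel_transform_def using W_pos[of \<omega>]
    by (intro continuous_intros) (auto intro!: isCont_o2[OF _ isCont_cis] continuous_intros)
  have bG: "cmod (?G \<omega>) \<le> \<bar>C0\<bar>" for \<omega>
    using W_ge_1[of \<omega>] by (simp add: kernel_transform_def norm_mult norm_inverse inverse_le_1_iff mult_left_le)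
  \<comment> \<open>\<open>?G\<close> is bounded and continuous, so Plancherel's equality is
    available on the frequency side; it is the remaining premise of
    \<open>is_fourier_transform_inverse\<close>.\<close>
  have "nsq (\<lambda>x. complex_of_real (kernel x y)) = nsq ?G"
    unfolding inv nsq_reflect[OF borel_measurable_ft[OF meas]] by (rule Plancherel_bounded_continuous[OF G(1) bG cG])
  then show "is_fourier_transform (\<lambda>x. kernel x y) ?G"
    by (intro is_fourier_transform_inverse G inv) simp
  have "continuous_on UNIV (\<lambda>x. Re (ft ?G (- x)))"
    by (intro continuous_on_Re continuous_on_compose2[OF continuous_on_ft[OF G(1), of UNIV]] continuous_intros) auto
  then show "continuous_on UNIV (\<lambda>x. kernel x y)" unfolding inv[symmetric] by simp
qed

lemma native: "native_space kernel S (sobolev_inner m)"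
  unfolding native_space_def
proof (intro conjI allI ballI)
  show "hilbert_function_space S (sobolev_inner m)" by (rule hilbert)
  fix y
  note G = kernel_transform_props[of y]
  show "(\<lambda>x. kernel x y) \<in> S" using mem_iff[OF G(3)] G(2,4) by simp
  fix f assume f: "f \<in> S"
  note F = mem_transform[OF f]
  have i: "integrable lborel (\<lambda>\<omega>. complex_of_real C0 * (fourier_transform f \<omega> * cis (- (\<omega> \<bullet> - y))))"
    by (intro integrable_mult_right integrable_mult_cis weighted_L2_integrable(1) F) auto
  have "sobolev_inner m f (\<lambda>x. kernel x y) = (LINT \<omega>|lborel. Re (complex_of_real C0 * (fourier_transform f \<omega> * cis (- (\<omega> \<bullet> - y)))))"
    unfolding inner_eq[OF F(1) G(3)]
  proof (intro Bochner_Integration.integral_cong refl)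
    fix \<omega>
    have "fourier_transform f \<omega> * cnj (kernel_transform y \<omega>) =
        complex_of_real (inverse (W \<omega>)) * (complex_of_real C0 * (fourier_transform f \<omega> * cis (- (\<omega> \<bullet> - y))))"
      by (simp add: kernel_transform_def cis_cnj inner_commute mult_ac)
    then show "W \<omega> * Re (fourier_transform f \<omega> * cnj (kernel_transform y \<omega>)) =
        Re (complex_of_real C0 * (fourier_transform f \<omega> * cis (- (\<omega> \<bullet> - y))))"
    proof -
      assume eq: "fourier_transform f \<omega> * cnj (kernel_transform y \<omega>) =
        complex_of_real (inverse (W \<omega>)) * (complex_of_real C0 * (fourier_transform f \<omega> * cis (- (\<omega> \<bullet> - y))))"
      have "Re (complex_of_real t * z) = t * Re z" for t z by simp
      moreover have "W \<omega> * (inverse (W \<omega>) * t) = t" for t using W_pos[of \<omega>] by simp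
      ultimately show ?thesis unfolding eq by (simp only:)
    qed
  qed
  also have "\<dots> = Re (ft (fourier_transform f) (- y))"
    unfolding integral_Re[OF i] by (simp add: ft_def C0_def)
  also have "\<dots> = f y" using inversion[OF f, of y] by (metis Re_complex_of_real)
  finally show "f y = sobolev_inner m f (\<lambda>x. kernel x y)" ..
qed

text \<open>By \<open>W_lower\<close> and \<open>W_upper\<close> the weight lies between
  \<open>(1 + norm \<omega> powr (2 * m)) / 2\<close> and
  \<open>2 powr m * (1 + norm \<omega> powr (2 * m))\<close>. Inverting these bounds gives the two
  constants and the exponent \<open>\<tau> = 2 * m\<close>.\<close>

lemma decaying: "decaying_kernel kernel S (sobolev_inner m) (\<lambda>\<omega>. C0\<^sup>2 * inverse (W \<omega>)) (2 * m)
   (C0\<^sup>2 * inverse (2 powr m)) (2 * C0\<^sup>2)"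
proof unfold_locales
  show "native_space kernel S (sobolev_inner m)" by (rule native)
  show "2 * m > real CARD('d)" using m by simp
  show "(\<lambda>\<omega>. C0\<^sup>2 * inverse (W \<omega>)) \<in> borel_measurable borel" by measurable
  show "C0\<^sup>2 * inverse (2 powr m) > 0" by (simp add: C0_def)
  fix \<omega> :: "real^'d"
  have p: "1 + norm \<omega> powr (2 * m) > 0" by (simp add: add_pos_nonneg)
  have "inverse (2 powr m * (1 + norm \<omega> powr (2 * m))) \<le> inverse (W \<omega>)"
    by (intro le_imp_inverse_le W_upper W_pos)
  then show "C0\<^sup>2 * inverse (2 powr m) * inverse (1 + norm \<omega> powr (2 * m)) \<le> C0\<^sup>2 * inverse (W \<omega>)"
    by (simp add: mult_left_mono mult.assoc)
  have "inverse (2 * W \<omega>) \<le> inverse (1 + norm \<omega> powr (2 * m))"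
    by (intro le_imp_inverse_le W_lower p)
  then have "inverse (W \<omega>) \<le> 2 * inverse (1 + norm \<omega> powr (2 * m))" by simp
  then have "C0\<^sup>2 * inverse (W \<omega>) \<le> C0\<^sup>2 * (2 * inverse (1 + norm \<omega> powr (2 * m)))"
    by (intro mult_left_mono) auto
  then show "C0\<^sup>2 * inverse (W \<omega>) \<le> 2 * C0\<^sup>2 * inverse (1 + norm \<omega> powr (2 * m))" by (simp add: mult_ac)
next
  show "complex_of_real (kernel x y) = (LINT \<omega>|lborel. complex_of_real (C0\<^sup>2 * inverse (W \<omega>)) * cis ((x - y) \<bullet> \<omega>))" for x y
    by (rule kernel_eq)
qed

end

section \<open>From the transform of \<Phi> to a spectral density of K\<close>

text \<open>The upper bound with \<open>\<tau> > d\<close> makes \<open>\<Phi>hat\<close>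
  integrable, and \<open>\<Phi>\<close> inherits continuity from the section of \<open>K\<close>
  with second argument 0. Hence the L2 transform inverts at every point and not merely almost
  everywhere. The constant \<open>C0\<close> of the inverse transform is absorbed in the
  density.\<close>

lemma decaying_kernel_of_fourier_transform:
  fixes K :: "real^'d \<Rightarrow> real^'d \<Rightarrow> real"
  assumes \<tau>: "\<tau> > real CARD('d)" and cont: "continuous_on UNIV (\<lambda>(x, y). K x y)"
    and K: "\<And>x y. K x y = \<Phi> (x - y)"
    and t: "is_fourier_transform \<Phi> (\<lambda>\<omega>. complex_of_real (\<Phi>hat \<omega>))"
    and c: "0 < c" and lower: "\<And>\<omega>. c * inverse (1 + norm \<omega> powr \<tau>) \<le> \<Phi>hat \<omega>"
    and upper: "\<And>\<omega>. \<Phi>hat \<omega> \<le> C * inverse (1 + norm \<omega> powr \<tau>)"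
    and native: "native_space K H ip"
  defines "C0 \<equiv> (2 * pi) powr (- real CARD('d) / 2)"
  shows "decaying_kernel K H ip (\<lambda>\<omega>. C0 * \<Phi>hat \<omega>) \<tau> (C0 * c) (C0 * C)"
proof -
  have C0: "C0 > 0" by (simp add: C0_def)
  have cm: "(\<lambda>\<omega>. complex_of_real (\<Phi>hat \<omega>)) \<in> borel_measurable borel"
    using t unfolding is_fourier_transform_iff by auto
  have "Re \<in> borel_measurable borel"
    by (intro borel_measurable_continuous_onI continuous_intros)
  from measurable_compose[OF cm this] have [measurable]: "\<Phi>hat \<in> borel_measurable borel" by simp
  have pos: "\<Phi>hat \<omega> > 0" for \<omega>
  proof -
    have "0 < c * inverse (1 + norm \<omega> powr \<tau>)" using c by (simp add: add_pos_nonneg)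
    also note lower
    finally show ?thesis .
  qed
  have i: "integrable lborel \<Phi>hat"
  proof (rule Bochner_Integration.integrable_bound)
    show "integrable lborel (\<lambda>\<omega>::real^'d. C * inverse (1 + norm \<omega> powr \<tau>))"
      using \<tau> by (intro integrable_mult_right integrable_decay) simp
    show "AE \<omega> in lborel. norm (\<Phi>hat \<omega>) \<le> norm (C * inverse (1 + norm \<omega> powr \<tau>))"
    proof (intro AE_I2)
      fix \<omega>
      show "norm (\<Phi>hat \<omega>) \<le> norm (C * inverse (1 + norm \<omega> powr \<tau>))"
        using pos[of \<omega>] upper[of \<omega>] unfolding real_norm_def by linarith
    qed
  qed measurable
  have "continuous_on UNIV (\<lambda>z. (\<lambda>(x, y). K x y) (z, 0))"
    by (intro continuous_on_compose2[OF cont] continuous_intros) auto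
  then have "continuous_on UNIV \<Phi>" by (simp add: K)
  from fourier_transform_inversion[OF t this integrable_of_real[OF i]]
  have inv: "complex_of_real (\<Phi> z) = complex_of_real C0 * (LINT \<omega>|lborel. complex_of_real (\<Phi>hat \<omega>) * cis (z \<bullet> \<omega>))" for z
    by (simp add: ft_def C0_def inner_commute)
  show ?thesis
  proof unfold_locales
    show "native_space K H ip" by (rule native)
    show "real CARD('d) < \<tau>" by (rule \<tau>)
    show "(\<lambda>\<omega>. C0 * \<Phi>hat \<omega>) \<in> borel_measurable borel" by measurable
    show "0 < C0 * c" using C0 c by simp
    show "C0 * c * inverse (1 + norm \<omega> powr \<tau>) \<le> C0 * \<Phi>hat \<omega>" for \<omega>
      unfolding mult.assoc using C0 by (intro mult_left_mono lower) simp
    show "C0 * \<Phi>hat \<omega> \<le> C0 * C * inverse (1 + norm \<omega> powr \<tau>)" for \<omega>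
      unfolding mult.assoc using C0 by (intro mult_left_mono upper) simp
    show "complex_of_real (K x y) = (LINT \<omega>|lborel. complex_of_real (C0 * \<Phi>hat \<omega>) * cis ((x - y) \<bullet> \<omega>))" for x y
      by (simp add: K inv mult.assoc)
  qed
qed

theorem theorem7:
  "(\<forall>(\<tau>::real) (K :: real^'d \<Rightarrow> real^'d \<Rightarrow> real) \<Phi> \<Phi>hat H ip.
      \<tau> > real CARD('d) \<and>
      continuous_on UNIV (\<lambda>(x, y). K x y) \<and>
      (\<forall>x y. K x y = K y x) \<and>
      pos_def_kernel K \<and>
      (\<forall>x y. K x y = \<Phi> (x - y)) \<and>
      is_fourier_transform \<Phi> (\<lambda>\<omega>. complex_of_real (\<Phi>hat \<omega>)) \<and>
      (\<exists>c C. 0 < c \<and> c \<le> C \<and>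
         (\<forall>\<omega>. c * inverse (1 + norm \<omega> powr \<tau>) \<le> \<Phi>hat \<omega> \<and>
              \<Phi>hat \<omega> \<le> C * inverse (1 + norm \<omega> powr \<tau>))) \<and>
      native_space K H ip
      \<longrightarrow>
      (\<forall>r>0. (\<exists>!b. b \<in> bumps H r \<and> ip_norm ip b = bump_norm H ip r) \<and>
             bump_norm H ip r = ip_norm ip (optimal_bump H ip r)) \<and>
      (\<exists>c' C' r0. 0 < c' \<and> c' \<le> C' \<and> 0 < r0 \<and>
         (\<forall>r. 0 < r \<and> r \<le> r0 \<longrightarrow>
            c' * r powr (real CARD('d) / 2 - \<tau> / 2) \<le> bump_norm H ip r \<and>
            bump_norm H ip r \<le> C' * r powr (real CARD('d) / 2 - \<tau> / 2))))
   \<and>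
   (\<forall>m::real. m > real CARD('d) / 2 \<longrightarrow>
      (let H = (sobolev_space m :: (real^'d \<Rightarrow> real) set); ip = sobolev_inner m; \<tau> = 2 * m in
       (\<forall>r>0. (\<exists>!b. b \<in> bumps H r \<and> ip_norm ip b = bump_norm H ip r) \<and>
              bump_norm H ip r = ip_norm ip (optimal_bump H ip r)) \<and>
       (\<exists>c' C' r0. 0 < c' \<and> c' \<le> C' \<and> 0 < r0 \<and>
          (\<forall>r. 0 < r \<and> r \<le> r0 \<longrightarrow>
             c' * r powr (real CARD('d) / 2 - \<tau> / 2) \<le> bump_norm H ip r \<and>
             bump_norm H ip r \<le> C' * r powr (real CARD('d) / 2 - \<tau> / 2)))))"
proof
  show "\<forall>(\<tau>::real) (K :: real^'d \<Rightarrow> real^'d \<Rightarrow> real) \<Phi> \<Phi>hat H ip.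
      \<tau> > real CARD('d) \<and>
      continuous_on UNIV (\<lambda>(x, y). K x y) \<and>
      (\<forall>x y. K x y = K y x) \<and>
      pos_def_kernel K \<and>
      (\<forall>x y. K x y = \<Phi> (x - y)) \<and>
      is_fourier_transform \<Phi> (\<lambda>\<omega>. complex_of_real (\<Phi>hat \<omega>)) \<and>
      (\<exists>c C. 0 < c \<and> c \<le> C \<and>
         (\<forall>\<omega>. c * inverse (1 + norm \<omega> powr \<tau>) \<le> \<Phi>hat \<omega> \<and>
              \<Phi>hat \<omega> \<le> C * inverse (1 + norm \<omega> powr \<tau>))) \<and>
      native_space K H ip
      \<longrightarrow>
      (\<forall>r>0. (\<exists>!b. b \<in> bumps H r \<and> ip_norm ip b = bump_norm H ip r) \<and>
             bump_norm H ip r = ip_norm ip (optimal_bump H ip r)) \<and>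
      (\<exists>c' C' r0. 0 < c' \<and> c' \<le> C' \<and> 0 < r0 \<and>
         (\<forall>r. 0 < r \<and> r \<le> r0 \<longrightarrow>
            c' * r powr (real CARD('d) / 2 - \<tau> / 2) \<le> bump_norm H ip r \<and>
            bump_norm H ip r \<le> C' * r powr (real CARD('d) / 2 - \<tau> / 2)))"
  proof (intro allI impI, elim conjE exE)
    fix \<tau> :: real and K :: "real^'d \<Rightarrow> real^'d \<Rightarrow> real" and \<Phi> \<Phi>hat H ip and c C :: real
    assume \<tau>: "\<tau> > real CARD('d)" and cont: "continuous_on UNIV (\<lambda>(x, y). K x y)"
      and K: "\<forall>x y. K x y = \<Phi> (x - y)"
      and t: "is_fourier_transform \<Phi> (\<lambda>\<omega>. complex_of_real (\<Phi>hat \<omega>))"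
      and c: "0 < c" and bounds: "\<forall>\<omega>. c * inverse (1 + norm \<omega> powr \<tau>) \<le> \<Phi>hat \<omega> \<and>
              \<Phi>hat \<omega> \<le> C * inverse (1 + norm \<omega> powr \<tau>)"
      and native: "native_space K H ip"
    show "(\<forall>r>0. (\<exists>!b. b \<in> bumps H r \<and> ip_norm ip b = bump_norm H ip r) \<and>
             bump_norm H ip r = ip_norm ip (optimal_bump H ip r)) \<and>
      (\<exists>c' C' r0. 0 < c' \<and> c' \<le> C' \<and> 0 < r0 \<and>
         (\<forall>r. 0 < r \<and> r \<le> r0 \<longrightarrow>
            c' * r powr (real CARD('d) / 2 - \<tau> / 2) \<le> bump_norm H ip r \<and>
            bump_norm H ip r \<le> C' * r powr (real CARD('d) / 2 - \<tau> / 2)))"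
      by (rule decaying_kernel.bump_norm_asymptotics[OF
            decaying_kernel_of_fourier_transform[OF \<tau> cont _ t c _ _ native]])
         (use K bounds in auto)
  qed
  show "\<forall>m::real. m > real CARD('d) / 2 \<longrightarrow>
      (let H = (sobolev_space m :: (real^'d \<Rightarrow> real) set); ip = sobolev_inner m; \<tau> = 2 * m in
       (\<forall>r>0. (\<exists>!b. b \<in> bumps H r \<and> ip_norm ip b = bump_norm H ip r) \<and>
              bump_norm H ip r = ip_norm ip (optimal_bump H ip r)) \<and>
       (\<exists>c' C' r0. 0 < c' \<and> c' \<le> C' \<and> 0 < r0 \<and>
          (\<forall>r. 0 < r \<and> r \<le> r0 \<longrightarrow>
             c' * r powr (real CARD('d) / 2 - \<tau> / 2) \<le> bump_norm H ip r \<and>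
             bump_norm H ip r \<le> C' * r powr (real CARD('d) / 2 - \<tau> / 2))))"
  proof (intro allI impI)
    fix m :: real
    assume "m > real CARD('d) / 2"
    then interpret sobolev m "TYPE('d)" by unfold_locales
    show "(let H = (sobolev_space m :: (real^'d \<Rightarrow> real) set); ip = sobolev_inner m; \<tau> = 2 * m in
       (\<forall>r>0. (\<exists>!b. b \<in> bumps H r \<and> ip_norm ip b = bump_norm H ip r) \<and>
              bump_norm H ip r = ip_norm ip (optimal_bump H ip r)) \<and>
       (\<exists>c' C' r0. 0 < c' \<and> c' \<le> C' \<and> 0 < r0 \<and>
          (\<forall>r. 0 < r \<and> r \<le> r0 \<longrightarrow>
             c' * r powr (real CARD('d) / 2 - \<tau> / 2) \<le> bump_norm H ip r \<and>
             bump_norm H ip r \<le> C' * r powr (real CARD('d) / 2 - \<tau> / 2))))"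
      unfolding Let_def by (rule decaying_kernel.bump_norm_asymptotics[OF decaying])
  qed
qed

end
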